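(* Consider the random initial value problem $\partial_t u+\partial_x f(u)=0$ on $(0,T)\times\mathbb{R}\times\Xi$ with $u(0,x,y)=u^0(x,y)$, and let $u$ be its random entropy solution. Let $u_h^n(x,y)$, $n=0,\ldots,N_t$, be the NISP numerical solution at the time points $t_0,\dots,t_{N_t}$, and let $\hat u^{sts}$ be the space-time-stochastic reconstruction, with space-time-stochastic residual $\mathcal{R}^{sts}=\partial_t\hat u^{sts}+\partial_x f(\hat u^{sts})$ (all defined in the context). Let $C_f$, $C_{\underline{\eta}}$, $C_{\overline{\eta}}$ be the constants introduced in the context, which bound the Hessians of $f$ and $\eta$ on a convex and compact set $\mathcal{C}\subset\mathcal{U}$. Then, for any $n=0,\ldots,N_t$, $$\begin{aligned}\|u(t_n,\cdot,\cdot)-u_h^n\|_{L^2_\xi(\Xi;L^2(\mathbb{R}))}^2\le{}& 2\|\hat u^{sts}(t_n,\cdot,\cdot)-u_h^n\|_{L^2_\xi(\Xi;L^2(\mathbb{R}))}^2\\&+2C_{\underline{\eta}}^{-1}\Big(\mathcal{E}^{sts}(t_n)+C_{\overline{\eta}}\,\mathcal{E}^{sts}_0\Big)\\&\quad\times\exp\Big(C_{\underline{\eta}}^{-1}\int_0^{t_n}\Big(C_{\overline{\eta}}C_f\|\partial_x\hat u^{sts}(t,\cdot,\cdot)\|_{L^\infty_\xi(\Xi;L^\infty(\mathbb{R}))}+C_{\overline{\eta}}^2\Big)\,\mathrm{d}t\Big),\end{aligned}$$ where $$\mathcal{E}^{sts}(t_n):=\|\mathcal{R}^{sts}\|^2_{L^2_\xi(\Xi;L^2((0,t_n)\times\mathbb{R}))},\qquad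 \mathcal{E}^{sts}_0:=\|u^0-\hat u^{sts}(0,\cdot,\cdot)\|^2_{L^2_\xi(\Xi;L^2(\mathbb{R}))}.$$
   Context: Random space. $\xi:\Omega\to\Xi\subset\mathbb{R}$ is a random variable on a probability space with probability density $w_\xi:\Xi\to\mathbb{R}_+$; $\Xi$ carries the law $\tilde{\mathbb{P}}$ of $\xi$. For a normed space $E$, $\|g\|_{L^p_\xi(\Xi;E)}=(\int_\Xi\|g(y)\|_E^p\,w_\xi(y)\,dy)^{1/p}$ for $1\le p<\infty$, and $\|g\|_{L^\infty_\xi(\Xi;E)}=\operatorname{ess\,sup}_{y\in\Xi}\|g(y)\|_E$. Indices in $\mathbb{N}$ start at $0$. Equation. $T\in(0,\infty)$, the state space $\mathcal{U}\subset\mathbb{R}^m$ is open, $f\in C^2(\mathcal{U};\mathbb{R}^m)$, and the system is strictly hyperbolic (the Jacobian $Df$ has $m$ distinct real eigenvalues). The system is equipped with an entropy/entropy-flux pair $(\eta,q)$: $\eta,q\in C^2(\mathcal{U};\mathbb{R})$, $\eta$ strictly convex, $D\eta\,Df=Dq$. A function $u\in L^1_\xi(\Xi;L^1((0,T)\times\mathbb{R};\mathcal{U}))$ is a random entropy solution if, for $\tilde{\mathbb{P}}$-almost every $y$, $u(\cdot,\cdot,y)$ is a classical entropy solution with initial datum $u^0(\cdot,y)$, i.e. a weak solution satisfying $\int_0^T\!\int_{\mathbb{R}}(\eta(u)\partial_t\varphi+q(u)\partial_x\varphi)\,dx\,dt+\int_{\mathbb{R}}\eta(u^0)\varphi(0,\cdot)\,dx\ge0$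 for all nonnegative Lipschitz test functions $\varphi$ with compact support in $[0,T)\times\mathbb{R}$. $u$ is assumed square-integrable with respect to $y\in\Xi$. Constants. Let $\mathcal{C}\subset\mathcal{U}$ be convex and compact. Since $f$ and $\eta$ are $C^2$ and $\eta$ is strictly convex, there exist constants $0<C_f<\infty$ and $0<C_{\underline{\eta}}<C_{\overline{\eta}}<\infty$ such that $$|v^\top Hf(w)v|\le C_f|v|^2,\qquad C_{\underline{\eta}}|v|^2\le v^\top H\eta(w)v\le C_{\overline{\eta}}|v|^2\qquad\text{for all }v\in\mathbb{R}^m,\ w\in\mathcal{C},$$ where $H\eta$ is the Hessian of $\eta$ and $Hf$ is the tensor of second derivatives of $f$. Discretization. $\{\Psi_i\}_{i\in\mathbb{N}}$ is an orthonormal basis of $L^2_\xi(\Xi)$, i.e. $\int_\Xi\Psi_i\Psi_jw_\xi\,dy=\delta_{ij}$. $M,R\in\mathbb{N}$; $y_0,\dots,y_R\in\Xi$ are quadrature points with weights $w_0,\dots,w_R$. $\mathcal{T}$ is a uniform triangulation of $\mathbb{R}$, $V_p^s=\{v:\mathbb{R}\to\mathbb{R}^m : v|_K\text{ is a polynomial of degree at most }p\text{ for all }K\in\mathcal{T}\}$, $p\in\mathbb{N}$, and $\{t_n\}_{n=0}^{N_t}$ is a partition of the time interval. For each $l=0,\dots,R$, $u_h^n(\cdot,y_l)\in V_p^s$ is the Runge–Kutta Discontinuous Galerkin approximation at time $t_n$ of the deterministic problem with initial datum $u^0(\cdot,y_l)$ (same triangulation and time partition for all $l$). The NISP (non-intrusive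 spectral projection) numerical solution is $$u_h^n(x,y)=\sum_{i=0}^M\Big(\sum_{l=0}^Ru_h^n(x,y_l)\Psi_i(y_l)w_l\Big)\Psi_i(y).$$ Reconstruction. For each $l$, $\hat u^{st}(y_l)\in W^{1}_\infty((0,T);V^s_{p+1}\cap C^0(\mathbb{R}))$ is a computable, Lipschitz continuous space-time reconstruction of $\{u_h^n(\cdot,y_l)\}_{n=0}^{N_t}$. Set $$\hat u^{st}_i=\sum_{l=0}^R\hat u^{st}(y_l)\Psi_i(y_l)w_l\ (i=0,\dots,M),\quad \hat u^{sts}(t,x,y)=\sum_{i=0}^M\hat u_i^{st}(t,x)\Psi_i(y),\quad \mathcal{R}^{sts}=\partial_t\hat u^{sts}+\partial_xf(\hat u^{sts}),$$ with $\mathcal{R}^{sts}\in L^2_\xi(\Xi;L^2((0,T)\times\mathbb{R};\mathbb{R}^m))$.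
   Formalization: It is additionally assumed that, for almost every y, both the random entropy solution u and the reconstruction û^{sts} take values in the convex compact set C almost everywhere; without this the constants on C do not control the error and the estimate can fail. *)

theory Defs
  imports
    "HOL-Probability.Probability"
    "HOL-Computational_Algebra.Polynomial"
begin

text \<open>
  All norms take values in \<open>[0, \<infinity>]\<close>, so that a norm of something outside the space is \<open>\<infinity>\<close>
  (and not \<open>0\<close>, as it would be with the Bochner integral). Norms of Bochner spaces
  \<open>L\<^sup>p(M; E)\<close> are obtained by feeding the \<open>E\<close>-norm, again as an extended number, to the outer norm.
\<close>

definition enn_powr :: "ennreal \<Rightarrow> real \<Rightarrow> ennreal" where
  "enn_powr a r = (if a = top then top else ennreal (enn2real a powr r))"

definition enn_exp :: "ennreal \<Rightarrow> ennreal" where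
  "enn_exp a = (if a = top then top else ennreal (exp (enn2real a)))"

definition Lp_norm :: "real \<Rightarrow> 'a measure \<Rightarrow> ('a \<Rightarrow> ennreal) \<Rightarrow> ennreal" where
  "Lp_norm p M g = enn_powr (\<integral>\<^sup>+ z. enn_powr (g z) p \<partial>M) (1 / p)"

definition law :: "real set \<Rightarrow> (real \<Rightarrow> real) \<Rightarrow> real measure" where
  "law \<Xi> w = density (restrict_space lborel \<Xi>) (\<lambda>y. ennreal (w y))"

definition slab :: "real \<Rightarrow> (real \<times> real) measure" where
  "slab T = restrict_space lborel ({0<..<T} \<times> UNIV)"

text \<open>The norms of \<open>L\<^sup>p\<^sub>\<xi>(\<Xi>; L\<^sup>r(\<real>))\<close>, \<open>L\<^sup>p\<^sub>\<xi>(\<Xi>; L\<^sup>r((0,T) \<times> \<real>))\<close> and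
  \<open>L\<^sup>\<infinity>\<^sub>\<xi>(\<Xi>; L\<^sup>\<infinity>(\<real>))\<close>, for \<open>P\<close> the law of \<open>\<xi>\<close>; the stochastic variable is the last argument.\<close>

definition norm_space_stoch ::
  "real \<Rightarrow> real \<Rightarrow> real measure \<Rightarrow> (real \<Rightarrow> real \<Rightarrow> 'b::real_normed_vector) \<Rightarrow> ennreal" where
  "norm_space_stoch p r P g =
     Lp_norm p P (\<lambda>y. Lp_norm r lborel (\<lambda>x. ennreal (norm (g x y))))"

definition norm_space_time_stoch ::
  "real \<Rightarrow> real \<Rightarrow> real \<Rightarrow> real measure \<Rightarrow> (real \<Rightarrow> real \<Rightarrow> real \<Rightarrow> 'b::real_normed_vector) \<Rightarrow> ennreal" where
  "norm_space_time_stoch p r T P g =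
     Lp_norm p P (\<lambda>y. Lp_norm r (slab T) (\<lambda>(t, x). ennreal (norm (g t x y))))"

definition sup_norm_space_stoch ::
  "real measure \<Rightarrow> (real \<Rightarrow> real \<Rightarrow> 'b::real_normed_vector) \<Rightarrow> ennreal" where
  "sup_norm_space_stoch P g =
     esssup P (\<lambda>y. esssup lborel (\<lambda>x. ennreal (norm (g x y))))"

definition D1 :: "('a::real_normed_vector \<Rightarrow> 'b::real_normed_vector) \<Rightarrow> 'a \<Rightarrow> 'a \<Rightarrow>\<^sub>L 'b" where
  "D1 f w = Blinfun (frechet_derivative f (at w))"

definition D2 :: "('a::real_normed_vector \<Rightarrow> 'b::real_normed_vector) \<Rightarrow> 'a \<Rightarrow> 'a \<Rightarrow>\<^sub>L 'a \<Rightarrow>\<^sub>L 'b" where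
  "D2 f w = D1 (D1 f) w"

definition C2_on :: "'a::real_normed_vector set \<Rightarrow> ('a \<Rightarrow> 'b::real_normed_vector) \<Rightarrow> bool" where
  "C2_on U f \<longleftrightarrow>
     (\<forall>w\<in>U. f differentiable (at w)) \<and> (\<forall>w\<in>U. D1 f differentiable (at w)) \<and>
     continuous_on U (D2 f)"

definition strictly_hyperbolic :: "(real^'m) set \<Rightarrow> (real^'m \<Rightarrow> real^'m) \<Rightarrow> bool" where
  "strictly_hyperbolic U f \<longleftrightarrow>
     (\<forall>w\<in>U. card {l::real. \<exists>v. v \<noteq> 0 \<and> jacobian f (at w) *v v = l *\<^sub>R v} = CARD('m))"

text \<open>The domain need not be convex, so strict convexity is required along the segments it contains.\<close>

definition strictly_convex_on :: "'a::real_vector set \<Rightarrow> ('a \<Rightarrow> real) \<Rightarrow> bool" where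
  "strictly_convex_on U g \<longleftrightarrow>
     (\<forall>a\<in>U. \<forall>b\<in>U. a \<noteq> b \<and> closed_segment a b \<subseteq> U \<longrightarrow>
        (\<forall>s. 0 < s \<and> s < 1 \<longrightarrow> g ((1 - s) *\<^sub>R a + s *\<^sub>R b) < (1 - s) * g a + s * g b))"

definition entropy_pair ::
  "(real^'m) set \<Rightarrow> (real^'m \<Rightarrow> real^'m) \<Rightarrow> (real^'m \<Rightarrow> real) \<Rightarrow> (real^'m \<Rightarrow> real) \<Rightarrow> bool" where
  "entropy_pair U f \<eta> q \<longleftrightarrow>
     C2_on U \<eta> \<and> C2_on U q \<and> strictly_convex_on U \<eta> \<and>
     (\<forall>w\<in>U. D1 \<eta> w o\<^sub>L D1 f w = D1 q w)"

definition test_function :: "real \<Rightarrow> (real \<times> real \<Rightarrow> real) \<Rightarrow> bool" where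
  "test_function T \<phi> \<longleftrightarrow>
     (\<exists>L. L-lipschitz_on ({0..<T} \<times> UNIV) \<phi>) \<and>
     (\<exists>K. compact K \<and> K \<subseteq> {0..<T} \<times> UNIV \<and> (\<forall>z\<in>{0..<T} \<times> UNIV - K. \<phi> z = 0))"

text \<open>
  Test functions are only Lipschitz; at the null set of points where a partial derivative does
  not exist, \<open>deriv\<close> has a fixed unspecified value. Existence of the integrals is part of the
  definitions of a solution.
\<close>

definition dt_test :: "(real \<times> real \<Rightarrow> real) \<Rightarrow> real \<times> real \<Rightarrow> real" where
  "dt_test \<phi> = (\<lambda>(t, x). deriv (\<lambda>s. \<phi> (s, x)) t)"

definition dx_test :: "(real \<times> real \<Rightarrow> real) \<Rightarrow> real \<times> real \<Rightarrow> real" where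
  "dx_test \<phi> = (\<lambda>(t, x). deriv (\<lambda>z. \<phi> (t, z)) x)"

definition weak_solution ::
  "real \<Rightarrow> (real^'m) set \<Rightarrow> (real^'m \<Rightarrow> real^'m) \<Rightarrow> (real \<Rightarrow> real^'m) \<Rightarrow>
   (real \<Rightarrow> real \<Rightarrow> real^'m) \<Rightarrow> bool" where
  "weak_solution T U f u0 u \<longleftrightarrow>
     (AE (t, x) in slab T. u t x \<in> U) \<and> (AE x in lborel. u0 x \<in> U) \<and>
     (\<forall>\<phi>. test_function T \<phi> \<longrightarrow>
        (let g = (\<lambda>(t, x). dt_test \<phi> (t, x) *\<^sub>R u t x + dx_test \<phi> (t, x) *\<^sub>R f (u t x));
             g0 = (\<lambda>x. \<phi> (0, x) *\<^sub>R u0 x)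
         in integrable (slab T) g \<and> integrable lborel g0 \<and>
            integral\<^sup>L (slab T) g + integral\<^sup>L lborel g0 = 0))"

definition entropy_solution ::
  "real \<Rightarrow> (real^'m) set \<Rightarrow> (real^'m \<Rightarrow> real^'m) \<Rightarrow> (real^'m \<Rightarrow> real) \<Rightarrow> (real^'m \<Rightarrow> real) \<Rightarrow>
   (real \<Rightarrow> real^'m) \<Rightarrow> (real \<Rightarrow> real \<Rightarrow> real^'m) \<Rightarrow> bool" where
  "entropy_solution T U f \<eta> q u0 u \<longleftrightarrow>
     weak_solution T U f u0 u \<and>
     (\<forall>\<phi>. test_function T \<phi> \<and> (\<forall>z\<in>{0..<T} \<times> UNIV. 0 \<le> \<phi> z) \<longrightarrow>
        (let g = (\<lambda>(t, x). \<eta> (u t x) * dt_test \<phi> (t, x) + q (u t x) * dx_test \<phi> (t, x));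
             g0 = (\<lambda>x. \<eta> (u0 x) * \<phi> (0, x))
         in integrable (slab T) g \<and> integrable lborel g0 \<and>
            integral\<^sup>L (slab T) g + integral\<^sup>L lborel g0 \<ge> 0))"

text \<open>
  An entropy solution is a class of functions modulo null sets of \<open>(0,T) \<times> \<real>\<close>. Its value
  \<open>u(t,\<cdot>)\<close> at a given time is that of its representative that is weakly continuous in time.
\<close>

definition weakly_continuous_in_time :: "real \<Rightarrow> (real \<Rightarrow> real \<Rightarrow> real^'m) \<Rightarrow> bool" where
  "weakly_continuous_in_time T u \<longleftrightarrow>
     (\<forall>\<psi>::real \<Rightarrow> real. (\<exists>L. L-lipschitz_on UNIV \<psi>) \<and> (\<exists>r. \<forall>x. r < \<bar>x\<bar> \<longrightarrow> \<psi> x = 0) \<longrightarrow>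
        (\<forall>t\<in>{0..T}. integrable lborel (\<lambda>x. \<psi> x *\<^sub>R u t x)) \<and>
        continuous_on {0..T} (\<lambda>t. LINT x|lborel. \<psi> x *\<^sub>R u t x))"

definition random_entropy_solution ::
  "real \<Rightarrow> real set \<Rightarrow> real measure \<Rightarrow> (real^'m) set \<Rightarrow> (real^'m \<Rightarrow> real^'m) \<Rightarrow>
   (real^'m \<Rightarrow> real) \<Rightarrow> (real^'m \<Rightarrow> real) \<Rightarrow>
   (real \<Rightarrow> real \<Rightarrow> real^'m) \<Rightarrow> (real \<Rightarrow> real \<Rightarrow> real \<Rightarrow> real^'m) \<Rightarrow> bool" where
  "random_entropy_solution T \<Xi> P U f \<eta> q u0 u \<longleftrightarrow>
     (\<lambda>(x, y). u0 x y) \<in> borel_measurable (restrict_space borel (UNIV \<times> \<Xi>)) \<and>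
     (\<lambda>(t, x, y). u t x y) \<in> borel_measurable (restrict_space borel ({0..T} \<times> UNIV \<times> \<Xi>)) \<and>
     norm_space_time_stoch 1 1 T P u < \<infinity> \<and>
     (AE y in P. entropy_solution T U f \<eta> q (\<lambda>x. u0 x y) (\<lambda>t x. u t x y) \<and>
                 weakly_continuous_in_time T (\<lambda>t x. u t x y))"

definition orthonormal_basis :: "real measure \<Rightarrow> (nat \<Rightarrow> real \<Rightarrow> real) \<Rightarrow> bool" where
  "orthonormal_basis P \<Psi> \<longleftrightarrow>
     (\<forall>i. \<Psi> i \<in> borel_measurable P \<and> integrable P (\<lambda>y. (\<Psi> i y)\<^sup>2)) \<and>
     (\<forall>i j. (LINT y|P. \<Psi> i y * \<Psi> j y) = (if i = j then 1 else 0)) \<and>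
     (\<forall>g. g \<in> borel_measurable P \<and> integrable P (\<lambda>y. (g y)\<^sup>2) \<longrightarrow>
        (\<lambda>N. LINT y|P. (g y - (\<Sum>i<N. (LINT z|P. g z * \<Psi> i z) * \<Psi> i y))\<^sup>2) \<longlonglongrightarrow> 0)"

text \<open>Non-intrusive spectral projection of functions \<open>g l\<close> attached to the quadrature
  points \<open>ys l\<close> with weights \<open>\<omega> l\<close>.\<close>

definition nisp ::
  "nat \<Rightarrow> nat \<Rightarrow> (nat \<Rightarrow> real \<Rightarrow> real) \<Rightarrow> (nat \<Rightarrow> real) \<Rightarrow> (nat \<Rightarrow> real) \<Rightarrow>
   (nat \<Rightarrow> real \<Rightarrow> real^'m) \<Rightarrow> real \<Rightarrow> real \<Rightarrow> real^'m" where
  "nisp M R \<Psi> ys \<omega> g x y =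
     (\<Sum>i\<le>M. \<Psi> i y *\<^sub>R (\<Sum>l\<le>R. (\<Psi> i (ys l) * \<omega> l) *\<^sub>R g l x))"

definition node :: "real \<Rightarrow> real \<Rightarrow> int \<Rightarrow> real" where
  "node a h j = a + of_int j * h"

definition cell :: "real \<Rightarrow> real \<Rightarrow> int \<Rightarrow> real set" where
  "cell a h j = {node a h j <..< node a h (j + 1)}"

text \<open>Cells are open: a discontinuous piecewise polynomial is double-valued at the nodes, and its
  (irrelevant) values there are left free.\<close>

definition dg_space :: "real \<Rightarrow> real \<Rightarrow> nat \<Rightarrow> (real \<Rightarrow> real^'m) set" where
  "dg_space a h p =
     {v. \<forall>j k. \<exists>c::real poly. degree c \<le> p \<and> (\<forall>x\<in>cell a h j. v x $ k = poly c x)}"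

definition numerical_flux ::
  "(real^'m) set \<Rightarrow> (real^'m \<Rightarrow> real^'m) \<Rightarrow> (real^'m \<Rightarrow> real^'m \<Rightarrow> real^'m) \<Rightarrow> bool" where
  "numerical_flux U f F \<longleftrightarrow>
     (\<forall>w\<in>U. F w w = f w) \<and>
     (\<forall>K. compact K \<and> K \<subseteq> U \<longrightarrow> (\<exists>L. L-lipschitz_on (K \<times> K) (\<lambda>(v, w). F v w)))"

definition flux_at_node ::
  "(real^'m \<Rightarrow> real^'m \<Rightarrow> real^'m) \<Rightarrow> real \<Rightarrow> real \<Rightarrow> (real \<Rightarrow> real^'m) \<Rightarrow> int \<Rightarrow> real^'m" where
  "flux_at_node F a h v j = F (Lim (at_left (node a h j)) v) (Lim (at_right (node a h j)) v)"

text \<open>\<open>z\<close> is the result of applying to \<open>v\<close> the spatial DG operator with numerical flux \<open>F\<close>.\<close>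

definition dg_operator ::
  "(real^'m \<Rightarrow> real^'m) \<Rightarrow> (real^'m \<Rightarrow> real^'m \<Rightarrow> real^'m) \<Rightarrow> real \<Rightarrow> real \<Rightarrow> nat \<Rightarrow>
   (real \<Rightarrow> real^'m) \<Rightarrow> (real \<Rightarrow> real^'m) \<Rightarrow> bool" where
  "dg_operator f F a h p v z \<longleftrightarrow>
     z \<in> dg_space a h p \<and>
     (\<forall>\<psi>\<in>dg_space a h p. \<forall>j.
        set_integrable lborel (cell a h j) (\<lambda>x. f (v x) \<bullet> vector_derivative \<psi> (at x)) \<and>
        (LINT x:cell a h j|lborel. z x \<bullet> \<psi> x) =
        (LINT x:cell a h j|lborel. f (v x) \<bullet> vector_derivative \<psi> (at x))
        - flux_at_node F a h v (j + 1) \<bullet> Lim (at_left (node a h (j + 1))) \<psi>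
        + flux_at_node F a h v j \<bullet> Lim (at_right (node a h j)) \<psi>)"

text \<open>One step of an explicit \<open>S\<close>-stage Runge-Kutta scheme in Shu-Osher form, with the
  limiter \<open>\<Lambda>\<close> (possibly the identity) applied after each stage.\<close>

definition rk_step ::
  "(real^'m \<Rightarrow> real^'m) \<Rightarrow> (real^'m \<Rightarrow> real^'m \<Rightarrow> real^'m) \<Rightarrow>
   ((real \<Rightarrow> real^'m) \<Rightarrow> (real \<Rightarrow> real^'m)) \<Rightarrow>
   nat \<Rightarrow> (nat \<Rightarrow> nat \<Rightarrow> real) \<Rightarrow> (nat \<Rightarrow> nat \<Rightarrow> real) \<Rightarrow>
   real \<Rightarrow> real \<Rightarrow> nat \<Rightarrow> real \<Rightarrow> (real \<Rightarrow> real^'m) \<Rightarrow> (real \<Rightarrow> real^'m) \<Rightarrow> bool" where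
  "rk_step f F \<Lambda> S \<alpha> \<beta> a h p dt v v' \<longleftrightarrow>
     (\<exists>W Z. W 0 = v \<and> W S = v' \<and>
        (\<forall>k<S. dg_operator f F a h p (W k) (Z k)) \<and>
        (\<forall>k\<in>{1..S}. W k = \<Lambda> (\<lambda>x. \<Sum>j<k. \<alpha> k j *\<^sub>R W j x + (\<beta> k j * dt) *\<^sub>R Z j x)))"

definition rkdg_approximation ::
  "(real^'m) set \<Rightarrow> (real^'m \<Rightarrow> real^'m) \<Rightarrow> (real^'m \<Rightarrow> real^'m \<Rightarrow> real^'m) \<Rightarrow>
   ((real \<Rightarrow> real^'m) \<Rightarrow> (real \<Rightarrow> real^'m)) \<Rightarrow>
   nat \<Rightarrow> (nat \<Rightarrow> nat \<Rightarrow> real) \<Rightarrow> (nat \<Rightarrow> nat \<Rightarrow> real) \<Rightarrow>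
   real \<Rightarrow> real \<Rightarrow> nat \<Rightarrow> nat \<Rightarrow> (nat \<Rightarrow> real) \<Rightarrow>
   (real \<Rightarrow> real^'m) \<Rightarrow> (nat \<Rightarrow> real \<Rightarrow> real^'m) \<Rightarrow> bool" where
  "rkdg_approximation U f F \<Lambda> S \<alpha> \<beta> a h p Nt ts u0 uh \<longleftrightarrow>
     numerical_flux U f F \<and>
     (\<forall>v\<in>dg_space a h p. \<Lambda> v \<in> dg_space a h p) \<and>
     1 \<le> S \<and> (\<forall>k\<in>{1..S}. (\<forall>j<k. 0 \<le> \<alpha> k j) \<and> (\<Sum>j<k. \<alpha> k j) = 1) \<and>
     (\<forall>n\<le>Nt. uh n \<in> dg_space a h p) \<and>
     (\<exists>v\<in>dg_space a h p. uh 0 = \<Lambda> v \<and>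
        (\<forall>\<psi>\<in>dg_space a h p. \<forall>j.
           set_integrable lborel (cell a h j) (\<lambda>x. (v x - u0 x) \<bullet> \<psi> x) \<and>
           (LINT x:cell a h j|lborel. (v x - u0 x) \<bullet> \<psi> x) = 0)) \<and>
     (\<forall>n<Nt. rk_step f F \<Lambda> S \<alpha> \<beta> a h p (ts (Suc n) - ts n) (uh n) (uh (Suc n)))"

text \<open>Joint Lipschitz continuity gives \<open>W\<^sup>1\<^sub>\<infinity>\<close> regularity in time, and makes the values at the
  end points of \<open>(0,T)\<close> meaningful.\<close>

definition space_time_reconstruction ::
  "real \<Rightarrow> real \<Rightarrow> real \<Rightarrow> nat \<Rightarrow> (real \<Rightarrow> real \<Rightarrow> real^'m) \<Rightarrow> bool" where
  "space_time_reconstruction T a h p v \<longleftrightarrow>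
     (\<forall>t\<in>{0..T}. v t \<in> dg_space a h (p + 1) \<and> continuous_on UNIV (v t)) \<and>
     (\<exists>L. L-lipschitz_on ({0..T} \<times> UNIV) (\<lambda>(t, x). v t x))"

definition residual ::
  "(real^'m \<Rightarrow> real^'m) \<Rightarrow> (real \<Rightarrow> real \<Rightarrow> real \<Rightarrow> real^'m) \<Rightarrow> real \<Rightarrow> real \<Rightarrow> real \<Rightarrow> real^'m" where
  "residual f v t x y =
     vector_derivative (\<lambda>s. v s x y) (at t) + vector_derivative (\<lambda>z. f (v t z y)) (at x)"

end

theory Submission
  imports Defs
begin

text \<open>
  Fix \<open>y\<close>. The reconstruction \<open>v\<close> is Lipschitz and solves the system up to the residual \<open>R\<close>, so testing
  the entropy inequality with \<open>\<phi>\<close> and the weak formulation with \<open>\<phi> D\<eta>(v)\<close> gives an inequality for the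
  relative entropy \<open>\<eta>(u|v)\<close>, which is comparable to \<open>|u - v|\<^sup>2\<close>. Its source is
  \<open>-D\<^sup>2\<eta>(v)(R, u - v) - D\<^sup>2\<eta>(v)(v\<^sub>x, f(u|v))\<close>, because \<open>D\<^sup>2\<eta> Df\<close> is symmetric.
  The weight \<open>\<phi>\<close> is the product of a cut-off in time, the integrating factor \<open>exp(-A(t))\<close>, which takes the place
  of Gronwall's lemma, and a weight supported in a cone that shrinks fast enough to absorb the relative
  entropy flux. This bounds time averages of \<open>\<parallel>u - v\<parallel>\<^sup>2\<close> just before \<open>t\<^sub>n\<close>; weak continuity in time and
  lower semicontinuity of the norm carry the bound to \<open>t\<^sub>n\<close> itself, and integration over \<open>y\<close> concludes.
\<close>

text \<open>Test functions and the reconstruction are merely Lipschitz, so chain rules hold only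
  almost everywhere, and partial derivatives must be Borel functions on the plane before Fubini
  applies; hence the start from Lebesgue differentiation. The constants arise as follows. Young's
  inequality splits Cu |R| |u - v| into halves of |R|^2 and Cu^2 |u - v|^2, Taylor's formula bounds
  |f(u|v)| by Cf/2 |u - v|^2, and |u - v|^2 is at most 2/Cl times the relative entropy. The growth
  rate is therefore (Cu Cf |v_x| + Cu^2)/Cl, and the remaining halves cancel against the Cl/2 of the
  lower entropy bound, which leaves 1/Cl in front. The outer factors 2 come from splitting u - u_h
  at the reconstruction. The exponential has to leave the integral over y. For this |v_x| is
  replaced by a function of t alone, the essential supremum over x and y; that it is measurable and
  dominates |v_x| for almost every y and almost every (t, x) is the delicate point of the random
  part.\<close>

section \<open>Lipschitz functions of a real variable\<close>

text \<open>Lebesgue differentiation from Henstock's lemma. At a bad point the increments over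
  arbitrarily short intervals miss the slope \<open>f x\<close> by a fixed \<open>c\<close>. By
  Vitali's theorem disjoint bad intervals, fine for the gauge, cover the bad set up to a null set.
  Henstock's lemma bounds the sum of their errors, hence \<open>c\<close> times their total length,
  by \<open>e * c\<close>.\<close>

lemma negligible_not_derivative_integral:
  fixes f :: "real \<Rightarrow> 'b::euclidean_space"
  assumes f: "f integrable_on {a..b}"
  shows "negligible {x\<in>{a<..<b}. \<not> ((\<lambda>y. integral {a..y} f) has_vector_derivative f x) (at x)}"
proof -
  define I where "I = (\<lambda>y. integral {a..y} f)"
  define B where "B = (\<lambda>(c::real) x y. \<bar>y - x\<bar> * c < norm (I y - I x - (y - x) *\<^sub>R f x))"
  \<comment> \<open>The points where \<open>f x\<close> fails to be the derivative lie in the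
    countable union of these sets, so it suffices that each of them is negligible.\<close>
  define E where "E = (\<lambda>n::nat. {x\<in>{a<..<b}. \<forall>d>0. \<exists>y\<in>{a<..<b}. y \<noteq> x \<and> \<bar>y - x\<bar> < d \<and> B (1 / Suc n) x y})"
  have neg: "negligible (E n)" for n
    unfolding negligible_outer_le
  proof (intro allI impI)
    fix e :: real assume e: "e > 0"
    define c :: real where "c = 1 / Suc n"
    have c: "c > 0" by (simp add: c_def)
    have fi: "f integrable_on cbox a b" using f by simp
    \<comment> \<open>The tolerance \<open>e * c\<close> is chosen so that dividing by
      \<open>c\<close> at the end leaves the total length \<open>e\<close>.\<close>
    obtain \<gamma> where \<gamma>: "gauge \<gamma>" and hen: "\<And>p. \<lbrakk>p tagged_partial_division_of (cbox a b); \<gamma> fine p\<rbrakk> \<Longrightarrow>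
             sum (\<lambda>(x,k). norm(measure lborel k *\<^sub>R f x - integral k f)) p < e * c"
      using Henstock_lemma[OF fi, of "e * c"] e c by auto
    \<comment> \<open>The bad partner may lie on either side of the tag, so the interval is formed
      regardless of order; as a ball it has the shape that the covering theorem asks for.\<close>
    define S where "S = (\<lambda>(x::real, y::real). {min x y..max x y})"
    have S_cball: "S i = cball ((fst i + snd i) / 2) (\<bar>snd i - fst i\<bar> / 2)" for i
      by (cases i; cases "fst i \<le> snd i"; simp add: S_def cball_eq_atLeastAtMost field_simps)
    define K where "K = {(x, y). x \<in> {a<..<b} \<and> y \<in> {a<..<b} \<and> y \<noteq> x \<and> S (x, y) \<subseteq> \<gamma> x \<and> B c x y}"
    have K1: "\<exists>i. i \<in> K \<and> x \<in> cball ((fst i + snd i) / 2) (\<bar>snd i - fst i\<bar> / 2) \<and> \<bar>snd i - fst i\<bar> / 2 < d"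
      if x: "x \<in> E n" and d: "0 < d" for x d
    proof -
      from gaugeD[OF \<gamma>, of x] obtain r where r: "r > 0" "ball x r \<subseteq> \<gamma> x"
        by (meson openE)
      have "\<forall>d>0. \<exists>y\<in>{a<..<b}. y \<noteq> x \<and> \<bar>y - x\<bar> < d \<and> B c x y"
        using x unfolding E_def c_def by blast
      moreover have "min r d > 0" using r d by simp
      ultimately obtain y where y: "y \<in> {a<..<b}" "y \<noteq> x" "\<bar>y - x\<bar> < min r d" "B c x y"
        by blast
      have "S (x, y) \<subseteq> ball x r"
        using y by (auto simp: S_def dist_real_def)
      with r y x have "(x, y) \<in> K"
        by (auto simp: K_def E_def)
      moreover have "x \<in> S (x, y)" by (auto simp: S_def)
      then have "x \<in> cball ((fst (x, y) + snd (x, y)) / 2) (\<bar>snd (x, y) - fst (x, y)\<bar> / 2)"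
        by (simp only: S_cball)
      moreover have "\<bar>snd (x, y) - fst (x, y)\<bar> / 2 < d" using y d by auto
      ultimately show ?thesis by blast
    qed
    obtain C where C: "countable C" "C \<subseteq> K"
      and disj: "pairwise (\<lambda>i j. disjnt (S i) (S j)) C"
      and negC: "negligible (E n - (\<Union>i\<in>C. S i))"
    proof (rule Vitali_covering_theorem_cballs[of K "\<lambda>i. \<bar>snd i - fst i\<bar> / 2" "E n" "\<lambda>i. (fst i + snd i) / 2"])
      show "0 < \<bar>snd i - fst i\<bar> / 2" if "i \<in> K" for i
        using that by (auto simp: K_def)
    qed (use K1 in \<open>simp_all add: S_cball\<close>)
    \<comment> \<open>Finite subfamilies suffice: a uniform bound on them passes to the countable
      union.\<close>
    have bound: "measure lebesgue (\<Union>(S ` D)) \<le> e" if D: "D \<subseteq> C" "finite D" for D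
    proof -
      have DK: "D \<subseteq> K" using D C by auto
      define p where "p = (\<lambda>i. (fst i, S i)) ` D"
      have ne: "interior (S i) \<noteq> {}" if "i \<in> D" for i
        using that DK by (cases i) (auto simp: S_def K_def interior_atLeastAtMost_real)
      have inj: "inj_on (\<lambda>i. (fst i, S i)) D"
      proof (rule inj_onI)
        fix i j assume ij: "i \<in> D" "j \<in> D" "(fst i, S i) = (fst j, S j)"
        show "i = j"
        proof (rule ccontr)
          assume "i \<noteq> j"
          then have "disjnt (S i) (S j)" using disj ij D unfolding pairwise_def by blast
          with ij ne[of i] show False
            by (metis disjnt_self_iff_empty interior_empty prod.inject)
        qed
      qed
      have part: "p tagged_partial_division_of (cbox a b)"
        unfolding tagged_partial_division_of_def
      proof (intro conjI allI impI)
        show "finite p" using D by (simp add: p_def)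
      next
        fix x k assume "(x, k) \<in> p"
        then obtain y where y: "(x, y) \<in> D" "k = S (x, y)" by (auto simp: p_def)
        then have "(x, y) \<in> K" using DK by auto
        then show "x \<in> k" "k \<subseteq> cbox a b" "\<exists>a b. k = cbox a b"
          using y by (auto simp: K_def S_def)
      next
        fix x1 K1 x2 K2 assume *: "(x1, K1) \<in> p \<and> (x2, K2) \<in> p \<and> (x1, K1) \<noteq> (x2, K2)"
        then obtain i j where ij: "i \<in> D" "j \<in> D" "i \<noteq> j" "K1 = S i" "K2 = S j"
          by (auto simp: p_def)
        then have "disjnt (S i) (S j)" using disj D unfolding pairwise_def by blast
        then show "interior K1 \<inter> interior K2 = {}"
          using ij(4,5) interior_subset[of "S i"] interior_subset[of "S j"] unfolding disjnt_def by blast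
      qed
      have fine: "\<gamma> fine p"
        unfolding fine_def p_def using DK unfolding K_def by fastforce
      have key: "\<bar>snd i - fst i\<bar> * c \<le> norm (measure lborel (S i) *\<^sub>R f (fst i) - integral (S i) f)" if "i \<in> D" for i
      proof -
        obtain x y where i: "i = (x, y)" by force
        have xy: "x \<in> {a<..<b}" "y \<in> {a<..<b}" "y \<noteq> x" "B c x y" using that DK i by (auto simp: K_def)
        have int: "integral {u..v} f = I v - I u" if "a \<le> u" "u \<le> v" "v \<le> b" for u v
        proof -
          have "integral {a..u} f + integral {u..v} f = integral {a..v} f"
            by (rule Henstock_Kurzweil_Integration.integral_combine)
               (use that f in \<open>auto intro: integrable_on_subinterval\<close>)
          then show ?thesis by (simp add: I_def algebra_simps)
        qed
        show ?thesis
        proof (cases "x < y")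
          case True
          then show ?thesis using xy int[of x y] unfolding i
            by (simp add: S_def B_def) (metis less_eq_real_def norm_minus_commute)
        next
          case False
          then have "y < x" using xy by simp
          then have "measure lborel (S i) *\<^sub>R f (fst i) - integral (S i) f = I y - I x - (y - x) *\<^sub>R f x"
            using xy int[of y x] unfolding i by (simp add: S_def algebra_simps)
          then show ?thesis using xy(4) unfolding i by (simp add: B_def)
        qed
      qed
      have "measure lebesgue (\<Union>(S ` D)) \<le> (\<Sum>i\<in>D. measure lebesgue (S i))"
        by (rule measure_UNION_le) (use D in \<open>auto simp: S_cball\<close>)
      also have "\<dots> = (\<Sum>i\<in>D. \<bar>snd i - fst i\<bar>)"
        by (intro sum.cong) (auto simp: S_def min_def max_def split: prod.splits)
      finally have "measure lebesgue (\<Union>(S ` D)) * c \<le> (\<Sum>i\<in>D. \<bar>snd i - fst i\<bar> * c)"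
        using c by (simp add: sum_distrib_right [symmetric])
      also have "\<dots> \<le> (\<Sum>i\<in>D. norm (measure lborel (S i) *\<^sub>R f (fst i) - integral (S i) f))"
        by (intro sum_mono key)
      also have "\<dots> = sum (\<lambda>(x,k). norm(measure lborel k *\<^sub>R f x - integral k f)) p"
        unfolding p_def by (subst sum.reindex[OF inj]) (auto simp: o_def)
      also have "\<dots> < e * c" by (rule hen[OF part fine])
      finally show ?thesis using c by simp
    qed
    have meas: "\<And>i. i \<in> C \<Longrightarrow> S i \<in> lmeasurable" by (simp add: S_cball)
    have U: "(\<Union>i\<in>C. S i) \<in> lmeasurable" "measure lebesgue (\<Union>i\<in>C. S i) \<le> e"
      using fmeasurable_UN_bound[OF C(1) meas bound] measure_UN_bound[OF C(1) meas bound] by auto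
    show "\<exists>T. E n \<subseteq> T \<and> T \<in> lmeasurable \<and> measure lebesgue T \<le> e"
    proof (intro exI conjI)
      show "E n \<subseteq> (\<Union>i\<in>C. S i) \<union> (E n - (\<Union>i\<in>C. S i))" by auto
      show "(\<Union>i\<in>C. S i) \<union> (E n - (\<Union>i\<in>C. S i)) \<in> lmeasurable"
        using U negC by (intro fmeasurable.Un) (auto intro: negligible_imp_measurable)
      show "measure lebesgue ((\<Union>i\<in>C. S i) \<union> (E n - (\<Union>i\<in>C. S i))) \<le> e"
        using measure_Un_le[of "\<Union>i\<in>C. S i" lebesgue "E n - (\<Union>i\<in>C. S i)"] U negC
        by (simp add: negligible_imp_measure0 fmeasurableD negligible_imp_sets)
    qed
  qed
  have "{x\<in>{a<..<b}. \<not> (I has_vector_derivative f x) (at x)} \<subseteq> (\<Union>n. E n)"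
  proof clarify
    fix x assume x: "x \<in> {a<..<b}" "\<not> (I has_vector_derivative f x) (at x)"
    show "x \<in> (\<Union>n. E n)"
    proof (rule ccontr)
      assume "x \<notin> (\<Union>n. E n)"
      then have *: "\<exists>d>0. \<forall>y\<in>{a<..<b}. y \<noteq> x \<longrightarrow> \<bar>y - x\<bar> < d \<longrightarrow> \<not> B (1 / Suc n) x y" for n
        using x unfolding E_def by force
      have "(I has_vector_derivative f x) (at x)"
        unfolding has_vector_derivative_def has_derivative_at_alt
      proof (intro conjI allI impI)
        show "bounded_linear (\<lambda>h. h *\<^sub>R f x)" by (rule bounded_linear_scaleR_left)
        fix e :: real assume "e > 0"
        then obtain n where n: "1 / Suc n < e" using nat_approx_posE by blast
        from *[of n] obtain d where d: "d > 0" "\<forall>y\<in>{a<..<b}. y \<noteq> x \<longrightarrow> \<bar>y - x\<bar> < d \<longrightarrow> \<not> B (1 / Suc n) x y"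
          by auto
        let ?d = "min d (min (x - a) (b - x))"
        show "\<exists>d>0. \<forall>y. norm (y - x) < d \<longrightarrow> norm (I y - I x - (y - x) *\<^sub>R f x) \<le> e * norm (y - x)"
        proof (intro exI[of _ ?d] conjI allI impI)
          show "?d > 0" using d x by simp
          fix y assume y: "norm (y - x) < ?d"
          show "norm (I y - I x - (y - x) *\<^sub>R f x) \<le> e * norm (y - x)"
          proof (cases "y = x")
            case False
            have "y \<in> {a<..<b}" using y by (auto simp: abs_if split: if_splits)
            with False have "\<not> B (1 / Suc n) x y" using d y by auto
            then have "norm (I y - I x - (y - x) *\<^sub>R f x) \<le> \<bar>y - x\<bar> * (1 / Suc n)"
              by (simp add: B_def)
            also have "\<dots> \<le> \<bar>y - x\<bar> * e" using n by (intro mult_left_mono) auto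
            finally show ?thesis by (simp add: mult.commute)
          qed simp
        qed
      qed
      with x show False by simp
    qed
  qed
  then show ?thesis
    unfolding I_def[symmetric] using negligible_Union_nat[of E] neg by (auto intro: negligible_subset)
qed


lemma AE_lborel_iff_negligible:
  fixes P :: "'a::euclidean_space \<Rightarrow> bool"
  shows "(AE x in lborel. P x) \<longleftrightarrow> negligible {x. \<not> P x}"
  by (subst AE_completion_iff[symmetric]) (simp add: completion.AE_iff_null_sets negligible_iff_null_sets)

text \<open>Adding a steep linear function makes \<open>F\<close> a strictly increasing bi-Lipschitz
  \<open>G\<close>. The measure that assigns to a set the length of its image under \<open>G\<close>
  is absolutely continuous, because Lipschitz maps preserve null sets. Its Radon-Nikodym density
  integrates to the increments of \<open>G\<close>, and the differentiation lemma above makes it the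
  derivative almost everywhere.\<close>

lemma lipschitz_real_ex_derivative:
  fixes F :: "real \<Rightarrow> real"
  assumes F: "L-lipschitz_on UNIV F"
  obtains F' where "F' \<in> borel_measurable borel"
    "AE x in lborel. (F has_real_derivative F' x) (at x)"
    "\<And>a b. a \<le> b \<Longrightarrow> (F' has_integral (F b - F a)) {a..b}"
proof -
  have L: "0 \<le> L" using F by (rule lipschitz_on_nonneg)
  have FL: "\<bar>F x - F y\<bar> \<le> L * \<bar>x - y\<bar>" for x y
    using lipschitz_onD[OF F, of x y] by (simp add: dist_real_def)
  \<comment> \<open>Slope at least 1 makes the inverse 1-Lipschitz; slope at most
    \<open>2 * L + 1\<close> keeps \<open>G\<close> itself Lipschitz.\<close>
  define G where "G = (\<lambda>x. F x + (L + 1) * x)"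
  have G1: "y - x \<le> G y - G x" if "x \<le> y" for x y
    using FL[of y x] that by (auto simp: G_def algebra_simps abs_le_iff)
  have G2: "G y - G x \<le> (2 * L + 1) * (y - x)" if "x \<le> y" for x y
    using FL[of y x] that by (auto simp: G_def algebra_simps abs_le_iff)
  have mono: "strict_mono G"
    unfolding strict_mono_def using G1 by (metis diff_gt_0_iff_gt less_eq_real_def less_le_trans)
  have contF: "continuous_on UNIV F" using F by (rule lipschitz_on_continuous_on)
  then have contG: "continuous_on UNIV G" unfolding G_def by (intro continuous_intros)
  have surj: "\<exists>x. G x = y" for y
  proof -
    define r where "r = \<bar>y - G 0\<bar>"
    have "G (- r) \<le> y" "y \<le> G r" using G1[of 0 r] G1[of "- r" 0] by (auto simp: r_def)
    moreover have "- r \<le> r" by (simp add: r_def)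
    ultimately show ?thesis
      using IVT'[of G "- r" y r] contG continuous_on_subset by blast
  qed
  have bij: "bij G" using mono surj by (auto simp: bij_def strict_mono_imp_inj_on surj_def) metis
  define Gi where "Gi = inv G"
  have Gi: "G (Gi y) = y" "Gi (G x) = x" for x y
    using bij by (auto simp: Gi_def bij_is_surj surj_f_inv_f bij_is_inj)
  have "1-lipschitz_on UNIV Gi"
  proof (rule lipschitz_onI)
    fix x y show "dist (Gi x) (Gi y) \<le> 1 * dist x y"
      using G1[of "Gi x" "Gi y"] G1[of "Gi y" "Gi x"] by (auto simp: dist_real_def Gi abs_if)
  qed simp
  then have Gi_meas [measurable]: "Gi \<in> borel_measurable borel"
    using lipschitz_on_continuous_on borel_measurable_continuous_onI by blast
  \<comment> \<open>Pushing Lebesgue measure forward by the inverse measures images under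
    \<open>G\<close>, so an interval receives the increment of \<open>G\<close>.\<close>
  define \<mu> where "\<mu> = distr lborel borel Gi"
  have vim: "Gi -` A = G ` A" for A
    by (auto simp: Gi image_iff) (metis Gi(1))
  have ac: "absolutely_continuous lborel \<mu>"
    unfolding absolutely_continuous_def
  proof
    fix A :: "real set" assume A: "A \<in> null_sets lborel"
    then have "negligible A"
      by (simp add: negligible_iff_null_sets null_sets_completionI)
    then have "negligible (G ` A)"
    proof (rule negligible_locally_Lipschitz_image[OF order_refl])
      fix x assume "x \<in> A"
      have "norm (G y - G x) \<le> (2 * L + 1) * norm (y - x)" for y
        using G1[of x y] G2[of x y] G1[of y x] G2[of y x] L
        by (cases "x \<le> y") (auto simp: algebra_simps abs_if)
      then show "\<exists>T B. open T \<and> x \<in> T \<and> (\<forall>y\<in>A \<inter> T. norm (G y - G x) \<le> B * norm (y - x))"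
        by (intro exI[of _ UNIV] exI[of _ "2 * L + 1"]) auto
    qed
    then have "emeasure lebesgue (Gi -` A) = 0"
      by (simp add: vim negligible_iff_null_sets null_sets_def)
    moreover have "Gi -` A \<in> sets borel"
      using A measurable_sets[OF Gi_meas, of A] by (auto simp: null_sets_def)
    ultimately show "A \<in> null_sets \<mu>"
      using A by (auto simp: \<mu>_def null_sets_def emeasure_distr)
  qed
  define \<rho> where "\<rho> = RN_deriv lborel \<mu>"
  have \<rho>_meas [measurable]: "\<rho> \<in> borel_measurable borel"
    unfolding \<rho>_def using borel_measurable_RN_deriv[of lborel \<mu>] by simp
  have dens: "density lborel \<rho> = \<mu>"
    unfolding \<rho>_def by (rule sigma_finite_measure.density_RN_deriv[OF sigma_finite_lborel ac]) (simp add: \<mu>_def)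
  have \<rho>_int: "(\<integral>\<^sup>+x. \<rho> x * indicator {a..b} x \<partial>lborel) = ennreal (G b - G a)" if "a \<le> b" for a b
  proof -
    have "G ` {a..b} = {G a..G b}"
    proof (intro set_eqI iffI)
      fix y assume "y \<in> {G a..G b}"
      then have "Gi y \<in> {a..b}"
        using Gi mono by (metis atLeastAtMost_iff strict_mono_less_eq)
      then show "y \<in> G ` {a..b}" using Gi by (metis image_eqI)
    qed (use mono in \<open>auto simp: strict_mono_less_eq\<close>)
    then have "\<mu> {a..b} = ennreal (G b - G a)"
      using that mono by (simp add: \<mu>_def emeasure_distr vim strict_mono_less_eq)
    then show ?thesis
      unfolding dens[symmetric] by (subst (asm) emeasure_density) auto
  qed
  define g where "g = (\<lambda>x. enn2real (\<rho> x))"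
  have g_meas [measurable]: "g \<in> borel_measurable borel" by (simp add: g_def)
  have g_hi: "(g has_integral (G b - G a)) {a..b}" if "a \<le> b" for a b
  proof -
    \<comment> \<open>The density is finite almost everywhere on each bounded interval, so passing
      to real values does not change the integrals.\<close>
    have "AE x in lborel. \<rho> x * indicator {a..b} x \<noteq> \<infinity>"
      using \<rho>_int[OF that] by (intro nn_integral_PInf_AE) auto
    then have "(\<integral>\<^sup>+x. ennreal (g x * indicator {a..b} x) \<partial>lborel) = (\<integral>\<^sup>+x. \<rho> x * indicator {a..b} x \<partial>lborel)"
      by (intro nn_integral_cong_AE) (auto simp: g_def indicator_def less_top)
    then have "((\<lambda>x. g x * indicator {a..b} x) has_integral (G b - G a)) UNIV"
      using \<rho>_int[OF that]
      by (intro nn_integral_has_integral) (use G1[OF that] that in \<open>auto simp: g_def\<close>)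
    moreover have "(\<lambda>x. g x * indicator {a..b} x) = (\<lambda>x. if x \<in> {a..b} then g x else 0)"
      by (auto simp: indicator_def)
    ultimately show ?thesis by (simp only: has_integral_restrict_UNIV)
  qed
  have "AE x in lborel. \<forall>n::nat. x \<in> {- real n<..<real n} \<longrightarrow> (G has_vector_derivative g x) (at x)"
    unfolding AE_all_countable
  proof
    fix n
    have I: "integral {- real n..y} g = G y - G (- real n)" if "- real n \<le> y" for y
      using g_hi[OF that] by (rule integral_unique)
    have "negligible {x\<in>{- real n<..<real n}. \<not> ((\<lambda>y. integral {- real n..y} g) has_vector_derivative g x) (at x)}"
      by (rule negligible_not_derivative_integral) (use g_hi[of "- real n" "real n"] in auto)
    moreover have "(G has_vector_derivative g x) (at x)"
      if x: "x \<in> {- real n<..<real n}" and d: "((\<lambda>y. integral {- real n..y} g) has_vector_derivative g x) (at x)" for x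
    proof -
      have "((\<lambda>y. G y - G (- real n)) has_vector_derivative g x) (at x)"
        by (rule has_vector_derivative_transform_within_open[OF d, of "{- real n<..}"]) (use x I in auto)
      from has_vector_derivative_add[OF this has_vector_derivative_const[of "G (- real n)"]]
      show ?thesis by simp
    qed
    ultimately show "AE x in lborel. x \<in> {- real n<..<real n} \<longrightarrow> (G has_vector_derivative g x) (at x)"
      unfolding AE_lborel_iff_negligible by (auto elim!: negligible_subset)
  qed
  then have G': "AE x in lborel. (G has_vector_derivative g x) (at x)"
  proof eventually_elim
    case (elim x)
    obtain n where "\<bar>x\<bar> < real n" using reals_Archimedean2 by blast
    then have "x \<in> {- real n<..<real n}" by auto
    then show ?case using elim by blast
  qed
  show ?thesis
  proof
    show "(\<lambda>x. g x - (L + 1)) \<in> borel_measurable borel" by simp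
    show "AE x in lborel. (F has_real_derivative g x - (L + 1)) (at x)"
      using G'
    proof eventually_elim
      case (elim x)
      then have "(G has_real_derivative g x) (at x)"
        by (simp add: has_real_derivative_iff_has_vector_derivative)
      then have "((\<lambda>x. G x - (L + 1) * x) has_real_derivative g x - (L + 1)) (at x)"
        by (auto intro!: derivative_eq_intros)
      then show ?case by (simp add: G_def)
    qed
    fix a b :: real assume "a \<le> b"
    from has_integral_diff[OF g_hi[OF this] has_integral_const_real[of "L + 1" a b]] \<open>a \<le> b\<close>
    show "((\<lambda>x. g x - (L + 1)) has_integral F b - F a) {a..b}"
      by (simp add: G_def algebra_simps)
  qed
qed


section \<open>Borel partial derivatives of Lipschitz functions of two variables\<close>

lemma has_vector_derivative_difference_quotient:
  assumes d: "(F has_vector_derivative d) (at t)"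
  shows "(\<lambda>n. real (Suc n) *\<^sub>R (F (t + 1 / Suc n) - F t)) \<longlonglongrightarrow> d"
proof (rule LIMSEQ_I)
  from d have H: "\<forall>e>0. \<exists>r>0. \<forall>y. norm (y - t) < r \<longrightarrow>
        norm (F y - F t - (y - t) *\<^sub>R d) \<le> e * norm (y - t)"
    unfolding has_vector_derivative_def has_derivative_at_alt by blast
  fix e :: real assume "e > 0"
  with H obtain r where r: "r > 0" "\<And>y. norm (y - t) < r \<Longrightarrow>
      norm (F y - F t - (y - t) *\<^sub>R d) \<le> e / 2 * norm (y - t)"
    using half_gt_zero by blast
  obtain N where N: "1 / Suc N < r" using r(1) nat_approx_posE by blast
  have "norm (real (Suc n) *\<^sub>R (F (t + 1 / Suc n) - F t) - d) < e" if "n \<ge> N" for n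
  proof -
    have "1 / Suc n \<le> 1 / Suc N" using that by (intro divide_left_mono) auto
    then have "norm (F (t + 1 / Suc n) - F t - (1 / Suc n) *\<^sub>R d) \<le> e / 2 * (1 / Suc n)"
      using r(2)[of "t + 1 / Suc n"] N by simp
    then have "real (Suc n) * norm (F (t + 1 / Suc n) - F t - (1 / Suc n) *\<^sub>R d) \<le> e / 2"
      by (simp add: field_simps del: of_nat_Suc)
    moreover have "real (Suc n) *\<^sub>R (F (t + 1 / Suc n) - F t) - d
        = real (Suc n) *\<^sub>R (F (t + 1 / Suc n) - F t - (1 / Suc n) *\<^sub>R d)"
      by (simp add: scaleR_diff_right del: of_nat_Suc)
    ultimately show ?thesis using \<open>e > 0\<close> by simp
  qed
  then show "\<exists>N. \<forall>n\<ge>N. norm (real (Suc n) *\<^sub>R (F (t + 1 / Suc n) - F t) - d) < e" by blast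
qed

lemma lipschitz_has_vector_derivative_AE:
  fixes F :: "real \<Rightarrow> 'b::euclidean_space"
  assumes F: "L-lipschitz_on UNIV F"
  shows "AE x in lborel. \<exists>d. (F has_vector_derivative d) (at x)"
proof -
  have "\<forall>b\<in>Basis. AE x in lborel. \<exists>d. ((\<lambda>x. F x \<bullet> b) has_real_derivative d) (at x)"
  proof
    fix b :: 'b assume b: "b \<in> Basis"
    have "L-lipschitz_on UNIV (\<lambda>x. F x \<bullet> b)"
    proof (rule lipschitz_onI)
      fix x y
      have "\<bar>(F x - F y) \<bullet> b\<bar> \<le> norm (F x - F y)" by (rule Basis_le_norm[OF b])
      then show "dist (F x \<bullet> b) (F y \<bullet> b) \<le> L * dist x y"
        using lipschitz_onD[OF F, of x y] by (simp add: dist_real_def dist_norm inner_diff_left)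
    qed (rule lipschitz_on_nonneg[OF F])
    then obtain F' where "AE x in lborel. ((\<lambda>x. F x \<bullet> b) has_real_derivative F' x) (at x)"
      by (rule lipschitz_real_ex_derivative)
    then show "AE x in lborel. \<exists>d. ((\<lambda>x. F x \<bullet> b) has_real_derivative d) (at x)"
      by eventually_elim auto
  qed
  then have "AE x in lborel. \<forall>b\<in>Basis. \<exists>d. ((\<lambda>x. F x \<bullet> b) has_real_derivative d) (at x)"
    by (simp add: AE_finite_all)
  then show ?thesis
  proof eventually_elim
    case (elim x)
    then obtain d where "\<forall>b\<in>Basis. ((\<lambda>x. F x \<bullet> b) has_real_derivative d b) (at x)" by metis
    then have "(F has_vector_derivative (\<Sum>b\<in>Basis. d b *\<^sub>R b)) (at x)"
      unfolding has_vector_derivative_def has_field_derivative_def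
      by (subst has_derivative_componentwise_within)
         (auto simp: inner_sum_left inner_Basis if_distrib mult.commute[of _ "d _"] cong: if_cong)
    then show ?case by blast
  qed
qed

lemma lipschitz_slice:
  fixes F :: "real \<times> real \<Rightarrow> 'b::metric_space"
  assumes F: "L-lipschitz_on UNIV F"
  shows "L-lipschitz_on UNIV (\<lambda>s. F (s, x))" and "L-lipschitz_on UNIV (\<lambda>z. F (t, z))"
  using lipschitz_onD[OF F, of "(_, x)" "(_, x)"] lipschitz_onD[OF F, of "(t, _)" "(t, _)"]
    lipschitz_on_nonneg[OF F]
  by (auto intro!: lipschitz_onI simp: dist_Pair_Pair)

lemma lipschitz_on_coordinate:
  fixes g :: "real \<Rightarrow> 'b::metric_space"
  assumes g: "L-lipschitz_on UNIV g"
  shows "L-lipschitz_on UNIV (\<lambda>z::real \<times> real. g (fst z))"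
    and "L-lipschitz_on UNIV (\<lambda>z::real \<times> real. g (snd z))"
proof -
  have "1-lipschitz_on UNIV (fst :: real \<times> real \<Rightarrow> real)" "1-lipschitz_on UNIV (snd :: real \<times> real \<Rightarrow> real)"
    by (auto intro!: lipschitz_onI dist_fst_le[simplified] dist_snd_le[simplified])
       (metis dist_fst_le fst_conv, metis dist_snd_le snd_conv)
  from this[THEN lipschitz_on_compose2[OF _ lipschitz_on_subset[OF g]]]
  show "L-lipschitz_on UNIV (\<lambda>z::real \<times> real. g (fst z))" "L-lipschitz_on UNIV (\<lambda>z::real \<times> real. g (snd z))"
    by auto
qed

text \<open>For fixed \<open>x\<close>, differentiability in time holds almost everywhere. To
  combine the lines by Fubini, both the derivative and the set where it is attained must be Borel.
  The limit of difference quotients with step 1/(n+1) is a Borel candidate, and differentiability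
  becomes a countable condition once increments are restricted to the rationals.\<close>

lemma lipschitz_partial_derivative:
  fixes F :: "real \<times> real \<Rightarrow> 'b::euclidean_space"
  assumes F: "L-lipschitz_on UNIV F"
  obtains D where "D \<in> borel_measurable borel" "\<And>z. norm (D z) \<le> L"
    "Measurable.pred borel (\<lambda>z. ((\<lambda>s. F (s, snd z)) has_vector_derivative D z) (at (fst z)))"
    "\<And>x. AE t in lborel. ((\<lambda>s. F (s, x)) has_vector_derivative D (t, x)) (at t)"
proof -
  note FL = lipschitz_onD[OF lipschitz_slice(1)[OF F], simplified]
  have L: "0 \<le> L" using F by (rule lipschitz_on_nonneg)
  have contF: "continuous_on UNIV F" using F by (rule lipschitz_on_continuous_on)
  have F_meas [measurable]: "F \<in> borel_measurable borel"
    using contF by (rule borel_measurable_continuous_onI)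
  have [measurable]: "(\<lambda>z. F (g z, h z)) \<in> borel_measurable borel"
    if [measurable]: "g \<in> borel_measurable borel" "h \<in> borel_measurable borel" for g h :: "real \<times> real \<Rightarrow> real"
  proof -
    have "(\<lambda>z. (g z, h z)) \<in> borel \<rightarrow>\<^sub>M borel"
      unfolding borel_prod[symmetric] by measurable (simp_all add: borel_prod)
    from measurable_compose[OF this F_meas] show ?thesis .
  qed
  have [measurable]: "fst \<in> borel_measurable (borel :: (real \<times> real) measure)"
    "snd \<in> borel_measurable (borel :: (real \<times> real) measure)"
    by (auto intro!: borel_measurable_continuous_onI continuous_intros)
  define Q where "Q = (\<lambda>n z. real (Suc n) *\<^sub>R (F (fst z + 1 / Suc n, snd z) - F z))"
  have [measurable]: "Q n \<in> borel_measurable borel" for n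
    unfolding Q_def by measurable
  \<comment> \<open>Where the quotients diverge the value 0 is taken, which respects the bound
    \<open>L\<close> as well.\<close>
  define D where "D = (\<lambda>z. if Cauchy (\<lambda>n. Q n z) then lim (\<lambda>n. Q n z) else 0)"
  have D_meas [measurable]: "D \<in> borel_measurable borel"
    unfolding D_def by measurable
  have QD: "D z = d" if "(\<lambda>n. Q n z) \<longlonglongrightarrow> d" for z d
    unfolding D_def using that LIMSEQ_imp_Cauchy limI by auto
  have Qb: "norm (Q n z) \<le> L" for n z
  proof -
    have "norm (F (fst z + 1 / Suc n, snd z) - F z) \<le> L * (1 / Suc n)"
      using FL[of "fst z + 1 / Suc n" "snd z" "fst z"] by (simp add: dist_norm)
    then show ?thesis by (simp add: Q_def pos_le_divide_eq mult.commute del: of_nat_Suc)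
  qed
  have Db: "norm (D z) \<le> L" for z
  proof (cases "Cauchy (\<lambda>n. Q n z)")
    case True
    then obtain d where "(\<lambda>n. Q n z) \<longlonglongrightarrow> d" using Cauchy_convergent convergent_def by blast
    then show ?thesis using QD[of z d] Qb Lim_bounded tendsto_norm by metis
  qed (use L in \<open>simp add: D_def\<close>)
  \<comment> \<open>Differentiability with derivative \<open>D z\<close>, written with countable
    quantifiers only, hence a Borel predicate.\<close>
  define P where "P = (\<lambda>z. \<forall>k::nat. \<exists>j::nat. \<forall>h::rat. \<bar>real_of_rat h\<bar> < 1 / Suc j \<longrightarrow>
    norm (F (fst z + real_of_rat h, snd z) - F z - real_of_rat h *\<^sub>R D z) \<le> 1 / Suc k * \<bar>real_of_rat h\<bar>)"
  have P_meas: "Measurable.pred borel P"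
    unfolding P_def by measurable
  have P_iff: "P z \<longleftrightarrow> ((\<lambda>s. F (s, snd z)) has_vector_derivative D z) (at (fst z))" for z
  proof
    assume P: "P z"
    show "((\<lambda>s. F (s, snd z)) has_vector_derivative D z) (at (fst z))"
      unfolding has_vector_derivative_def has_derivative_at_alt
    proof (intro conjI allI impI)
      show "bounded_linear (\<lambda>h. h *\<^sub>R D z)" by (rule bounded_linear_scaleR_left)
      fix e :: real assume "e > 0"
      then obtain k where k: "1 / Suc k < e" using nat_approx_posE by blast
      from P obtain j where j: "\<And>h::rat. \<bar>real_of_rat h\<bar> < 1 / Suc j \<Longrightarrow>
          norm (F (fst z + real_of_rat h, snd z) - F z - real_of_rat h *\<^sub>R D z) \<le> 1 / Suc k * \<bar>real_of_rat h\<bar>"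
        unfolding P_def by blast
      have "norm (F (fst z + h, snd z) - F z - h *\<^sub>R D z) \<le> 1 / Suc k * \<bar>h\<bar>" if h: "\<bar>h\<bar> < 1 / Suc j" for h
      proof -
        \<comment> \<open>Both sides are continuous in the increment, so the estimate extends from
          rational increments to all small ones.\<close>
        have "closed {h. norm (F (fst z + h, snd z) - F z - h *\<^sub>R D z) \<le> 1 / Suc k * \<bar>h\<bar>}" (is "closed ?A")
          by (intro closed_Collect_le continuous_intros continuous_on_compose2[OF contF]) auto
        moreover have "\<rat> \<inter> {- (1 / Suc j)<..<1 / Suc j} \<subseteq> ?A"
        proof
          fix r assume r: "r \<in> \<rat> \<inter> {- (1 / Suc j)<..<1 / Suc j}"
          then obtain q where "r = real_of_rat q" by (auto elim: Rats_cases)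
          moreover have "\<bar>r\<bar> < 1 / Suc j" using r by (auto simp: abs_less_iff)
          ultimately show "r \<in> ?A" using j[of q] by (simp only: mem_Collect_eq)
        qed
        moreover have "h \<in> closure (\<rat> \<inter> {- (1 / Suc j)<..<1 / Suc j})"
        proof -
          have "{- (1 / Suc j)<..<1 / Suc j} \<subseteq> closure (\<rat> \<inter> {- (1 / Suc j)<..<1 / Suc j})"
            using open_Int_closure_subset[of "{- (1 / Suc j)<..<1 / Suc j}" \<rat>] Rats_closure_real
            by (simp add: Int_commute)
          moreover have "h \<in> {- (1 / Suc j)<..<1 / Suc j}" using h by (simp only: abs_less_iff) auto
          ultimately show ?thesis by (rule subsetD)
        qed
        ultimately have "h \<in> ?A" using closure_minimal[of _ ?A] by (meson subsetD)
        then show ?thesis by (simp only: mem_Collect_eq)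
      qed
      then show "\<exists>d>0. \<forall>y. norm (y - fst z) < d \<longrightarrow>
          norm (F (y, snd z) - F (fst z, snd z) - (y - fst z) *\<^sub>R D z) \<le> e * norm (y - fst z)"
      proof (intro exI[of _ "1 / Suc j"] conjI allI impI)
        fix y assume "\<And>h. \<bar>h\<bar> < 1 / real (Suc j) \<Longrightarrow>
            norm (F (fst z + h, snd z) - F z - h *\<^sub>R D z) \<le> 1 / Suc k * \<bar>h\<bar>"
          and "norm (y - fst z) < 1 / Suc j"
        from this(1)[of "y - fst z"] this(2)
        have "norm (F (y, snd z) - F (fst z, snd z) - (y - fst z) *\<^sub>R D z) \<le> 1 / Suc k * norm (y - fst z)"
          by simp
        also have "\<dots> \<le> e * norm (y - fst z)" using k by (intro mult_right_mono) auto
        finally show "norm (F (y, snd z) - F (fst z, snd z) - (y - fst z) *\<^sub>R D z) \<le> e * norm (y - fst z)" .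
      qed simp
    qed
  next
    assume "((\<lambda>s. F (s, snd z)) has_vector_derivative D z) (at (fst z))"
    then have H: "\<forall>e>0. \<exists>d>0. \<forall>y. norm (y - fst z) < d \<longrightarrow>
          norm (F (y, snd z) - F (fst z, snd z) - (y - fst z) *\<^sub>R D z) \<le> e * norm (y - fst z)"
      unfolding has_vector_derivative_def has_derivative_at_alt by blast
    show "P z"
      unfolding P_def
    proof
      fix k :: nat
      have "1 / real (Suc k) > 0" by simp
      with H obtain d where d: "d > 0" "\<forall>y. norm (y - fst z) < d \<longrightarrow>
          norm (F (y, snd z) - F (fst z, snd z) - (y - fst z) *\<^sub>R D z) \<le> 1 / Suc k * norm (y - fst z)"
        by blast
      then obtain j where "1 / Suc j < d" using nat_approx_posE by blast
      then show "\<exists>j::nat. \<forall>h::rat. \<bar>real_of_rat h\<bar> < 1 / Suc j \<longrightarrow>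
        norm (F (fst z + real_of_rat h, snd z) - F z - real_of_rat h *\<^sub>R D z) \<le> 1 / Suc k * \<bar>real_of_rat h\<bar>"
        using d(2)[rule_format, of "fst z + real_of_rat h" for h] by (intro exI[of _ j]) auto
    qed
  qed
  have deriv: "((\<lambda>s. F (s, x)) has_vector_derivative D (t, x)) (at t)"
    if d: "((\<lambda>s. F (s, x)) has_vector_derivative d) (at t)" for d t x
  proof -
    have "(\<lambda>n. Q n (t, x)) \<longlonglongrightarrow> d"
      using has_vector_derivative_difference_quotient[OF d] by (simp add: Q_def)
    then show ?thesis using QD d by blast
  qed
  show ?thesis
  proof
    show "D \<in> borel_measurable borel" "norm (D z) \<le> L" for z by (fact D_meas, fact Db)
    show "Measurable.pred borel (\<lambda>z. ((\<lambda>s. F (s, snd z)) has_vector_derivative D z) (at (fst z)))"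
      using P_meas by (simp add: P_iff[symmetric])
    fix x
    show "AE t in lborel. ((\<lambda>s. F (s, x)) has_vector_derivative D (t, x)) (at t)"
      using lipschitz_has_vector_derivative_AE[OF lipschitz_slice(1)[OF F, of x]]
      by eventually_elim (use deriv in blast)
  qed
qed

text \<open>Measurability of \<open>P\<close> lets the two variables be exchanged, so exceptional
  sets that are null on lines in either direction suffice.\<close>

lemma AE_lborel_pairI:
  fixes P :: "'a::euclidean_space \<times> 'b::euclidean_space \<Rightarrow> bool"
  assumes "Measurable.pred borel P"
    and "(AE x in lborel. AE y in lborel. P (x, y)) \<or> (AE y in lborel. AE x in lborel. P (x, y))"
  shows "AE z in lborel. P z"
proof -
  have P: "{z \<in> space (lborel \<Otimes>\<^sub>M lborel). P z} \<in> sets (lborel \<Otimes>\<^sub>M lborel)"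
    unfolding lborel_prod using assms(1) by (simp add: pred_def)
  have "AE x in lborel. AE y in lborel. P (x, y)"
    using assms(2) lborel_pair.AE_commute[of "\<lambda>x y. P (x, y)"] P by (simp add: split_beta')
  from lborel_pair.AE_pair_measure[OF P this] show ?thesis unfolding lborel_prod .
qed

text \<open>The space derivative is the time derivative after swapping coordinates. Both forms of
  the exceptional sets are kept: the statement on every line is what can be integrated along that
  line and evaluated at a fixed time, while the planar statement enters pointwise identities on the
  slab.\<close>

lemma lipschitz_partial_derivatives:
  fixes F :: "real \<times> real \<Rightarrow> 'b::euclidean_space"
  assumes F: "L-lipschitz_on UNIV F"
  obtains Dt Dx where "Dt \<in> borel_measurable borel" "Dx \<in> borel_measurable borel"
    "\<And>z. norm (Dt z) \<le> L" "\<And>z. norm (Dx z) \<le> L"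
    "\<And>x. AE t in lborel. ((\<lambda>s. F (s, x)) has_vector_derivative Dt (t, x)) (at t)"
    "\<And>t. AE x in lborel. ((\<lambda>z. F (t, z)) has_vector_derivative Dx (t, x)) (at x)"
    "AE (t, x) in lborel. ((\<lambda>s. F (s, x)) has_vector_derivative Dt (t, x)) (at t)"
    "AE (t, x) in lborel. ((\<lambda>z. F (t, z)) has_vector_derivative Dx (t, x)) (at x)"
proof -
  obtain Dt where Dt: "Dt \<in> borel_measurable borel" "\<And>z. norm (Dt z) \<le> L"
    "Measurable.pred borel (\<lambda>z. ((\<lambda>s. F (s, snd z)) has_vector_derivative Dt z) (at (fst z)))"
    "\<And>x. AE t in lborel. ((\<lambda>s. F (s, x)) has_vector_derivative Dt (t, x)) (at t)"
    using lipschitz_partial_derivative[OF F] by blast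
  have swap: "L-lipschitz_on UNIV (\<lambda>z. F (prod.swap z))"
  proof (rule lipschitz_onI)
    show "dist (F (prod.swap x)) (F (prod.swap y)) \<le> L * dist x y" for x y
      using lipschitz_onD[OF F, of "prod.swap x" "prod.swap y"] by (simp add: dist_prod_def add.commute)
  qed (rule lipschitz_on_nonneg[OF F])
  obtain D where D: "D \<in> borel_measurable borel" "\<And>z. norm (D z) \<le> L"
    "Measurable.pred borel (\<lambda>z. ((\<lambda>s. F (snd z, s)) has_vector_derivative D z) (at (fst z)))"
    "\<And>x. AE t in lborel. ((\<lambda>s. F (x, s)) has_vector_derivative D (t, x)) (at t)"
    using lipschitz_partial_derivative[OF swap] by (auto simp: prod.swap_def)
  define Dx where "Dx = (\<lambda>z. D (prod.swap z))"
  have sw [measurable]: "prod.swap \<in> (borel :: (real \<times> real) measure) \<rightarrow>\<^sub>M (borel :: (real \<times> real) measure)"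
    by (intro borel_measurable_continuous_onI) (auto intro!: continuous_intros simp: prod.swap_def)
  have Dx: "Dx \<in> borel_measurable borel" unfolding Dx_def using D(1) sw by (rule measurable_compose[rotated])
  have "Measurable.pred borel (\<lambda>z. ((\<lambda>s. F (fst z, s)) has_vector_derivative Dx z) (at (snd z)))"
    using measurable_compose[OF sw D(3)] by (simp add: Dx_def)
  then have "AE z in lborel. ((\<lambda>s. F (fst z, s)) has_vector_derivative Dx z) (at (snd z))"
    by (rule AE_lborel_pairI) (use D(4) in \<open>simp add: Dx_def\<close>)
  then have A: "AE (t, x) in lborel. ((\<lambda>z. F (t, z)) has_vector_derivative Dx (t, x)) (at x)"
    by (simp add: split_beta')
  have "AE z in lborel. ((\<lambda>s. F (s, snd z)) has_vector_derivative Dt z) (at (fst z))"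
    using Dt(3) by (rule AE_lborel_pairI) (use Dt(4) in simp)
  then have B: "AE (t, x) in lborel. ((\<lambda>s. F (s, x)) has_vector_derivative Dt (t, x)) (at t)"
    by (simp add: split_beta')
  show ?thesis
    by (rule that[OF Dt(1) Dx Dt(2) _ Dt(4) _ B A]) (use D in \<open>auto simp: Dx_def\<close>)
qed


section \<open>Integration of total derivatives over the slab\<close>

lemma bounded_compact_support_integrable:
  fixes g :: "'a::euclidean_space \<Rightarrow> 'b::{banach, second_countable_topology}"
  assumes [measurable]: "g \<in> borel_measurable borel"
    and B: "\<And>z. norm (g z) \<le> B" and r: "\<And>z. r < norm z \<Longrightarrow> g z = 0"
  shows "integrable lborel g"
proof (rule Bochner_Integration.integrable_bound)
  show "integrable lborel (\<lambda>z::'a. indicator (cball 0 r) z * B)"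
    using emeasure_lborel_cball_finite[of "0::'a" r]
    by (intro integrable_mult_left impI integrable_real_indicator) auto
  have "0 \<le> B" using B[of 0] norm_ge_zero order_trans by blast
  then show "AE z in lborel. norm (g z) \<le> norm (indicator (cball 0 r) z * B)"
    using B r by (intro AE_I2) (auto simp: indicator_def not_le)
qed simp

lemma borel_slices [measurable]:
  "(\<lambda>t::real. (t, x::real)) \<in> borel \<rightarrow>\<^sub>M borel" "(\<lambda>x::real. (t::real, x)) \<in> borel \<rightarrow>\<^sub>M borel"
  by (auto intro!: borel_measurable_continuous_onI continuous_intros)

text \<open>Two functions that are derivatives almost everywhere agree off a null set, so the
  fundamental theorem holds for either.\<close>

lemma has_integral_lipschitz_derivative:
  fixes F :: "real \<Rightarrow> real"
  assumes F: "L-lipschitz_on UNIV F" and d: "AE x in lborel. (F has_vector_derivative d x) (at x)"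
    and "a \<le> b"
  shows "(d has_integral (F b - F a)) {a..b}"
proof -
  obtain F' where "F' \<in> borel_measurable borel"
    and F': "AE x in lborel. (F has_real_derivative F' x) (at x)"
    "\<And>a b. a \<le> b \<Longrightarrow> (F' has_integral (F b - F a)) {a..b}"
    by (rule lipschitz_real_ex_derivative[OF F]) (rule that)
  have "AE x in lborel. d x = F' x"
    using d F'(1)
    by eventually_elim (metis has_real_derivative_iff_has_vector_derivative vector_derivative_unique_at)
  then have "negligible {x. d x \<noteq> F' x}" by (simp add: AE_lborel_iff_negligible)
  from has_integral_spike[OF this _ F'(2)[OF \<open>a \<le> b\<close>], of d] show ?thesis by auto
qed

text \<open>By Fubini and the fundamental theorem on lines only the boundary value at time 0
  survives. This evaluates the terms of the relative entropy that depend on the reconstruction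
  alone.\<close>

lemma integral_partial_derivatives:
  fixes K :: "real \<times> real \<Rightarrow> real"
  assumes K: "L-lipschitz_on UNIV K" and T: "0 < T"
    and s1: "\<And>t x. T \<le> t \<Longrightarrow> K (t, x) = 0" and s2: "\<And>t x. r \<le> \<bar>x\<bar> \<Longrightarrow> K (t, x) = 0"
  obtains Dt Dx where
    "AE (t, x) in slab T. ((\<lambda>s. K (s, x)) has_real_derivative Dt (t, x)) (at t)"
    "AE (t, x) in slab T. ((\<lambda>z. K (t, z)) has_real_derivative Dx (t, x)) (at x)"
    "integrable (slab T) Dt" "integral\<^sup>L (slab T) Dt = - (LINT x|lborel. K (0, x))"
    "integrable (slab T) Dx" "integral\<^sup>L (slab T) Dx = 0"
proof -
  obtain Dt Dx where D [measurable]: "Dt \<in> borel_measurable borel" "Dx \<in> borel_measurable borel"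
    and b: "\<And>z. norm (Dt z) \<le> L" "\<And>z. norm (Dx z) \<le> L"
    and sl: "\<And>x. AE t in lborel. ((\<lambda>s. K (s, x)) has_vector_derivative Dt (t, x)) (at t)"
      "\<And>t. AE x in lborel. ((\<lambda>z. K (t, z)) has_vector_derivative Dx (t, x)) (at x)"
    and ae: "AE (t, x) in lborel. ((\<lambda>s. K (s, x)) has_vector_derivative Dt (t, x)) (at t)"
      "AE (t, x) in lborel. ((\<lambda>z. K (t, z)) has_vector_derivative Dx (t, x)) (at x)"
    using lipschitz_partial_derivatives[OF K] by blast
  \<comment> \<open>Strictly larger than \<open>r\<close>: beyond \<open>R\<close> the function
    vanishes in a neighbourhood in space, so its derivatives are 0 there and may be cut off.\<close>
  define R where "R = max r 0 + 1"
  have R: "R > 0" "r < R" by (auto simp: R_def)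
  define A where "A = {0<..<T} \<times> {- R..R}"
  have [measurable]: "A \<in> sets borel" unfolding A_def by (intro borel_Times) auto
  have A_iff: "z \<in> A \<longleftrightarrow> fst z \<in> {0<..<T} \<and> snd z \<in> {- R..R}" for z
    by (auto simp: A_def mem_Times_iff)
  define Et where "Et = (\<lambda>z. indicator A z * Dt z)"
  define Ex where "Ex = (\<lambda>z. indicator A z * Dx z)"
  have E_meas [measurable]: "Et \<in> borel_measurable borel" "Ex \<in> borel_measurable borel"
    unfolding Et_def Ex_def by measurable
  have L: "0 \<le> L" using K by (rule lipschitz_on_nonneg)
  have A0: "indicator A z = (0::real)" if "T + R < norm z" for z
  proof (rule ccontr)
    assume "indicator A z \<noteq> (0::real)"
    then have "z \<in> A" by (simp add: indicator_def split: if_splits)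
    then have "norm (fst z) \<le> T" "norm (snd z) \<le> R" by (auto simp: A_def)
    then have "norm z \<le> T + R"
      using norm_Pair_le[of "fst z" "snd z"] by simp
    with that show False by simp
  qed
  have int: "integrable lborel Et" "integrable lborel Ex"
    unfolding Et_def Ex_def
    by (rule bounded_compact_support_integrable[of _ L "T + R"]; use b A0 L in \<open>auto simp: indicator_def\<close>)+
  have T': "(LINT t|lborel. Et (t, x)) = - K (0, x)" for x
  proof (cases "x \<in> {- R..R}")
    case True
    have hi: "((\<lambda>t. Dt (t, x)) has_integral (K (T, x) - K (0, x))) {0..T}"
      by (rule has_integral_lipschitz_derivative[OF lipschitz_slice(1)[OF K] sl(1)]) (use T in simp)
    have si: "set_integrable lborel {0..T} (\<lambda>t. Dt (t, x))"
      unfolding set_integrable_def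
      by (rule bounded_compact_support_integrable[of _ L T]) (use b L in \<open>auto simp: indicator_def\<close>)
    have "(LINT t|lborel. Et (t, x)) = (LINT t:{0..T}|lborel. Dt (t, x))"
      unfolding set_lebesgue_integral_def
    proof (rule integral_cong_AE)
      have "AE t in lborel. t \<noteq> 0 \<and> t \<noteq> T"
        using AE_lborel_singleton[of 0] AE_lborel_singleton[of T] by eventually_elim auto
      then show "AE t in lborel. Et (t, x) = indicator {0..T} t *\<^sub>R Dt (t, x)"
        by eventually_elim (use True in \<open>auto simp: Et_def A_iff indicator_def\<close>)
    qed measurable
    also have "\<dots> = K (T, x) - K (0, x)"
      using set_borel_integral_eq_integral(2)[OF si] hi by (simp add: integral_unique)
    finally show ?thesis using s1 by simp
  next
    case False
    then have "K (0, x) = 0" using R by (intro s2) auto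
    moreover have "Et (t, x) = 0" for t using False by (auto simp: Et_def A_iff)
    ultimately show ?thesis by simp
  qed
  have X': "(LINT x|lborel. Ex (t, x)) = 0" for t
  proof (cases "t \<in> {0<..<T}")
    case True
    have hi: "((\<lambda>x. Dx (t, x)) has_integral (K (t, R) - K (t, - R))) {- R..R}"
      by (rule has_integral_lipschitz_derivative[OF lipschitz_slice(2)[OF K] sl(2)]) (use R in simp)
    have si: "set_integrable lborel {- R..R} (\<lambda>x. Dx (t, x))"
      unfolding set_integrable_def
      by (rule bounded_compact_support_integrable[of _ L R]) (use b L in \<open>auto simp: indicator_def\<close>)
    have "(LINT x|lborel. Ex (t, x)) = (LINT x:{-R..R}|lborel. Dx (t, x))"
      unfolding set_lebesgue_integral_def
      by (rule Bochner_Integration.integral_cong) (use True in \<open>auto simp: Ex_def A_iff indicator_def\<close>)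
    also have "\<dots> = K (t, R) - K (t, - R)"
      using set_borel_integral_eq_integral(2)[OF si] hi by (simp add: integral_unique)
    finally show ?thesis using s2 R by simp
  next
    case False
    then have "Ex (t, x) = 0" for x by (auto simp: Ex_def A_iff)
    then show ?thesis by simp
  qed
  have Et: "integral\<^sup>L lborel Et = - (LINT x|lborel. K (0, x))"
    using lborel_pair.integral_snd[of "\<lambda>t x. Et (t, x)"] int(1) by (simp add: lborel_prod T')
  have Ex: "integral\<^sup>L lborel Ex = 0"
    using lborel_pair.integral_fst[of "\<lambda>t x. Ex (t, x)"] int(2) by (simp add: lborel_prod X')
  have A_slab: "A \<subseteq> {0<..<T} \<times> UNIV" by (auto simp: A_def)
  have Om: "{0<..<T} \<times> UNIV \<in> sets (lborel :: (real \<times> real) measure)"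
    by (simp add: borel_Times)
  have slab_eq: "indicator ({0<..<T} \<times> UNIV) z *\<^sub>R Et z = Et z"
    "indicator ({0<..<T} \<times> UNIV) z *\<^sub>R Ex z = Ex z" for z
    using A_slab by (auto simp: Et_def Ex_def indicator_def)
  have ae_slab: "AE z in slab T. P z" if "AE z in lborel. P z" for P
    unfolding slab_def using that Om by (subst AE_restrict_space_iff) (auto elim: eventually_mono)
  have slabA: "AE z in slab T. fst z \<in> {0<..<T}"
    unfolding slab_def by (intro AE_I2) (auto simp: space_restrict_space)
  show ?thesis
  proof (rule that[of Et Ex])
    show "AE (t, x) in slab T. ((\<lambda>s. K (s, x)) has_real_derivative Et (t, x)) (at t)"
      using ae_slab[OF ae(1)] slabA
    proof eventually_elim
      case (elim z)
      show ?case
      proof (cases "snd z \<in> {- R..R}")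
        case True
        then have "Et z = Dt z" using elim(2) by (auto simp: Et_def A_iff indicator_def mem_Times_iff)
        with elim(1) show ?thesis by (auto simp: has_real_derivative_iff_has_vector_derivative)
      next
        case False
        then have "r \<le> \<bar>snd z\<bar>" using R by auto
        then have "(\<lambda>s. K (s, snd z)) = (\<lambda>s. 0)" using s2 by auto
        moreover have "Et z = 0" using False by (auto simp: Et_def A_iff)
        ultimately show ?thesis by (auto simp: split_beta)
      qed
    qed
    show "AE (t, x) in slab T. ((\<lambda>z. K (t, z)) has_real_derivative Ex (t, x)) (at x)"
      using ae_slab[OF ae(2)] slabA
    proof eventually_elim
      case (elim z)
      show ?case
      proof (cases "snd z \<in> {- R..R}")
        case True
        then have "Ex z = Dx z" using elim(2) by (auto simp: Ex_def A_iff indicator_def mem_Times_iff)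
        with elim(1) show ?thesis by (auto simp: has_real_derivative_iff_has_vector_derivative)
      next
        case False
        have "((\<lambda>x. 0 :: real) has_real_derivative 0) (at (snd z))" by simp
        moreover have "open {x. r < \<bar>x\<bar>}" by (intro open_Collect_less continuous_intros)
        moreover have "snd z \<in> {x. r < \<bar>x\<bar>}" using False R by auto
        ultimately have "((\<lambda>x. K (fst z, x)) has_real_derivative 0) (at (snd z))"
          by (rule has_field_derivative_transform_within_open) (use s2 in auto)
        moreover have "Ex z = 0" using False by (auto simp: Ex_def A_iff)
        ultimately show ?thesis by (auto simp: split_beta)
      qed
    qed
    show "integrable (slab T) Et" "integrable (slab T) Ex"
      unfolding slab_def using int Om by (simp_all add: integrable_restrict_space slab_eq del: real_scaleR_def)
    show "integral\<^sup>L (slab T) Et = - (LINT x|lborel. K (0, x))" "integral\<^sup>L (slab T) Ex = 0"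
      unfolding slab_def using Et Ex Om by (simp_all add: integral_restrict_space slab_eq del: real_scaleR_def)
  qed
qed

section \<open>Second-order calculus and relative entropy\<close>

lemma dist_self_add: "dist w (w + y) = norm (y :: 'a::real_normed_vector)"
  by (simp add: dist_norm)

text \<open>Schwarz's theorem for a derivative \<open>g'\<close> that is assumed differentiable at
  \<open>w\<close> only. The second difference is symmetric in \<open>a\<close> and
  \<open>b\<close>; the mean value theorem in direction \<open>b\<close> and the expansion of
  \<open>g'\<close> at \<open>w\<close> show that it equals s^2 times \<open>G a b\<close> up to
  o(s^2).\<close>

lemma second_derivative_symmetric:
  fixes g :: "'a::real_normed_vector \<Rightarrow> real" and g' :: "'a \<Rightarrow> 'a \<Rightarrow>\<^sub>L real"
  assumes U: "open U" "w \<in> U"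
    and g: "\<And>z. z \<in> U \<Longrightarrow> (g has_derivative blinfun_apply (g' z)) (at z)"
    and G: "(g' has_derivative G) (at w)"
  shows "G a b = G b a"
proof -
  define \<Delta> where "\<Delta> = (\<lambda>a b s. g (w + s *\<^sub>R a + s *\<^sub>R b) - g (w + s *\<^sub>R a) - g (w + s *\<^sub>R b) + g w)"
  have lin: "bounded_linear G" using G by (rule has_derivative_bounded_linear)
  have key: "\<exists>d>0. \<forall>s. 0 < s \<longrightarrow> s < d \<longrightarrow> \<bar>\<Delta> a b s - s\<^sup>2 * G a b\<bar> \<le> e * s\<^sup>2" if e: "e > 0" for a b e
  proof -
    \<comment> \<open>The factor that the error estimate accumulates; the summand 1 keeps it
      positive in degenerate cases such as \<open>b = 0\<close>.\<close>
    define N where "N = 2 * (norm a + norm b) * norm b + 1"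
    have N: "N > 0" by (auto simp: N_def intro: add_nonneg_pos)
    define e' where "e' = e / N"
    have e': "e' > 0" using e N by (simp add: e'_def)
    obtain r where r: "r > 0" "ball w r \<subseteq> U" using U openE by blast
    from G e' obtain d where d: "d > 0"
      "\<And>y. norm (y - w) < d \<Longrightarrow> norm (g' y - g' w - G (y - w)) \<le> e' * norm (y - w)"
      unfolding has_derivative_at_alt by blast
    define \<rho> where "\<rho> = min r d / (norm a + norm b + 1)"
    have ab: "norm a + norm b + 1 > 0" using norm_ge_zero[of a] norm_ge_zero[of b] by linarith
    have "\<rho> > 0" using r d ab by (auto simp: \<rho>_def intro!: divide_pos_pos)
    moreover have "\<bar>\<Delta> a b s - s\<^sup>2 * G a b\<bar> \<le> e * s\<^sup>2" if s: "0 < s" "s < \<rho>" for s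
    proof -
      have small: "norm (\<alpha> *\<^sub>R a + \<beta> *\<^sub>R b) < min r d" if "0 \<le> \<alpha>" "\<alpha> \<le> s" "0 \<le> \<beta>" "\<beta> \<le> s" for \<alpha> \<beta>
      proof -
        have "norm (\<alpha> *\<^sub>R a + \<beta> *\<^sub>R b) \<le> \<alpha> * norm a + \<beta> * norm b"
          using norm_triangle_ineq[of "\<alpha> *\<^sub>R a" "\<beta> *\<^sub>R b"] that by simp
        also have "\<dots> \<le> s * norm a + s * norm b"
          using that by (intro add_mono mult_right_mono) auto
        also have "\<dots> < s * (norm a + norm b + 1)" using s by (simp add: algebra_simps)
        also have "\<dots> < min r d" using s ab by (simp add: \<rho>_def pos_less_divide_eq)
        finally show ?thesis .
      qed
      \<comment> \<open>The second difference is the increment of \<open>k\<close> over the unit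
        interval, so one application of the mean value theorem reduces it to first
        derivatives.\<close>
      define k where "k = (\<lambda>\<tau>. g (w + s *\<^sub>R a + (\<tau> * s) *\<^sub>R b) - g (w + (\<tau> * s) *\<^sub>R b))"
      define k' where "k' = (\<lambda>\<tau>. s * (g' (w + s *\<^sub>R a + (\<tau> * s) *\<^sub>R b) b - g' (w + (\<tau> * s) *\<^sub>R b) b))"
      have k: "(k has_real_derivative k' \<tau>) (at \<tau>)" if \<tau>: "0 \<le> \<tau>" "\<tau> \<le> 1" for \<tau>
      proof -
        have ts: "0 \<le> \<tau> * s" "\<tau> * s \<le> s" using \<tau> s by (auto simp: mult_left_le_one_le)
        have "w + s *\<^sub>R a + (\<tau> * s) *\<^sub>R b \<in> ball w r" "w + (\<tau> * s) *\<^sub>R b \<in> ball w r"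
          using small[of s "\<tau> * s"] small[of 0 "\<tau> * s"] ts s
          by (auto simp: dist_self_add add.assoc)
        then have in_U: "w + s *\<^sub>R a + (\<tau> * s) *\<^sub>R b \<in> U" "w + (\<tau> * s) *\<^sub>R b \<in> U" using r by auto
        have 1: "((\<lambda>\<tau>. g (w + s *\<^sub>R a + (\<tau> * s) *\<^sub>R b)) has_derivative
            (\<lambda>h. g' (w + s *\<^sub>R a + (\<tau> * s) *\<^sub>R b) ((h * s) *\<^sub>R b))) (at \<tau>)"
          by (rule has_derivative_compose[where f = "\<lambda>\<tau>. w + s *\<^sub>R a + (\<tau> * s) *\<^sub>R b", OF _ g[OF in_U(1)]]) (auto intro!: derivative_eq_intros)
        have 2: "((\<lambda>\<tau>. g (w + (\<tau> * s) *\<^sub>R b)) has_derivative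
            (\<lambda>h. g' (w + (\<tau> * s) *\<^sub>R b) ((h * s) *\<^sub>R b))) (at \<tau>)"
          by (rule has_derivative_compose[where f = "\<lambda>\<tau>. w + (\<tau> * s) *\<^sub>R b", OF _ g[OF in_U(2)]]) (auto intro!: derivative_eq_intros)
        from has_derivative_diff[OF 1 2] show ?thesis
          unfolding has_field_derivative_def k_def k'_def
          by (rule has_derivative_eq_rhs) (auto simp: blinfun.scaleR_right algebra_simps)
      qed
      obtain \<tau> where \<tau>: "0 < \<tau>" "\<tau> < 1" "k 1 - k 0 = k' \<tau>"
        using MVT2[of 0 1 k k'] k by auto
      have ts: "0 \<le> \<tau> * s" "\<tau> * s \<le> s" using \<tau> s by (auto simp: mult_left_le_one_le)
      define y1 where "y1 = s *\<^sub>R a + (\<tau> * s) *\<^sub>R b"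
      define y2 where "y2 = (\<tau> * s) *\<^sub>R b"
      have y: "norm y1 < d" "norm y2 < d"
        using small[of s "\<tau> * s"] small[of 0 "\<tau> * s"] ts s by (auto simp: y1_def y2_def)
      have yb: "norm y1 \<le> s * (norm a + norm b)" "norm y2 \<le> s * (norm a + norm b)"
      proof -
        have b: "(\<tau> * s) * norm b \<le> s * norm b" using ts by (intro mult_right_mono) auto
        have "norm y1 \<le> s * norm a + (\<tau> * s) * norm b"
          unfolding y1_def using norm_triangle_ineq[of "s *\<^sub>R a" "(\<tau> * s) *\<^sub>R b"] ts s by simp
        then show "norm y1 \<le> s * (norm a + norm b)" using b by (simp add: algebra_simps)
        have "norm y2 = (\<tau> * s) * norm b" using ts by (simp add: y2_def)
        moreover have "0 \<le> s * norm a" using s by simp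
        ultimately show "norm y2 \<le> s * (norm a + norm b)" using b by (simp add: distrib_left)
      qed
      have Gy: "G y1 - G y2 = s *\<^sub>R G a"
        using lin by (simp add: y1_def y2_def linear_simps)
      define E where "E = g' (w + y1) - g' (w + y2) - s *\<^sub>R G a"
      have "E = (g' (w + y1) - g' w - G y1) - (g' (w + y2) - g' w - G y2)"
        unfolding E_def Gy[symmetric] by simp
      then have "norm E \<le> norm (g' (w + y1) - g' w - G y1) + norm (g' (w + y2) - g' w - G y2)"
        by (metis norm_triangle_ineq4)
      also have "\<dots> \<le> e' * norm y1 + e' * norm y2"
        using d(2)[of "w + y1"] d(2)[of "w + y2"] y by (intro add_mono) auto
      also have "\<dots> \<le> e' * (s * (norm a + norm b)) + e' * (s * (norm a + norm b))"
        using yb e' by (intro add_mono mult_left_mono) auto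
      finally have E: "norm E \<le> 2 * e' * s * (norm a + norm b)" by (simp add: algebra_simps)
      have "\<Delta> a b s = k' \<tau>"
        unfolding \<tau>(3)[symmetric] by (simp add: \<Delta>_def k_def)
      also have "\<dots> = s * (E b + s * G a b)"
        by (simp add: k'_def E_def y1_def y2_def add.assoc blinfun.diff_left blinfun.scaleR_left)
      finally have "\<Delta> a b s - s\<^sup>2 * G a b = s * E b" by (simp add: power2_eq_square algebra_simps)
      then have "\<bar>\<Delta> a b s - s\<^sup>2 * G a b\<bar> = s * norm (E b)" using s by (simp add: abs_mult)
      also have "\<dots> \<le> s * (norm E * norm b)" using s norm_blinfun[of E b] by (intro mult_left_mono) auto
      also have "\<dots> \<le> s * ((2 * e' * s * (norm a + norm b)) * norm b)"
        using E s by (intro mult_left_mono mult_right_mono) auto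
      also have "\<dots> = s\<^sup>2 * e' * (2 * (norm a + norm b) * norm b)"
        by (simp add: power2_eq_square algebra_simps)
      also have "\<dots> \<le> s\<^sup>2 * e' * N" using e' by (intro mult_left_mono) (auto simp: N_def)
      also have "\<dots> = e * s\<^sup>2" using N by (simp add: e'_def)
      finally show ?thesis .
    qed
    ultimately show ?thesis by blast
  qed
  have "\<bar>G a b - G b a\<bar> \<le> 0 + e" if "e > 0" for e
  proof -
    have e2: "e / 2 > 0" using that by simp
    obtain d1 where d1: "d1 > 0" "\<And>s. 0 < s \<Longrightarrow> s < d1 \<Longrightarrow> \<bar>\<Delta> a b s - s\<^sup>2 * G a b\<bar> \<le> e / 2 * s\<^sup>2"
      using key[OF e2] by blast
    obtain d2 where d2: "d2 > 0" "\<And>s. 0 < s \<Longrightarrow> s < d2 \<Longrightarrow> \<bar>\<Delta> b a s - s\<^sup>2 * G b a\<bar> \<le> e / 2 * s\<^sup>2"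
      using key[OF e2] by blast
    define s where "s = min d1 d2 / 2"
    have s: "0 < s" "s < d1" "s < d2" using d1 d2 by (auto simp: s_def min_def)
    have "\<Delta> a b s = \<Delta> b a s" by (simp add: \<Delta>_def algebra_simps)
    then have "\<bar>s\<^sup>2 * G a b - s\<^sup>2 * G b a\<bar> \<le> e * s\<^sup>2"
      using d1(2)[OF s(1,2)] d2(2)[OF s(1,3)] by linarith
    moreover have "\<bar>s\<^sup>2 * G a b - s\<^sup>2 * G b a\<bar> = \<bar>G a b - G b a\<bar> * s\<^sup>2"
      unfolding right_diff_distrib[symmetric] abs_mult by simp
    ultimately show ?thesis using s by simp
  qed
  then have "\<bar>G a b - G b a\<bar> \<le> 0" by (rule field_le_epsilon)
  then show ?thesis by simp
qed

lemma second_order_taylor: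
  fixes g :: "'a::real_normed_vector \<Rightarrow> real" and g' :: "'a \<Rightarrow> 'a \<Rightarrow>\<^sub>L real"
  assumes g: "\<And>z. z \<in> closed_segment v u \<Longrightarrow> (g has_derivative blinfun_apply (g' z)) (at z)"
    and g': "\<And>z. z \<in> closed_segment v u \<Longrightarrow> (g' has_derivative g'' z) (at z)"
  obtains z where "z \<in> closed_segment v u"
    "g u = g v + g' v (u - v) + g'' z (u - v) (u - v) / 2"
proof -
  define d where "d = u - v"
  \<comment> \<open>Data for the Maclaurin expansion of order 2 on the unit interval: the
    restriction to the segment and its first two derivatives.\<close>
  define D where "D = (\<lambda>(n::nat) t. if n = 0 then g (v + t *\<^sub>R d)
    else if n = 1 then g' (v + t *\<^sub>R d) d else g'' (v + t *\<^sub>R d) d d)"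
  have seg: "v + t *\<^sub>R d \<in> closed_segment v u" if "0 \<le> t" "t \<le> 1" for t
    unfolding closed_segment_def using that
    by (auto simp: d_def algebra_simps intro!: exI[of _ t])
  have line: "((\<lambda>t. v + t *\<^sub>R d) has_derivative (\<lambda>h. h *\<^sub>R d)) (at t)" for t
    by (auto intro!: derivative_eq_intros)
  have 1: "((\<lambda>t. g (v + t *\<^sub>R d)) has_real_derivative g' (v + t *\<^sub>R d) d) (at t)" if "0 \<le> t" "t \<le> 1" for t
    using has_derivative_compose[OF line g[OF seg[OF that]]]
    by (simp add: has_field_derivative_def blinfun.scaleR_right mult.commute[of _ "blinfun_apply _ _"])
  have 2: "((\<lambda>t. g' (v + t *\<^sub>R d) d) has_real_derivative g'' (v + t *\<^sub>R d) d d) (at t)" if t: "0 \<le> t" "t \<le> 1" for t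
  proof -
    have "((\<lambda>t. g' (v + t *\<^sub>R d) d) has_derivative (\<lambda>h. g'' (v + t *\<^sub>R d) (h *\<^sub>R d) d)) (at t)"
      by (rule bounded_linear.has_derivative[OF blinfun.bounded_linear_left])
         (rule has_derivative_compose[OF line g'[OF seg[OF t]]])
    moreover have "linear (g'' (v + t *\<^sub>R d))"
      using has_derivative_linear[OF g'[OF seg[OF t]]] .
    ultimately show ?thesis
      by (simp add: has_field_derivative_def linear_scale blinfun.scaleR_left mult.commute[of _ "blinfun_apply _ _"])
  qed
  have "\<exists>t. 0 < t \<and> t < 1 \<and> (\<lambda>t. g (v + t *\<^sub>R d)) 1 =
    sum (\<lambda>m. (D m 0 / fact m) * 1 ^ m) {..<2} + (D 2 t / fact 2) * 1 ^ 2"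
  proof (rule Maclaurin)
    show "\<forall>m t. m < 2 \<and> 0 \<le> t \<and> t \<le> 1 \<longrightarrow> DERIV (D m) t :> D (Suc m) t"
      using 1 2 by (auto simp: D_def less_2_cases_iff)
  qed (simp_all add: D_def)
  then obtain t where t: "0 < t" "t < 1" "g (v + d) = g v + g' v d + g'' (v + t *\<^sub>R d) d d / 2"
    by (auto simp: D_def numeral_2_eq_2 fact_2)
  show ?thesis
    by (rule that[of "v + t *\<^sub>R d"]) (use t seg in \<open>auto simp: d_def\<close>)
qed

section \<open>Twice continuously differentiable functions on compact convex sets\<close>

lemma D1_has_derivative:
  "f differentiable (at w) \<Longrightarrow> (f has_derivative blinfun_apply (D1 f w)) (at w)"
  unfolding D1_def
  by (subst bounded_linear_Blinfun_apply) (auto simp: frechet_derivative_works has_derivative_bounded_linear)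

lemma C2_onD:
  assumes "C2_on U f" "w \<in> U"
  shows "(f has_derivative blinfun_apply (D1 f w)) (at w)"
    "(D1 f has_derivative blinfun_apply (D2 f w)) (at w)"
  using assms D1_has_derivative[of f w] D1_has_derivative[of "D1 f" w]
  by (auto simp: C2_on_def D2_def)

lemma C2_on_continuous:
  assumes "C2_on U f"
  shows "continuous_on U f" "continuous_on U (D1 f)" "continuous_on U (D2 f)"
  using assms unfolding C2_on_def
  by (auto intro!: continuous_at_imp_continuous_on differentiable_imp_continuous_within)

lemma lipschitz_on_compact_convex:
  fixes g :: "'a::real_normed_vector \<Rightarrow> 'b::real_normed_vector" and g' :: "'a \<Rightarrow> 'a \<Rightarrow>\<^sub>L 'b"
  assumes "\<And>w. w \<in> C \<Longrightarrow> (g has_derivative blinfun_apply (g' w)) (at w)"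
    and "continuous_on C g'" "compact C" "convex C"
  obtains L where "L-lipschitz_on C g"
proof -
  have "bounded (g' ` C)" using assms compact_continuous_image compact_imp_bounded by blast
  then obtain B where B: "\<And>w. w \<in> C \<Longrightarrow> norm (g' w) \<le> B" unfolding bounded_iff by auto
  \<comment> \<open>The maximum keeps the constant nonnegative when \<open>C\<close> is
    empty.\<close>
  have "(max B 0)-lipschitz_on C g"
  proof (rule bounded_derivative_imp_lipschitz[where f' = "\<lambda>w. blinfun_apply (g' w)"])
    show "(g has_derivative blinfun_apply (g' x)) (at x within C)" if "x \<in> C" for x
      using assms(1)[OF that] by (rule has_derivative_at_withinI)
    show "onorm (blinfun_apply (g' x)) \<le> max B 0" if "x \<in> C" for x
      using B[OF that] by (simp add: norm_blinfun.rep_eq[symmetric])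
  qed (use assms in auto)
  then show ?thesis by (rule that)
qed

section \<open>Relative entropy, relative fluxes and their quadratic bounds\<close>

locale relative_entropy =
  fixes U C :: "(real^'m) set" and f :: "real^'m \<Rightarrow> real^'m" and \<eta> q :: "real^'m \<Rightarrow> real"
    and Cf Cl Cu :: real
  assumes open_U: "open U" and C2_f: "C2_on U f" and pair: "entropy_pair U f \<eta> q"
    and convex_C: "convex C" and compact_C: "compact C" and C_sub_U: "C \<subseteq> U"
    and Cf_pos: "0 < Cf" and Cl_pos: "0 < Cl" and Cl_less_Cu: "Cl < Cu"
    and D2_f_le: "\<And>v w. w \<in> C \<Longrightarrow> norm (D2 f w v v) \<le> Cf * (norm v)\<^sup>2"
    and D2_eta: "\<And>v w. w \<in> C \<Longrightarrow> Cl * (norm v)\<^sup>2 \<le> D2 \<eta> w v v \<and> D2 \<eta> w v v \<le> Cu * (norm v)\<^sup>2"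
begin

definition rel_eta where "rel_eta u v = \<eta> u - \<eta> v - D1 \<eta> v (u - v)"

text \<open>The flux that accompanies \<open>rel_eta\<close>. It is not the Taylor remainder of
  \<open>q\<close>: at a state \<open>v\<close> in \<open>U\<close> it is that remainder minus
  \<open>D1 \<eta> v\<close> applied to \<open>rel_f u v\<close>, because \<open>D1 q\<close> is
  \<open>D1 \<eta>\<close> composed with \<open>D1 f\<close>.\<close>

definition rel_q where "rel_q u v = q u - q v - D1 \<eta> v (f u - f v)"

definition rel_f where "rel_f u v = f u - f v - D1 f v (u - v)"

lemma Cu_pos: "0 < Cu" using Cl_pos Cl_less_Cu by simp

lemma C2_eta: "C2_on U \<eta>" and C2_q: "C2_on U q"
  and flux: "w \<in> U \<Longrightarrow> D1 q w v = D1 \<eta> w (D1 f w v)"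
  using pair by (auto simp: entropy_pair_def) (metis blinfun_apply_blinfun_compose)

lemmas derivs =
  C2_onD(1)[OF C2_f] C2_onD(2)[OF C2_f] C2_onD(1)[OF C2_eta] C2_onD(2)[OF C2_eta]
  C2_onD(1)[OF C2_q] C2_onD(2)[OF C2_q]

lemma D2_eta_symmetric: "w \<in> U \<Longrightarrow> D2 \<eta> w a b = D2 \<eta> w b a"
  by (rule second_derivative_symmetric[OF open_U _ C2_onD(1)[OF C2_eta] C2_onD(2)[OF C2_eta]])

text \<open>The second derivative at \<open>w\<close> of \<open>q - D\<eta>(w) \<circ> f\<close> is \<open>D\<^sup>2\<eta>(w)\<close> composed with \<open>Df(w)\<close>, without a
  contribution of \<open>D\<^sup>2f\<close>.\<close>

lemma D2_eta_D1_f: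
  assumes w: "w \<in> U"
  shows "D2 \<eta> w (D1 f w a) b = D2 \<eta> w a (D1 f w b)"
proof -
  define g where "g = (\<lambda>z. q z - D1 \<eta> w (f z))"
  define g' where "g' = (\<lambda>z. (D1 \<eta> z - D1 \<eta> w) o\<^sub>L D1 f z)"
  have g: "(g has_derivative blinfun_apply (g' z)) (at z)" if "z \<in> U" for z
  proof -
    have "(g has_derivative (\<lambda>h. D1 q z h - D1 \<eta> w (D1 f z h))) (at z)"
      unfolding g_def using derivs[OF that]
      by (intro has_derivative_diff bounded_linear.has_derivative[OF blinfun.bounded_linear_right])
    moreover have "(\<lambda>h. D1 q z h - D1 \<eta> w (D1 f z h)) = blinfun_apply (g' z)"
      using flux[OF that] by (auto simp: g'_def blinfun.diff_left)
    ultimately show ?thesis by simp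
  qed
  have "(g' has_derivative (\<lambda>h. ((D1 \<eta> w - D1 \<eta> w) o\<^sub>L D2 f w h) + (D2 \<eta> w h o\<^sub>L D1 f w))) (at w)"
    unfolding g'_def
    by (rule bounded_bilinear.FDERIV[OF bounded_bilinear_blinfun_compose])
       (use derivs[OF w] in \<open>auto intro!: derivative_eq_intros\<close>)
  from second_derivative_symmetric[OF open_U w g this, of a b]
  have "D2 \<eta> w a (D1 f w b) = D2 \<eta> w b (D1 f w a)"
    by (simp add: blinfun.add_left blinfun.zero_left)
  then show ?thesis using D2_eta_symmetric[OF w, of b] by simp
qed

text \<open>Polarization. For unit vectors, positivity and the upper bound put the values of the
  form on the diagonal at a + b and a - b between 0 and 4 Cu. Their difference is four times the
  mixed value, so the constant for mixed arguments is again \<open>Cu\<close>; scaling does the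
  rest.\<close>

lemma D2_eta_le:
  assumes w: "w \<in> C"
  shows "\<bar>D2 \<eta> w a b\<bar> \<le> Cu * norm a * norm b"
proof -
  have wU: "w \<in> U" using w C_sub_U by auto
  have unit: "\<bar>D2 \<eta> w a b\<bar> \<le> Cu" if "norm a = 1" "norm b = 1" for a b
  proof -
    have pol: "4 * D2 \<eta> w a b = D2 \<eta> w (a + b) (a + b) - D2 \<eta> w (a - b) (a - b)"
      using D2_eta_symmetric[OF wU, of b a]
      by (simp add: blinfun.add_left blinfun.add_right blinfun.diff_left blinfun.diff_right)
    have nb: "(norm (a + b))\<^sup>2 \<le> 4" "(norm (a - b))\<^sup>2 \<le> 4"
      using norm_triangle_ineq[of a b] norm_triangle_ineq4[of a b] that
        power_mono[of "norm (a + b)" 2 2] power_mono[of "norm (a - b)" 2 2] by auto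
    have nn: "0 \<le> D2 \<eta> w v v" for v
      using D2_eta[OF w, of v] Cl_pos by (meson mult_nonneg_nonneg less_imp_le order_trans zero_le_power2)
    have "D2 \<eta> w (a + b) (a + b) \<le> Cu * 4" "D2 \<eta> w (a - b) (a - b) \<le> Cu * 4"
      using D2_eta[OF w] nb Cu_pos by (meson mult_left_mono less_imp_le order_trans)+
    then show ?thesis using pol nn[of "a + b"] nn[of "a - b"] by (simp add: abs_le_iff)
  qed
  show ?thesis
  proof (cases "a = 0 \<or> b = 0")
    case False
    have "\<bar>D2 \<eta> w (sgn a) (sgn b)\<bar> \<le> Cu" by (rule unit) (use False in \<open>auto simp: norm_sgn\<close>)
    then have "norm a * norm b * \<bar>D2 \<eta> w (sgn a) (sgn b)\<bar> \<le> norm a * norm b * Cu"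
      by (intro mult_left_mono) auto
    moreover have "norm a * norm b * \<bar>D2 \<eta> w (sgn a) (sgn b)\<bar> = \<bar>D2 \<eta> w (norm a *\<^sub>R sgn a) (norm b *\<^sub>R sgn b)\<bar>"
      by (simp add: blinfun.scaleR_left blinfun.scaleR_right abs_mult)
    moreover have "norm a *\<^sub>R sgn a = a" "norm b *\<^sub>R sgn b = b" using False by (auto simp: sgn_div_norm)
    ultimately show ?thesis by (simp add: mult.commute mult.left_commute)
  qed (use Cu_pos in auto)
qed

lemma seg_C: "u \<in> C \<Longrightarrow> v \<in> C \<Longrightarrow> z \<in> closed_segment v u \<Longrightarrow> z \<in> C"
  using convex_C convex_contains_segment by blast

lemma seg_U: "u \<in> C \<Longrightarrow> v \<in> C \<Longrightarrow> z \<in> closed_segment v u \<Longrightarrow> z \<in> U"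
  using seg_C C_sub_U by blast

text \<open>The halves are those of Taylor's formula; convexity keeps the intermediate point in
  \<open>C\<close>, where the Hessian is controlled.\<close>

lemma rel_eta_bounds:
  assumes uv: "u \<in> C" "v \<in> C"
  shows "Cl / 2 * (norm (u - v))\<^sup>2 \<le> rel_eta u v" "rel_eta u v \<le> Cu / 2 * (norm (u - v))\<^sup>2"
proof -
  obtain z where z: "z \<in> closed_segment v u"
    "\<eta> u = \<eta> v + D1 \<eta> v (u - v) + D2 \<eta> z (u - v) (u - v) / 2"
    by (rule second_order_taylor[of v u \<eta> "D1 \<eta>" "\<lambda>z. blinfun_apply (D2 \<eta> z)"])
       (use derivs(3,4)[OF seg_U[OF uv]] in auto)
  then have "rel_eta u v = D2 \<eta> z (u - v) (u - v) / 2" by (simp add: rel_eta_def)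
  then show "Cl / 2 * (norm (u - v))\<^sup>2 \<le> rel_eta u v" "rel_eta u v \<le> Cu / 2 * (norm (u - v))\<^sup>2"
    using D2_eta[OF seg_C[OF uv z(1)], of "u - v"] by auto
qed

text \<open>Taylor's formula with a single intermediate point holds for scalar functions only.
  Pairing \<open>f\<close> with the direction of the remainder reduces to that case without losing
  any of the norm.\<close>

lemma rel_f_le:
  assumes uv: "u \<in> C" "v \<in> C"
  shows "norm (rel_f u v) \<le> Cf / 2 * (norm (u - v))\<^sup>2"
proof -
  define e where "e = sgn (rel_f u v)"
  define g' where "g' = (\<lambda>z. blinfun_inner_left e o\<^sub>L D1 f z)"
  obtain z where z: "z \<in> closed_segment v u"
    "f u \<bullet> e = f v \<bullet> e + g' v (u - v) + (blinfun_inner_left e o\<^sub>L D2 f z (u - v)) (u - v) / 2"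
  proof (rule second_order_taylor[of v u "\<lambda>z. f z \<bullet> e" g' "\<lambda>z h. blinfun_inner_left e o\<^sub>L D2 f z h"])
    fix z assume z: "z \<in> closed_segment v u"
    show "((\<lambda>z. f z \<bullet> e) has_derivative blinfun_apply (g' z)) (at z)"
      using bounded_linear.has_derivative[OF bounded_linear_inner_left derivs(1)[OF seg_U[OF uv z]], of e]
      unfolding g'_def by (rule has_derivative_eq_rhs) (simp add: fun_eq_iff inner_commute)
    show "(g' has_derivative (\<lambda>h. blinfun_inner_left e o\<^sub>L D2 f z h)) (at z)"
      unfolding g'_def
      by (rule bounded_linear.has_derivative[OF
            bounded_bilinear.bounded_linear_right[OF bounded_bilinear_blinfun_compose] derivs(2)[OF seg_U[OF uv z]]])
  qed
  have "norm (rel_f u v) = rel_f u v \<bullet> e"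
    by (simp add: e_def sgn_div_norm norm_eq_sqrt_inner[symmetric] power2_norm_eq_inner[symmetric] power2_eq_square divide_simps)
  also have "\<dots> = D2 f z (u - v) (u - v) \<bullet> e / 2"
    using z(2) by (simp add: rel_f_def g'_def inner_diff_right inner_commute[of _ e])
  also have "\<dots> \<le> norm (D2 f z (u - v) (u - v)) * norm e / 2"
    using norm_cauchy_schwarz[of "D2 f z (u - v) (u - v)" e] by simp
  \<comment> \<open>\<open>e\<close> is 0 and not a unit vector when the remainder vanishes, so only
    the upper bound 1 for its norm is available.\<close>
  also have "\<dots> \<le> norm (D2 f z (u - v) (u - v)) * 1 / 2"
    by (intro divide_right_mono mult_left_mono) (auto simp: e_def norm_sgn)
  also have "\<dots> \<le> Cf * (norm (u - v))\<^sup>2 / 2"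
    using D2_f_le[OF seg_C[OF uv z(1)], of "u - v"] by simp
  finally show ?thesis by simp
qed

text \<open>Since Dq is D\<eta> composed with Df, the first-order terms of \<open>rel_q\<close>
  cancel and it is quadratic in the difference, while \<open>rel_eta\<close> is bounded below by a
  square. The ratio \<open>\<sigma>\<close> bounds the speed at which relative entropy propagates
  and fixes the slope of the cone.\<close>

lemma rel_q_le:
  obtains \<sigma> where "0 \<le> \<sigma>" "\<And>u v. u \<in> C \<Longrightarrow> v \<in> C \<Longrightarrow> \<bar>rel_q u v\<bar> \<le> \<sigma> * rel_eta u v"
proof -
  have "bounded (D2 q ` C)" "bounded (D1 \<eta> ` C)"
    using C2_on_continuous[OF C2_q] C2_on_continuous[OF C2_eta] compact_C C_sub_U
    by (meson compact_continuous_image compact_imp_bounded continuous_on_subset)+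
  then obtain B1 B2 where B: "\<And>w. w \<in> C \<Longrightarrow> norm (D2 q w) \<le> B1" "\<And>w. w \<in> C \<Longrightarrow> norm (D1 \<eta> w) \<le> B2"
    unfolding bounded_iff by auto
  define K where "K = \<bar>B1\<bar> / 2 + \<bar>B2\<bar> * Cf / 2"
  have K: "0 \<le> K" using Cf_pos by (simp add: K_def)
  have "\<bar>rel_q u v\<bar> \<le> K * 2 / Cl * rel_eta u v" if uv: "u \<in> C" "v \<in> C" for u v
  proof -
    obtain z where z: "z \<in> closed_segment v u"
      "q u = q v + D1 q v (u - v) + D2 q z (u - v) (u - v) / 2"
      by (rule second_order_taylor[of v u q "D1 q" "\<lambda>z. blinfun_apply (D2 q z)"])
         (use derivs(5,6)[OF seg_U[OF uv]] in auto)
    have "v \<in> U" using uv C_sub_U by auto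
    then have eq: "rel_q u v = D2 q z (u - v) (u - v) / 2 - D1 \<eta> v (rel_f u v)"
      using z(2) by (simp add: rel_q_def rel_f_def flux blinfun.diff_right)
    have "\<bar>D2 q z (u - v) (u - v)\<bar> \<le> norm (D2 q z (u - v)) * norm (u - v)"
      using norm_blinfun[of "D2 q z (u - v)" "u - v"] by simp
    also have "\<dots> \<le> (norm (D2 q z) * norm (u - v)) * norm (u - v)"
      by (intro mult_right_mono norm_blinfun) auto
    also have "\<dots> \<le> \<bar>B1\<bar> * norm (u - v) * norm (u - v)"
      using B(1)[OF seg_C[OF uv z(1)]] by (intro mult_right_mono) auto
    finally have 1: "\<bar>D2 q z (u - v) (u - v)\<bar> \<le> \<bar>B1\<bar> * (norm (u - v))\<^sup>2" by (simp add: power2_eq_square mult.assoc)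
    have "\<bar>D1 \<eta> v (rel_f u v)\<bar> \<le> norm (D1 \<eta> v) * norm (rel_f u v)"
      using norm_blinfun[of "D1 \<eta> v" "rel_f u v"] by simp
    also have "\<dots> \<le> \<bar>B2\<bar> * (Cf / 2 * (norm (u - v))\<^sup>2)"
      using B(2)[OF uv(2)] rel_f_le[OF uv] by (intro mult_mono) auto
    finally have 2: "\<bar>D1 \<eta> v (rel_f u v)\<bar> \<le> \<bar>B2\<bar> * (Cf / 2 * (norm (u - v))\<^sup>2)" .
    have "\<bar>rel_q u v\<bar> \<le> \<bar>D2 q z (u - v) (u - v)\<bar> / 2 + \<bar>D1 \<eta> v (rel_f u v)\<bar>"
      unfolding eq by linarith
    also have "\<dots> \<le> K * (norm (u - v))\<^sup>2" using 1 2 by (simp add: K_def algebra_simps)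
    also have "\<dots> \<le> K * (2 / Cl * rel_eta u v)"
      using rel_eta_bounds(1)[OF uv] Cl_pos K by (intro mult_left_mono) (auto simp: field_simps)
    finally show ?thesis by simp
  qed
  then show ?thesis using that[of "K * 2 / Cl"] K Cl_pos by auto
qed

lemma lipschitz_on_C:
  obtains L where "L-lipschitz_on C \<eta>" "L-lipschitz_on C q" "L-lipschitz_on C f" "L-lipschitz_on C (D1 \<eta>)"
proof -
  note cont = C2_on_continuous[OF C2_eta] C2_on_continuous[OF C2_q] C2_on_continuous[OF C2_f]
  have *: "continuous_on C g" if "continuous_on U g" for g :: "real^'m \<Rightarrow> 'z::topological_space"
    using that C_sub_U continuous_on_subset by blast
  have U: "w \<in> U" if "w \<in> C" for w using that C_sub_U by auto
  obtain L1 where L1: "L1-lipschitz_on C \<eta>"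
    using lipschitz_on_compact_convex[OF derivs(3)[OF U] *[OF cont(2)] compact_C convex_C] by blast
  obtain L2 where L2: "L2-lipschitz_on C q"
    using lipschitz_on_compact_convex[OF derivs(5)[OF U] *[OF cont(5)] compact_C convex_C] by blast
  obtain L3 where L3: "L3-lipschitz_on C f"
    using lipschitz_on_compact_convex[OF derivs(1)[OF U] *[OF cont(8)] compact_C convex_C] by blast
  obtain L4 where L4: "L4-lipschitz_on C (D1 \<eta>)"
    using lipschitz_on_compact_convex[OF derivs(4)[OF U] *[OF cont(3)] compact_C convex_C] by blast
  show ?thesis
    by (rule that[of "max (max L1 L2) (max L3 L4)"])
       (rule lipschitz_on_le[OF L1] lipschitz_on_le[OF L2] lipschitz_on_le[OF L3] lipschitz_on_le[OF L4]; simp)+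
qed

end

section \<open>Testing the entropy inequality and the weak formulation\<close>

lemma (in bounded_bilinear) lipschitz_on_prod:
  assumes f: "K-lipschitz_on X f" and g: "L-lipschitz_on X g"
    and bf: "\<And>x. x \<in> X \<Longrightarrow> norm (f x) \<le> A" and bg: "\<And>x. x \<in> X \<Longrightarrow> norm (g x) \<le> B"
  obtains M where "M-lipschitz_on X (\<lambda>x. prod (f x) (g x))"
proof -
  obtain P where P: "P > 0" "\<And>a b. norm (prod a b) \<le> norm a * norm b * P"
    using pos_bounded by blast
  have KL: "0 \<le> K" "0 \<le> L" using f g lipschitz_on_nonneg by blast+
  define M where "M = (K * \<bar>B\<bar> + \<bar>A\<bar> * L) * P"
  have "M-lipschitz_on X (\<lambda>x. prod (f x) (g x))"
  proof (rule lipschitz_onI)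
    fix x y assume x: "x \<in> X" and y: "y \<in> X"
    have fxy: "norm (f x - f y) \<le> K * dist x y" using lipschitz_onD[OF f x y] by (simp add: dist_norm)
    have gxy: "norm (g x - g y) \<le> L * dist x y" using lipschitz_onD[OF g x y] by (simp add: dist_norm)
    have "dist (prod (f x) (g x)) (prod (f y) (g y)) = norm (prod (f x - f y) (g x) + prod (f y) (g x - g y))"
      by (simp add: dist_norm diff_left diff_right)
    also have "\<dots> \<le> norm (prod (f x - f y) (g x)) + norm (prod (f y) (g x - g y))"
      by (rule norm_triangle_ineq)
    also have "\<dots> \<le> norm (f x - f y) * norm (g x) * P + norm (f y) * norm (g x - g y) * P"
      by (intro add_mono P)
    also have "\<dots> \<le> (K * dist x y) * \<bar>B\<bar> * P + \<bar>A\<bar> * (L * dist x y) * P"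
      using fxy gxy bf[OF y] bg[OF x] P(1) KL by (intro add_mono mult_right_mono mult_mono) auto
    also have "\<dots> = M * dist x y" by (simp add: M_def algebra_simps)
    finally show "dist (prod (f x) (g x)) (prod (f y) (g y)) \<le> M * dist x y" .
  qed (use KL P in \<open>simp add: M_def\<close>)
  then show ?thesis by (rule that)
qed

lemma has_vector_derivative_chain:
  assumes "(p has_vector_derivative d) (at t)" "(g has_derivative g') (at (p t))"
  shows "((\<lambda>s. g (p s)) has_vector_derivative g' d) (at t)"
proof -
  have "linear g'" using assms(2) by (rule has_derivative_linear)
  from has_derivative_compose[OF assms(1)[unfolded has_vector_derivative_def] assms(2)]
  show ?thesis unfolding has_vector_derivative_def by (simp add: linear_scale[OF \<open>linear g'\<close>])
qed

lemma test_functionI: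
  assumes "L-lipschitz_on UNIV \<phi>" "\<tau> < T"
    "\<And>t x. \<tau> \<le> t \<Longrightarrow> \<phi> (t, x) = 0" "\<And>t x. r \<le> \<bar>x\<bar> \<Longrightarrow> \<phi> (t, x) = 0"
  shows "test_function T \<phi>"
  unfolding test_function_def
proof (intro conjI exI)
  show "L-lipschitz_on ({0..<T} \<times> UNIV) \<phi>" using assms(1) lipschitz_on_subset by blast
  show "compact ({0..\<tau>} \<times> {- r..r})" by (intro compact_Times) auto
  show "{0..\<tau>} \<times> {- r..r} \<subseteq> {0..<T} \<times> UNIV" using assms(2) by auto
  show "\<forall>z\<in>{0..<T} \<times> UNIV - {0..\<tau>} \<times> {- r..r}. \<phi> z = 0"
  proof
    fix z :: "real \<times> real" assume "z \<in> {0..<T} \<times> UNIV - {0..\<tau>} \<times> {- r..r}"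
    then have "\<tau> \<le> fst z \<or> r \<le> \<bar>snd z\<bar>" by (cases z) auto
    then show "\<phi> z = 0" using assms(3,4) by (cases z) auto
  qed
qed

text \<open>The weak formulation pairs the vector \<open>u\<close> with scalar test functions. This
  expansion assembles \<open>D1 \<eta> (v z)\<close> applied to \<open>u\<close> from tests with its
  coordinates; it also reduces the measurability of a derivative applied to a measurable vector to
  its values on the axes.\<close>

lemma blinfun_axis_expansion:
  fixes A :: "(real^'m) \<Rightarrow>\<^sub>L 'b::real_normed_vector"
  shows "A x = (\<Sum>k\<in>UNIV. (x \<bullet> axis k 1) *\<^sub>R A (axis k 1))"
proof -
  have "A x = A (\<Sum>k\<in>UNIV. (x $ k) *\<^sub>R axis k 1)"
    using basis_expansion[of x] by (simp add: scalar_mult_eq_scaleR)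
  then show ?thesis by (simp add: blinfun.sum_right blinfun.scaleR_right inner_axis)
qed

lemma space_slab [simp]: "space (slab T) = {0<..<T} \<times> UNIV"
  by (simp add: slab_def space_restrict_space)

context relative_entropy
begin

text \<open>Besides the entropy inequality with test function \<open>\<phi>\<close>, the weak formulation is tested with the
  components of \<open>\<phi> D\<eta>(v)\<close>; the terms that do not involve \<open>u\<close> form a total derivative.\<close>

lemma relative_entropy_inequality:
  fixes v :: "real \<times> real \<Rightarrow> real^'m" and \<phi> :: "real \<times> real \<Rightarrow> real"
  assumes T: "0 < T" and sol: "entropy_solution T U f \<eta> q u0 u"
    and v: "Lv-lipschitz_on UNIV v" and vC: "\<And>z. v z \<in> C"
    and \<phi>: "L\<phi>-lipschitz_on UNIV \<phi>" and \<phi>0: "\<And>z. 0 \<le> \<phi> z" and \<phi>B: "\<And>z. \<phi> z \<le> B"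
    and \<tau>: "\<tau> < T" and s1: "\<And>t x. \<tau> \<le> t \<Longrightarrow> \<phi> (t, x) = 0" and s2: "\<And>t x. r \<le> \<bar>x\<bar> \<Longrightarrow> \<phi> (t, x) = 0"
  obtains E where "integrable (slab T) E"
    "AE (t, x) in slab T. \<forall>\<phi>t \<phi>x vt vx.
       ((\<lambda>s. \<phi> (s, x)) has_real_derivative \<phi>t) (at t) \<longrightarrow> ((\<lambda>z. \<phi> (t, z)) has_real_derivative \<phi>x) (at x) \<longrightarrow>
       ((\<lambda>s. v (s, x)) has_vector_derivative vt) (at t) \<longrightarrow> ((\<lambda>z. v (t, z)) has_vector_derivative vx) (at x) \<longrightarrow>
       E (t, x) = rel_eta (u t x) (v (t, x)) * \<phi>t + rel_q (u t x) (v (t, x)) * \<phi>x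
         - \<phi> (t, x) * (D2 \<eta> (v (t, x)) vt (u t x - v (t, x)) + D2 \<eta> (v (t, x)) vx (f (u t x) - f (v (t, x))))"
    "integrable lborel (\<lambda>x. rel_eta (u0 x) (v (0, x)) * \<phi> (0, x))"
    "0 \<le> integral\<^sup>L (slab T) E + (LINT x|lborel. rel_eta (u0 x) (v (0, x)) * \<phi> (0, x))"
proof -
  obtain L where L: "L-lipschitz_on C \<eta>" "L-lipschitz_on C q" "L-lipschitz_on C f" "L-lipschitz_on C (D1 \<eta>)"
    by (rule lipschitz_on_C)
  have comp: "(L' * Lv)-lipschitz_on UNIV (\<lambda>z. g (v z))" if "L'-lipschitz_on C g"
    for g :: "real^'m \<Rightarrow> 'z::metric_space" and L'
    by (rule lipschitz_on_compose2[OF v lipschitz_on_subset[OF that]]) (use vC in blast)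
  have bdd: "\<exists>B. \<forall>z. norm (g (v z)) \<le> B" if "L'-lipschitz_on C g"
    for g :: "real^'m \<Rightarrow> 'z::real_normed_vector" and L'
  proof -
    have "bounded (g ` C)"
      using compact_C lipschitz_on_continuous_on[OF that] compact_continuous_image compact_imp_bounded by blast
    then show ?thesis using vC unfolding bounded_iff by blast
  qed
  have prodL: "\<exists>M. M-lipschitz_on UNIV (\<lambda>z. \<phi> z * g z)" if "M1-lipschitz_on UNIV g" "\<And>z. norm (g z) \<le> M2"
    for g M1 M2
  proof -
    have "norm (\<phi> z) \<le> B" for z using \<phi>0[of z] \<phi>B[of z] by simp
    then show ?thesis
      using bounded_bilinear.lipschitz_on_prod[OF bounded_bilinear_mult \<phi> that(1), of B M2] that(2) by blast
  qed
  obtain B1 where B1: "\<And>z. norm (D1 \<eta> (v z)) \<le> B1" using bdd[OF L(4)] by blast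
  obtain B2 where B2: "\<And>z. norm (f (v z)) \<le> B2" using bdd[OF L(3)] by blast
  obtain B3 where B3: "\<And>z. norm (\<eta> (v z)) \<le> B3" using bdd[OF L(1)] by blast
  obtain B4 where B4: "\<And>z. norm (q (v z)) \<le> B4" using bdd[OF L(2)] by blast
  have "1-lipschitz_on C (\<lambda>w::real^'m. w)" by (simp add: lipschitz_on_def)
  then obtain B5 where B5: "\<And>z. norm (v z) \<le> B5" using bdd by blast
  have D1b: "norm (D1 \<eta> (v z) a) \<le> B1 * norm a" for z a
    using norm_blinfun[of "D1 \<eta> (v z)" a] B1[of z] by (meson mult_right_mono norm_ge_zero order_trans)
  \<comment> \<open>\<open>G\<close> and \<open>Q\<close> are what is subtracted from the relative
    entropy and its flux besides the terms linear in \<open>u\<close> and \<open>f(u)\<close>.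
    First-order terms cancel in their derivatives: \<open>G\<close> has time derivative
    -D^2\<eta>(v)(v_t, v), and \<open>Q\<close> has space derivative -D^2\<eta>(v)(v_x,
    f(v)).\<close>
  define G where "G = (\<lambda>z. \<eta> (v z) - D1 \<eta> (v z) (v z))"
  define Q where "Q = (\<lambda>z. q (v z) - D1 \<eta> (v z) (f (v z)))"
  define \<psi> where "\<psi> = (\<lambda>k z. \<phi> z * D1 \<eta> (v z) (axis k 1))"
  have lipD1: "\<exists>M. M-lipschitz_on UNIV (\<lambda>z. D1 \<eta> (v z) (b z))"
    if "M1-lipschitz_on UNIV b" "\<And>z. norm (b z) \<le> M2" for b :: "real \<times> real \<Rightarrow> real^'m" and M1 M2
    using bounded_bilinear.lipschitz_on_prod[OF bounded_bilinear_blinfun_apply comp[OF L(4)] that(1), of B1 M2]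
      B1 that(2) by blast
  have lipG: "\<exists>M. M-lipschitz_on UNIV G"
  proof -
    obtain M where "M-lipschitz_on UNIV (\<lambda>z. D1 \<eta> (v z) (v z))" using lipD1[OF v B5] by blast
    then show ?thesis unfolding G_def using lipschitz_on_diff[OF comp[OF L(1)]] by blast
  qed
  have lipQ: "\<exists>M. M-lipschitz_on UNIV Q"
  proof -
    obtain M where "M-lipschitz_on UNIV (\<lambda>z. D1 \<eta> (v z) (f (v z)))" using lipD1[OF comp[OF L(3)] B2] by blast
    then show ?thesis unfolding Q_def using lipschitz_on_diff[OF comp[OF L(2)]] by blast
  qed
  have bG: "norm (G z) \<le> B3 + B1 * B5" for z
  proof -
    have "norm (D1 \<eta> (v z) (v z)) \<le> B1 * B5"
      using D1b[of z "v z"] B5[of z] B1[of z] by (meson mult_left_mono norm_ge_zero order_trans)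
    then show ?thesis unfolding G_def using B3[of z] norm_triangle_ineq4[of "\<eta> (v z)" "D1 \<eta> (v z) (v z)"] by linarith
  qed
  have bQ: "norm (Q z) \<le> B4 + B1 * B2" for z
  proof -
    have "norm (D1 \<eta> (v z) (f (v z))) \<le> B1 * B2"
      using D1b[of z "f (v z)"] B2[of z] B1[of z] by (meson mult_left_mono norm_ge_zero order_trans)
    then show ?thesis unfolding Q_def using B4[of z] norm_triangle_ineq4[of "q (v z)" "D1 \<eta> (v z) (f (v z))"] by linarith
  qed
  obtain LG where LG: "LG-lipschitz_on UNIV (\<lambda>z. \<phi> z * G z)" using lipG prodL bG by blast
  obtain LQ where LQ: "LQ-lipschitz_on UNIV (\<lambda>z. \<phi> z * Q z)" using lipQ prodL bQ by blast
  have test\<phi>: "test_function T \<phi>" by (rule test_functionI[OF \<phi> \<tau> s1 s2])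
  have test\<psi>: "test_function T (\<psi> k)" for k
  proof -
    obtain M where "M-lipschitz_on UNIV (\<lambda>z. D1 \<eta> (v z) (axis k 1))"
      using lipD1[of 0 "\<lambda>_. axis k 1" "norm (axis k (1::real) :: real^'m)"] by (auto simp: lipschitz_on_def)
    then obtain M' where "M'-lipschitz_on UNIV (\<psi> k)"
      unfolding \<psi>_def using prodL D1b by blast
    then show ?thesis by (rule test_functionI[OF _ \<tau>, where r = r]) (auto simp: \<psi>_def s1 s2)
  qed
  define g1 where "g1 = (\<lambda>(t, x). \<eta> (u t x) * dt_test \<phi> (t, x) + q (u t x) * dx_test \<phi> (t, x))"
  define g2 where "g2 = (\<lambda>k (t, x). dt_test (\<psi> k) (t, x) *\<^sub>R u t x + dx_test (\<psi> k) (t, x) *\<^sub>R f (u t x))"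
  have ent: "integrable (slab T) g1" "integrable lborel (\<lambda>x. \<eta> (u0 x) * \<phi> (0, x))"
    "0 \<le> integral\<^sup>L (slab T) g1 + (LINT x|lborel. \<eta> (u0 x) * \<phi> (0, x))"
    using sol test\<phi> \<phi>0 unfolding entropy_solution_def g1_def Let_def by auto
  have weak: "integrable (slab T) (g2 k)" "integrable lborel (\<lambda>x. \<psi> k (0, x) *\<^sub>R u0 x)"
    "integral\<^sup>L (slab T) (g2 k) + (LINT x|lborel. \<psi> k (0, x) *\<^sub>R u0 x) = 0" for k
    using sol test\<psi>[of k] unfolding entropy_solution_def weak_solution_def g2_def Let_def by auto
  have weak': "integrable (slab T) (\<lambda>z. g2 k z \<bullet> axis k 1)" "integrable lborel (\<lambda>x. (\<psi> k (0, x) *\<^sub>R u0 x) \<bullet> axis k 1)"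
    "integral\<^sup>L (slab T) (\<lambda>z. g2 k z \<bullet> axis k 1) + (LINT x|lborel. (\<psi> k (0, x) *\<^sub>R u0 x) \<bullet> axis k 1) = 0" for k
  proof -
    show i: "integrable (slab T) (\<lambda>z. g2 k z \<bullet> axis k 1)"
      "integrable lborel (\<lambda>x. (\<psi> k (0, x) *\<^sub>R u0 x) \<bullet> axis k 1)"
      by (rule integrable_inner_left, rule weak)+
    show "integral\<^sup>L (slab T) (\<lambda>z. g2 k z \<bullet> axis k 1) + (LINT x|lborel. (\<psi> k (0, x) *\<^sub>R u0 x) \<bullet> axis k 1) = 0"
      by (subst integral_inner_left, rule weak, subst integral_inner_left, rule weak)
         (simp only: inner_add_left[symmetric] weak inner_zero_left)
  qed
  have s1': "\<phi> (t, x) * G (t, x) = 0" "\<phi> (t, x) * Q (t, x) = 0" if "T \<le> t" for t x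
    using s1[of t x] that \<tau> by simp_all
  have s2': "\<phi> (t, x) * G (t, x) = 0" "\<phi> (t, x) * Q (t, x) = 0" if "r \<le> \<bar>x\<bar>" for t x
    using s2[of x t] that by simp_all
  obtain Dt Dx' where Dt: "AE (t, x) in slab T. ((\<lambda>s. \<phi> (s, x) * G (s, x)) has_real_derivative Dt (t, x)) (at t)"
    "AE (t, x) in slab T. ((\<lambda>z. \<phi> (t, z) * G (t, z)) has_real_derivative Dx' (t, x)) (at x)"
    "integrable (slab T) Dt" "integral\<^sup>L (slab T) Dt = - (LINT x|lborel. \<phi> (0, x) * G (0, x))"
    "integrable (slab T) Dx'" "integral\<^sup>L (slab T) Dx' = 0"
    by (rule integral_partial_derivatives[OF LG T, of r]) (erule s1'(1), erule s2'(1), rule that)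
  obtain Dt' Dx where Dx: "AE (t, x) in slab T. ((\<lambda>s. \<phi> (s, x) * Q (s, x)) has_real_derivative Dt' (t, x)) (at t)"
    "AE (t, x) in slab T. ((\<lambda>z. \<phi> (t, z) * Q (t, z)) has_real_derivative Dx (t, x)) (at x)"
    "integrable (slab T) Dt'" "integral\<^sup>L (slab T) Dt' = - (LINT x|lborel. \<phi> (0, x) * Q (0, x))"
    "integrable (slab T) Dx" "integral\<^sup>L (slab T) Dx = 0"
    by (rule integral_partial_derivatives[OF LQ T, of r]) (erule s1'(2), erule s2'(2), rule that)
  have intG: "integrable lborel (\<lambda>x. \<phi> (0, x) * G (0, x))"
  proof (rule bounded_compact_support_integrable)
    show "(\<lambda>x. \<phi> (0, x) * G (0, x)) \<in> borel_measurable borel"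
      by (rule borel_measurable_continuous_onI[OF lipschitz_on_continuous_on[OF lipschitz_slice(2)[OF LG]]])
    show "norm (\<phi> (0, x) * G (0, x)) \<le> \<bar>B\<bar> * (B3 + B1 * B5)" for x
      unfolding norm_mult using \<phi>0[of "(0, x)"] \<phi>B[of "(0, x)"] bG[of "(0, x)"] by (intro mult_mono) auto
    show "\<phi> (0, x) * G (0, x) = 0" if "r < norm x" for x using that s2 by simp
  qed
  define E where "E = (\<lambda>z. g1 z - (\<Sum>k\<in>UNIV. g2 k z \<bullet> axis k 1) - Dt z - Dx z)"
  have intE: "integrable (slab T) E"
    unfolding E_def using ent weak' Dt(3) Dx(5) by (intro Bochner_Integration.integrable_diff Bochner_Integration.integrable_sum) auto
  have valE: "integral\<^sup>L (slab T) E = integral\<^sup>L (slab T) g1 - (\<Sum>k\<in>UNIV. integral\<^sup>L (slab T) (\<lambda>z. g2 k z \<bullet> axis k 1))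
      - integral\<^sup>L (slab T) Dt - integral\<^sup>L (slab T) Dx"
    unfolding E_def using ent weak' Dt(3) Dx(5) by (simp add: Bochner_Integration.integral_sum)
  have init: "rel_eta (u0 x) (v (0, x)) * \<phi> (0, x) = \<eta> (u0 x) * \<phi> (0, x)
      - (\<Sum>k\<in>UNIV. (\<psi> k (0, x) *\<^sub>R u0 x) \<bullet> axis k 1) - \<phi> (0, x) * G (0, x)" for x
  proof -
    have "(\<Sum>k\<in>UNIV. (\<psi> k (0, x) *\<^sub>R u0 x) \<bullet> axis k 1) = \<phi> (0, x) * D1 \<eta> (v (0, x)) (u0 x)"
      unfolding blinfun_axis_expansion[of "D1 \<eta> (v (0, x))" "u0 x"]
      by (simp add: \<psi>_def inner_axis sum_distrib_left mult_ac)
    then show ?thesis by (simp add: rel_eta_def G_def blinfun.diff_right algebra_simps)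
  qed
  show ?thesis
  proof (rule that[OF intE])
    show "integrable lborel (\<lambda>x. rel_eta (u0 x) (v (0, x)) * \<phi> (0, x))"
      unfolding init using ent weak' intG
      by (intro Bochner_Integration.integrable_diff Bochner_Integration.integrable_sum) auto
    have "(LINT x|lborel. rel_eta (u0 x) (v (0, x)) * \<phi> (0, x)) = (LINT x|lborel. \<eta> (u0 x) * \<phi> (0, x))
      - (\<Sum>k\<in>UNIV. LINT x|lborel. (\<psi> k (0, x) *\<^sub>R u0 x) \<bullet> axis k 1) - (LINT x|lborel. \<phi> (0, x) * G (0, x))"
      unfolding init using ent weak' intG by (simp add: Bochner_Integration.integral_sum)
    moreover have "(\<Sum>k\<in>UNIV. integral\<^sup>L (slab T) (\<lambda>z. g2 k z \<bullet> axis k 1))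
        + (\<Sum>k\<in>UNIV. LINT x|lborel. (\<psi> k (0, x) *\<^sub>R u0 x) \<bullet> axis k 1) = 0"
      unfolding sum.distrib[symmetric] weak'(3) by simp
    ultimately show "0 \<le> integral\<^sup>L (slab T) E + (LINT x|lborel. rel_eta (u0 x) (v (0, x)) * \<phi> (0, x))"
      using ent(3) Dt(4) Dx(6) valE by linarith
    \<comment> \<open>With the derivatives quantified inside the almost-everywhere statement the
      caller supplies its own; uniqueness of derivatives identifies them with those in
      \<open>dt_test\<close>, \<open>dx_test\<close>, \<open>Dt\<close> and
      \<open>Dx\<close>.\<close>
    show "AE (t, x) in slab T. \<forall>\<phi>t \<phi>x vt vx.
       ((\<lambda>s. \<phi> (s, x)) has_real_derivative \<phi>t) (at t) \<longrightarrow> ((\<lambda>z. \<phi> (t, z)) has_real_derivative \<phi>x) (at x) \<longrightarrow>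
       ((\<lambda>s. v (s, x)) has_vector_derivative vt) (at t) \<longrightarrow> ((\<lambda>z. v (t, z)) has_vector_derivative vx) (at x) \<longrightarrow>
       E (t, x) = rel_eta (u t x) (v (t, x)) * \<phi>t + rel_q (u t x) (v (t, x)) * \<phi>x
         - \<phi> (t, x) * (D2 \<eta> (v (t, x)) vt (u t x - v (t, x)) + D2 \<eta> (v (t, x)) vx (f (u t x) - f (v (t, x))))"
      using Dt(1) Dx(2)
    proof (eventually_elim, clarsimp)
      fix t x \<phi>t \<phi>x vt vx
      assume Dt: "((\<lambda>s. \<phi> (s, x) * G (s, x)) has_real_derivative Dt (t, x)) (at t)"
        and Dx: "((\<lambda>z. \<phi> (t, z) * Q (t, z)) has_real_derivative Dx (t, x)) (at x)"
        and \<phi>t: "((\<lambda>s. \<phi> (s, x)) has_real_derivative \<phi>t) (at t)"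
        and \<phi>x: "((\<lambda>z. \<phi> (t, z)) has_real_derivative \<phi>x) (at x)"
        and vt: "((\<lambda>s. v (s, x)) has_vector_derivative vt) (at t)"
        and vx: "((\<lambda>z. v (t, z)) has_vector_derivative vx) (at x)"
      define w where "w = v (t, x)"
      have w: "w \<in> U" using vC C_sub_U by (auto simp: w_def)
      note dw = derivs[OF w, unfolded w_def]
      have D1: "((\<lambda>s. D1 \<eta> (v (s, x)) a) has_real_derivative D2 \<eta> w vt a) (at t)"
        "((\<lambda>z. D1 \<eta> (v (t, z)) a) has_real_derivative D2 \<eta> w vx a) (at x)" for a
        unfolding has_real_derivative_iff_has_vector_derivative w_def
        using bounded_linear.has_vector_derivative[OF blinfun.bounded_linear_left has_vector_derivative_chain[OF vt dw(4)]]
          bounded_linear.has_vector_derivative[OF blinfun.bounded_linear_left has_vector_derivative_chain[OF vx dw(4)]]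
        by auto
      have \<psi>': "dt_test (\<psi> k) (t, x) = \<phi>t * D1 \<eta> w (axis k 1) + \<phi> (t, x) * D2 \<eta> w vt (axis k 1)"
        "dx_test (\<psi> k) (t, x) = \<phi>x * D1 \<eta> w (axis k 1) + \<phi> (t, x) * D2 \<eta> w vx (axis k 1)" for k
        unfolding dt_test_def dx_test_def \<psi>_def w_def prod.case
        by (rule DERIV_imp_deriv, rule DERIV_cong[OF DERIV_mult[OF \<phi>t D1(1)]], simp add: w_def mult.commute)
           (rule DERIV_imp_deriv, rule DERIV_cong[OF DERIV_mult[OF \<phi>x D1(2)]], simp add: w_def mult.commute)
      have \<phi>': "dt_test \<phi> (t, x) = \<phi>t" "dx_test \<phi> (t, x) = \<phi>x"
        using \<phi>t \<phi>x by (auto simp: dt_test_def dx_test_def DERIV_imp_deriv)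
      have Gt: "((\<lambda>s. G (s, x)) has_real_derivative - D2 \<eta> w vt w) (at t)"
      proof -
        have "((\<lambda>s. D1 \<eta> (v (s, x)) (v (s, x))) has_vector_derivative
            D1 \<eta> w vt + D2 \<eta> w vt w) (at t)"
          using bounded_bilinear.has_vector_derivative[OF bounded_bilinear_blinfun_apply
              has_vector_derivative_chain[OF vt dw(4)] vt] by (simp add: w_def)
        from has_vector_derivative_diff[OF has_vector_derivative_chain[OF vt dw(3)] this] show ?thesis
          unfolding has_real_derivative_iff_has_vector_derivative G_def by (simp add: w_def)
      qed
      have Qx: "((\<lambda>z. Q (t, z)) has_real_derivative - D2 \<eta> w vx (f w)) (at x)"
      proof -
        have "((\<lambda>z. D1 \<eta> (v (t, z)) (f (v (t, z)))) has_vector_derivative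
            D1 \<eta> w (D1 f w vx) + D2 \<eta> w vx (f w)) (at x)"
          using bounded_bilinear.has_vector_derivative[OF bounded_bilinear_blinfun_apply
              has_vector_derivative_chain[OF vx dw(4)] has_vector_derivative_chain[OF vx dw(1)]] by (simp add: w_def)
        from has_vector_derivative_diff[OF has_vector_derivative_chain[OF vx dw(5)] this] show ?thesis
          unfolding has_real_derivative_iff_has_vector_derivative Q_def using flux[OF w] by (simp add: w_def)
      qed
      have Dt': "Dt (t, x) = \<phi>t * G (t, x) - \<phi> (t, x) * D2 \<eta> w vt w"
        by (rule DERIV_unique[OF Dt], rule DERIV_cong[OF DERIV_mult[OF \<phi>t Gt]]) simp
      have Dx': "Dx (t, x) = \<phi>x * Q (t, x) - \<phi> (t, x) * D2 \<eta> w vx (f w)"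
        by (rule DERIV_unique[OF Dx], rule DERIV_cong[OF DERIV_mult[OF \<phi>x Qx]]) simp
      have sum: "(\<Sum>k\<in>UNIV. g2 k (t, x) \<bullet> axis k 1) =
          \<phi>t * D1 \<eta> w (u t x) + \<phi> (t, x) * D2 \<eta> w vt (u t x)
          + \<phi>x * D1 \<eta> w (f (u t x)) + \<phi> (t, x) * D2 \<eta> w vx (f (u t x))"
        unfolding blinfun_axis_expansion[of "D1 \<eta> w" "u t x"] blinfun_axis_expansion[of "D1 \<eta> w" "f (u t x)"]
          blinfun_axis_expansion[of "D2 \<eta> w vt" "u t x"] blinfun_axis_expansion[of "D2 \<eta> w vx" "f (u t x)"]
        by (simp add: g2_def \<psi>' inner_axis sum_distrib_left sum.distrib[symmetric] algebra_simps)
      show "E (t, x) = rel_eta (u t x) (v (t, x)) * \<phi>t + rel_q (u t x) (v (t, x)) * \<phi>x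
         - \<phi> (t, x) * (D2 \<eta> (v (t, x)) vt (u t x - v (t, x)) + D2 \<eta> (v (t, x)) vx (f (u t x) - f (v (t, x))))"
        unfolding E_def sum Dt' Dx' G_def Q_def
        by (simp add: g1_def \<phi>' rel_eta_def rel_q_def w_def[symmetric] blinfun.diff_right algebra_simps)
    qed
  qed
qed

end

section \<open>Space-time weights\<close>

text \<open>Unlike the positive part, its square is differentiable at 0. This is why the cone weight
  enters squared: no exceptional set arises at the edge of the cone.\<close>

lemma max_square_has_real_derivative:
  "((\<lambda>z::real. (max 0 z)\<^sup>2) has_real_derivative 2 * max 0 z) (at z)"
proof -
  consider "z < 0" | "z = 0" | "z > 0" by linarith
  then show ?thesis
  proof cases
    case 1
    have "((\<lambda>_. 0) has_real_derivative 2 * max 0 z) (at z)" using 1 by simp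
    then show ?thesis
      by (rule has_field_derivative_transform_within_open[where S = "{..<0}"]) (use 1 in auto)
  next
    case 2
    have "((\<lambda>z::real. (max 0 z)\<^sup>2) has_real_derivative 0) (at 0)"
      unfolding has_field_derivative_def has_derivative_at_alt
    proof (intro conjI allI impI)
      fix e :: real assume "e > 0"
      moreover have "norm ((max 0 y)\<^sup>2 - (max 0 0)\<^sup>2 - 0 * (y - 0)) \<le> e * norm (y - 0)"
        if "norm (y - 0) < e" for y :: real
      proof (cases "y \<ge> 0")
        case True
        then have "y * y \<le> e * y" using that by (intro mult_right_mono) auto
        then show ?thesis using True by (simp add: power2_eq_square max_def)
      qed (use \<open>e > 0\<close> in \<open>auto simp: max_def mult_le_0_iff\<close>)
      ultimately show "\<exists>d>0. \<forall>y. norm (y - 0) < d \<longrightarrow>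
          norm ((max 0 y)\<^sup>2 - (max 0 0)\<^sup>2 - 0 * (y - 0)) \<le> e * norm (y - (0::real))" by blast
    qed (simp add: bounded_linear_mult_right)
    then show ?thesis using 2 by simp
  next
    case 3
    have "((\<lambda>z. z\<^sup>2) has_real_derivative 2 * max 0 z) (at z)" using 3
      by (auto intro!: derivative_eq_intros)
    then show ?thesis
      by (rule has_field_derivative_transform_within_open[where S = "{0<..}"]) (use 3 in auto)
  qed
qed

text \<open>Reverse triangle inequality for the vectors (1, x) and (1, y).\<close>

lemma sqrt_one_add_sq_lipschitz: "\<bar>sqrt (1 + x\<^sup>2) - sqrt (1 + y\<^sup>2)\<bar> \<le> \<bar>x - y\<bar>"
proof -
  have "\<bar>norm (1::real, x) - norm (1::real, y)\<bar> \<le> norm ((1::real, x) - (1, y))"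
    by (rule norm_triangle_ineq3)
  then show ?thesis by (simp add: norm_Pair)
qed

text \<open>Supplies the exponent of the integrating factor. The rate may be discontinuous in time,
  but its primitive is Lipschitz and so may enter a test function; for negative times the interval
  is empty and the primitive is 0.\<close>

lemma integral_bounded_lipschitz:
  fixes a :: "real \<Rightarrow> real"
  assumes [measurable]: "a \<in> borel_measurable borel" and a: "\<And>t. 0 \<le> a t" "\<And>t. a t \<le> B"
  shows "B-lipschitz_on UNIV (\<lambda>t. integral {0..t} a)"
    and "s \<le> t \<Longrightarrow> integral {0..s} a \<le> integral {0..t} a"
    and "0 \<le> integral {0..t} a"
    and "AE t in lborel. 0 < t \<longrightarrow> ((\<lambda>t. integral {0..t} a) has_real_derivative a t) (at t)"
    and "0 \<le> t \<Longrightarrow> ennreal (integral {0..t} a) = (\<integral>\<^sup>+x. ennreal (a x) * indicator {0<..<t} x \<partial>lborel)"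
proof -
  have B: "0 \<le> B" using a[of 0] by simp
  have si: "set_integrable lborel {s..t} a" for s t
    unfolding set_integrable_def
    by (rule bounded_compact_support_integrable[of _ B "max \<bar>s\<bar> \<bar>t\<bar>"]) (use a B in \<open>auto simp: indicator_def\<close>)
  then have int: "a integrable_on {s..t}" for s t using set_borel_integral_eq_integral(1) by blast
  have split: "integral {0..t} a - integral {0..s} a = integral {s..t} a" if "0 \<le> s" "s \<le> t" for s t
    using Henstock_Kurzweil_Integration.integral_combine[OF that int] by simp
  have nonneg: "0 \<le> integral {s..t} a" for s t
    by (rule Henstock_Kurzweil_Integration.integral_nonneg[OF int]) (use a in auto)
  have le: "integral {s..t} a \<le> B * (t - s)" if "s \<le> t" for s t
    using integral_le[OF int[of s t], of "\<lambda>_. B"] a that integrable_const_ivl[of B s t] by (simp add: mult.commute)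
  have mono: "0 \<le> integral {0..t} a - integral {0..s} a \<and> integral {0..t} a - integral {0..s} a \<le> B * (t - s)"
    if "s \<le> t" for s t
  proof (cases "0 \<le> s")
    case True
    then show ?thesis using split[OF True that] nonneg[of s t] le[OF that] by simp
  next
    case False
    then have [simp]: "integral {0..s} a = 0" by simp
    show ?thesis
    proof (cases "0 \<le> t")
      case True
      have "B * t \<le> B * (t - s)" using B False by (intro mult_left_mono) auto
      then show ?thesis using nonneg[of 0 t] le[OF True] by simp
    qed (use that B in simp)
  qed
  show "B-lipschitz_on UNIV (\<lambda>t. integral {0..t} a)"
  proof (rule lipschitz_onI)
    fix x y show "dist (integral {0..x} a) (integral {0..y} a) \<le> B * dist x y"
      using mono[of x y] mono[of y x] by (cases "x \<le> y") (auto simp: dist_real_def)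
  qed (rule B)
  show "s \<le> t \<Longrightarrow> integral {0..s} a \<le> integral {0..t} a" using mono[of s t] by simp
  show "0 \<le> integral {0..t} a" by (rule nonneg)
  have "AE t in lborel. \<forall>n::nat. 0 < t \<longrightarrow> t < real n \<longrightarrow> ((\<lambda>t. integral {0..t} a) has_real_derivative a t) (at t)"
    unfolding AE_all_countable AE_lborel_iff_negligible
  proof
    fix n
    show "negligible {t. \<not> (0 < t \<longrightarrow> t < real n \<longrightarrow> ((\<lambda>t. integral {0..t} a) has_real_derivative a t) (at t))}"
      using negligible_not_derivative_integral[OF int[of 0 "real n"]]
      by (rule negligible_subset) (auto simp: has_real_derivative_iff_has_vector_derivative)
  qed
  then show "AE t in lborel. 0 < t \<longrightarrow> ((\<lambda>t. integral {0..t} a) has_real_derivative a t) (at t)"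
    by eventually_elim (use reals_Archimedean2 in blast)
  assume t: "0 \<le> t"
  have "(\<integral>\<^sup>+x. ennreal (a x) * indicator {0<..<t} x \<partial>lborel) = (\<integral>\<^sup>+x. ennreal (indicator {0..t} x * a x) \<partial>lborel)"
  proof (rule nn_integral_cong_AE)
    have "AE x in lborel. x \<noteq> 0 \<and> x \<noteq> t"
      using AE_lborel_singleton[of 0] AE_lborel_singleton[of t] by eventually_elim auto
    then show "AE x in lborel. ennreal (a x) * indicator {0<..<t} x = ennreal (indicator {0..t} x * a x)"
      by eventually_elim (auto simp: indicator_def)
  qed
  also have "\<dots> = ennreal (LINT x:{0..t}|lborel. a x)"
    unfolding set_lebesgue_integral_def using si[of 0 t] a
    by (subst nn_integral_eq_integral) (auto simp: set_integrable_def)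
  also have "\<dots> = ennreal (integral {0..t} a)"
    using set_borel_integral_eq_integral(2)[OF si[of 0 t]] by simp
  finally show "ennreal (integral {0..t} a) = (\<integral>\<^sup>+x. ennreal (a x) * indicator {0<..<t} x \<partial>lborel)" by simp
qed

text \<open>\<open>sqrt (1 + x\<^sup>2)\<close> is a smooth substitute for |x| with slope below 1,
  and the support shrinks at speed \<open>\<sigma>\<close>, so the decay of the weight in time
  outweighs its variation in space against \<open>rel_q\<close>. As \<open>N\<close> grows the
  weight tends to 1. Constant continuation to negative times keeps it at most 1 on the whole
  plane.\<close>

definition cone_weight :: "real \<Rightarrow> real \<Rightarrow> real \<times> real \<Rightarrow> real" where
  "cone_weight N \<sigma> = (\<lambda>(t, x). max 0 (1 - (sqrt (1 + x\<^sup>2) + \<sigma> * max 0 t) / N))"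

lemma cone_weight_bounds:
  assumes "0 < N" "0 \<le> \<sigma>"
  shows "0 \<le> cone_weight N \<sigma> z" "cone_weight N \<sigma> z \<le> 1"
  using assms by (auto simp: cone_weight_def split_beta intro!: divide_nonneg_nonneg add_nonneg_nonneg mult_nonneg_nonneg)

lemma cone_weight_eq_0:
  assumes "0 < N" "0 \<le> \<sigma>" "N \<le> \<bar>x\<bar>"
  shows "cone_weight N \<sigma> (t, x) = 0"
proof -
  have "\<bar>x\<bar> \<le> sqrt (1 + x\<^sup>2)" by (rule real_le_rsqrt) simp
  then have "N \<le> sqrt (1 + x\<^sup>2) + \<sigma> * max 0 t" using assms by (smt (verit) mult_nonneg_nonneg)
  then show ?thesis using assms by (simp add: cone_weight_def)
qed

lemma cone_weight_lipschitz:
  assumes "0 < N" "0 \<le> \<sigma>"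
  shows "((1 + \<sigma>) / N)-lipschitz_on UNIV (cone_weight N \<sigma>)"
proof (rule lipschitz_onI)
  fix z w :: "real \<times> real"
  define p where "p = (\<lambda>z::real \<times> real. sqrt (1 + (snd z)\<^sup>2) + \<sigma> * max 0 (fst z))"
  have d: "\<bar>fst z - fst w\<bar> \<le> dist z w" "\<bar>snd z - snd w\<bar> \<le> dist z w"
    using dist_fst_le[of z w] dist_snd_le[of z w] by (auto simp: dist_real_def)
  have "\<bar>max 0 (fst z) - max 0 (fst w)\<bar> \<le> dist z w" using d(1) by linarith
  then have "\<bar>\<sigma> * max 0 (fst z) - \<sigma> * max 0 (fst w)\<bar> \<le> \<sigma> * dist z w"
    using assms unfolding right_diff_distrib[symmetric] abs_mult by (intro mult_mono) auto
  then have "\<bar>p z - p w\<bar> \<le> (1 + \<sigma>) * dist z w"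
    using sqrt_one_add_sq_lipschitz[of "snd z" "snd w"] d(2) unfolding p_def distrib_right by linarith
  then have "\<bar>p z / N - p w / N\<bar> \<le> (1 + \<sigma>) / N * dist z w"
    using assms by (simp add: diff_divide_distrib[symmetric] divide_right_mono)
  moreover have "\<bar>cone_weight N \<sigma> z - cone_weight N \<sigma> w\<bar> \<le> \<bar>p z / N - p w / N\<bar>"
    unfolding cone_weight_def p_def split_beta by linarith
  ultimately show "dist (cone_weight N \<sigma> z) (cone_weight N \<sigma> w) \<le> (1 + \<sigma>) / N * dist z w"
    by (simp add: dist_real_def)
qed (use assms in simp)

lemma cone_weight_derivatives:
  assumes "0 < N"
  shows "0 < t \<Longrightarrow> ((\<lambda>s. (cone_weight N \<sigma> (s, x))\<^sup>2) has_real_derivative - (2 * cone_weight N \<sigma> (t, x) * \<sigma> / N)) (at t)"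
    and "((\<lambda>z. (cone_weight N \<sigma> (t, z))\<^sup>2) has_real_derivative
      - (2 * cone_weight N \<sigma> (t, x) * (x / sqrt (1 + x\<^sup>2)) / N)) (at x)"
proof -
  assume t: "0 < t"
  have "((\<lambda>s. 1 - (sqrt (1 + x\<^sup>2) + \<sigma> * s) / N) has_real_derivative - \<sigma> / N) (at t)"
    using assms by (auto intro!: derivative_eq_intros simp: field_simps)
  from DERIV_chain2[OF max_square_has_real_derivative this]
  have "((\<lambda>s. (max 0 (1 - (sqrt (1 + x\<^sup>2) + \<sigma> * s) / N))\<^sup>2) has_real_derivative
      - (2 * cone_weight N \<sigma> (t, x) * \<sigma> / N)) (at t)"
    using t by (simp add: cone_weight_def)
  then show "((\<lambda>s. (cone_weight N \<sigma> (s, x))\<^sup>2) has_real_derivative - (2 * cone_weight N \<sigma> (t, x) * \<sigma> / N)) (at t)"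
    by (rule has_field_derivative_transform_within_open[where S = "{0<..}"]) (use t in \<open>auto simp: cone_weight_def\<close>)
next
  have "0 < 1 + x\<^sup>2" by (simp add: add_pos_nonneg)
  then have "((\<lambda>z. 1 - (sqrt (1 + z\<^sup>2) + \<sigma> * max 0 t) / N) has_real_derivative - (x / sqrt (1 + x\<^sup>2)) / N) (at x)"
    using assms by (auto intro!: derivative_eq_intros simp: field_simps)
  from DERIV_chain2[OF max_square_has_real_derivative this]
  show "((\<lambda>z. (cone_weight N \<sigma> (t, z))\<^sup>2) has_real_derivative
      - (2 * cone_weight N \<sigma> (t, x) * (x / sqrt (1 + x\<^sup>2)) / N)) (at x)"
    by (simp add: cone_weight_def)
qed

text \<open>Its derivative is -1/\<epsilon> on the window of length \<epsilon> that ends at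
  \<open>c\<close>, so testing with it produces the average over this window.\<close>

definition ramp :: "real \<Rightarrow> real \<Rightarrow> real \<Rightarrow> real" where
  "ramp c \<epsilon> t = max 0 (min 1 ((c - t) / \<epsilon>))"

lemma ramp_lipschitz: "0 < \<epsilon> \<Longrightarrow> (1 / \<epsilon>)-lipschitz_on UNIV (ramp c \<epsilon>)"
proof (rule lipschitz_onI)
  fix x y assume e: "0 < \<epsilon>"
  have "\<bar>ramp c \<epsilon> x - ramp c \<epsilon> y\<bar> \<le> \<bar>(c - x) / \<epsilon> - (c - y) / \<epsilon>\<bar>" unfolding ramp_def by linarith
  also have "\<dots> = 1 / \<epsilon> * \<bar>x - y\<bar>" using e by (simp add: diff_divide_distrib[symmetric] abs_minus_commute)
  finally show "dist (ramp c \<epsilon> x) (ramp c \<epsilon> y) \<le> 1 / \<epsilon> * dist x y" by (simp add: dist_real_def)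
qed simp

lemma ramp_simps:
  assumes "0 < \<epsilon>"
  shows "0 \<le> ramp c \<epsilon> t" "ramp c \<epsilon> t \<le> 1" "c \<le> t \<Longrightarrow> ramp c \<epsilon> t = 0"
  using assms by (auto simp: ramp_def min_def max_def field_simps)

lemma ramp_derivative:
  assumes "0 < \<epsilon>" "t \<noteq> c" "t \<noteq> c - \<epsilon>"
  shows "(ramp c \<epsilon> has_real_derivative - (indicator {c - \<epsilon><..<c} t / \<epsilon>)) (at t)"
proof -
  consider "t < c - \<epsilon>" | "c - \<epsilon> < t" "t < c" | "c < t" using assms by linarith
  then show ?thesis
  proof cases
    case 1
    then have "((\<lambda>_. 1) has_real_derivative - (indicator {c - \<epsilon><..<c} t / \<epsilon>)) (at t)" by simp
    then show ?thesis
      by (rule has_field_derivative_transform_within_open[where S = "{..<c - \<epsilon>}"])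
         (use 1 assms in \<open>auto simp: ramp_def min_def max_def field_simps\<close>)
  next
    case 2
    then have "((\<lambda>s. (c - s) / \<epsilon>) has_real_derivative - (indicator {c - \<epsilon><..<c} t / \<epsilon>)) (at t)"
      using assms by (auto intro!: derivative_eq_intros simp: field_simps)
    then show ?thesis
      by (rule has_field_derivative_transform_within_open[where S = "{c - \<epsilon><..<c}"])
         (use 2 assms in \<open>auto simp: ramp_def min_def max_def field_simps\<close>)
  next
    case 3
    then have "((\<lambda>_. 0) has_real_derivative - (indicator {c - \<epsilon><..<c} t / \<epsilon>)) (at t)" by simp
    then show ?thesis
      by (rule has_field_derivative_transform_within_open[where S = "{c<..}"])
         (use 3 assms in \<open>auto simp: ramp_def min_def max_def field_simps\<close>)
  qed
qed

lemma one_minus_exp_le: "1 - exp (- x) \<le> (x::real)"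
  using exp_ge_add_one_self[of "- x"] by linarith

section \<open>Measurability and null sets on the slab\<close>

lemma borel_measurable_fst: "fst \<in> (borel :: (real \<times> real) measure) \<rightarrow>\<^sub>M borel"
  by (intro borel_measurable_continuous_onI continuous_intros)

lemma borel_measurable_snd: "snd \<in> (borel :: (real \<times> real) measure) \<rightarrow>\<^sub>M borel"
  by (intro borel_measurable_continuous_onI continuous_intros)

lemma measurable_slab: "g \<in> borel_measurable borel \<Longrightarrow> g \<in> borel_measurable (slab T)"
  unfolding slab_def by (rule measurable_restrict_space1) simp

text \<open>\<open>ennreal\<close> truncates negative numbers to 0, so equality can fail for
  summands of opposite sign.\<close>

lemma ennreal_plus_le: "ennreal (a + b) \<le> ennreal a + ennreal b"
  by (cases "0 \<le> a"; cases "0 \<le> b")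
     (auto simp: ennreal_plus[symmetric] ennreal_neg intro: ennreal_leI order_trans simp del: ennreal_plus)

lemma AE_slab_iff: "(AE z in slab T. P z) \<longleftrightarrow> (AE z in lborel. fst z \<in> {0<..<T} \<longrightarrow> P z)"
  unfolding slab_def by (subst AE_restrict_space_iff) (auto simp: borel_Times mem_Times_iff)

lemma AE_lborel_coordinate:
  assumes "AE t in lborel. P t"
  shows "AE z :: real \<times> real in lborel. P (fst z)" and "AE z :: real \<times> real in lborel. P (snd z)"
proof -
  \<comment> \<open>\<open>P\<close> itself may fail to be Borel, so its failures are first enclosed
    in a Borel null set.\<close>
  from assms obtain N where N: "N \<in> null_sets lborel" "{t. \<not> P t} \<subseteq> N"
    by (auto elim!: AE_E simp: null_sets_def)
  then have [measurable]: "N \<in> sets borel" by (auto simp: null_sets_def)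
  note N_AE = AE_not_in[OF N(1)]
  have f: "AE z :: real \<times> real in lborel. fst z \<notin> N"
    by (rule AE_lborel_pairI, rule measurable_compose[OF borel_measurable_fst, where g = "\<lambda>t. t \<notin> N"])
       (measurable, use N_AE in auto)
  have s: "AE z :: real \<times> real in lborel. snd z \<notin> N"
    by (rule AE_lborel_pairI, rule measurable_compose[OF borel_measurable_snd, where g = "\<lambda>t. t \<notin> N"])
       (measurable, use N_AE in auto)
  from f show "AE z :: real \<times> real in lborel. P (fst z)" by eventually_elim (use N in auto)
  from s show "AE z :: real \<times> real in lborel. P (snd z)" by eventually_elim (use N in auto)
qed

lemma AE_slab_fst: "AE t in lborel. P t \<Longrightarrow> AE z in slab T. P (fst z)"
  unfolding AE_slab_iff by (drule AE_lborel_coordinate(1)) (auto elim!: eventually_mono)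

lemma nn_integral_slab:
  assumes [measurable]: "g \<in> borel_measurable (slab T)"
  shows "(\<integral>\<^sup>+z. g z \<partial>slab T) = (\<integral>\<^sup>+z. g z * indicator ({0<..<T} \<times> UNIV) z \<partial>lborel)"
  unfolding slab_def by (subst nn_integral_restrict_space) (auto simp: borel_Times)

lemma integrable_slab_bounded:
  fixes g :: "real \<times> real \<Rightarrow> real"
  assumes g: "g \<in> borel_measurable (slab T)"
    and b: "AE z in slab T. \<bar>g z\<bar> \<le> B * indicator {- r..r} (snd z)"
  shows "integrable (slab T) g"
proof (rule Bochner_Integration.integrable_bound[OF _ g])
  have "integrable lborel (\<lambda>z::real \<times> real. indicator (cbox (0, - r) (T, r)) z * \<bar>B\<bar>)"
    by (intro integrable_mult_left integrable_real_indicator) (auto simp: emeasure_lborel_cbox_eq)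
  then show "integrable (slab T) (\<lambda>z. indicator (cbox (0, - r) (T, r)) z * \<bar>B\<bar>)"
    unfolding slab_def
    by (subst integrable_restrict_space)
       (auto simp: borel_Times simp del: real_scaleR_def intro!: integrable_mult_indicator)
  have "AE z in slab T. z \<in> {0<..<T} \<times> UNIV" using AE_space[of "slab T"] by simp
  with b show "AE z in slab T. norm (g z) \<le> norm (indicator (cbox (0, - r) (T, r)) z * \<bar>B\<bar>)"
  proof eventually_elim
    case (elim z)
    then show ?case by (cases "snd z \<in> {- r..r}") (auto simp: indicator_def)
  qed
qed

section \<open>The weighted estimate over a time window\<close>

context relative_entropy
begin

text \<open>After the symmetry has removed the linear part of the flux difference, Young's
  inequality is applied to the residual term. Since the mixed form is bounded by \<open>Cu\<close>,
  this is where \<open>Cu\<^sup>2\<close> and the factor 1/2 of the squared residual come from; the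
  other coefficient is \<open>Cu\<close> times the bound on \<open>rel_f\<close>.\<close>

lemma dissipation_bound:
  assumes uv: "u \<in> C" "v \<in> C" and \<phi>: "0 \<le> \<phi>"
  shows "- (\<phi> * (D2 \<eta> v vt (u - v) + D2 \<eta> v vx (f u - f v)))
    \<le> \<phi> * ((norm (vt + D1 f v vx))\<^sup>2 / 2 + (Cu\<^sup>2 + Cu * Cf * norm vx) / 2 * (norm (u - v))\<^sup>2)"
proof -
  define R where "R = vt + D1 f v vx"
  have vU: "v \<in> U" using uv C_sub_U by auto
  have "vt = R - D1 f v vx" by (simp add: R_def)
  then have eq: "D2 \<eta> v vt (u - v) + D2 \<eta> v vx (f u - f v) = D2 \<eta> v R (u - v) + D2 \<eta> v vx (rel_f u v)"
    using D2_eta_D1_f[OF vU, of vx "u - v"]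
    by (simp add: rel_f_def blinfun.diff_left blinfun.diff_right)
  have "\<bar>D2 \<eta> v R (u - v)\<bar> \<le> norm R * (Cu * norm (u - v))"
    using D2_eta_le[OF uv(2), of R "u - v"] by (simp add: mult_ac)
  moreover have "norm R * (Cu * norm (u - v)) \<le> (norm R)\<^sup>2 / 2 + (Cu * norm (u - v))\<^sup>2 / 2"
    using zero_le_power2[of "norm R - Cu * norm (u - v)"] unfolding power2_diff by simp
  moreover have "\<bar>D2 \<eta> v vx (rel_f u v)\<bar> \<le> Cu * norm vx * (Cf / 2 * (norm (u - v))\<^sup>2)"
    using D2_eta_le[OF uv(2), of vx "rel_f u v"] rel_f_le[OF uv] Cu_pos
    by (meson mult_left_mono mult_nonneg_nonneg norm_ge_zero less_imp_le order_trans)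
  moreover have "(Cu\<^sup>2 + Cu * Cf * norm vx) / 2 * (norm (u - v))\<^sup>2
      = (Cu * norm (u - v))\<^sup>2 / 2 + Cu * norm vx * (Cf / 2 * (norm (u - v))\<^sup>2)"
    by (simp add: power_mult_distrib algebra_simps)
  ultimately have "- (D2 \<eta> v R (u - v) + D2 \<eta> v vx (rel_f u v))
      \<le> (norm R)\<^sup>2 / 2 + (Cu\<^sup>2 + Cu * Cf * norm vx) / 2 * (norm (u - v))\<^sup>2"
    by linarith
  from mult_left_mono[OF this \<phi>] show ?thesis unfolding eq R_def by (simp only: mult_minus_right)
qed

text \<open>Replacing the squared distance by \<open>2 / Cl\<close> times the relative entropy turns
  the coefficient of \<open>dissipation_bound\<close> into the rate of the exponential.\<close>

lemma exponent_eq: "(Cu\<^sup>2 + Cu * Cf * l) / 2 * (2 / Cl) = (Cu * Cf * l + Cu\<^sup>2) / Cl"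
  using Cl_pos by (simp add: field_simps)

text \<open>In the derivatives of \<open>\<phi>\<close> each factor has one task: the exponential
  absorbs the quadratic terms of \<open>dissipation_bound\<close>, the cone absorbs
  \<open>rel_q\<close>, and the ramp leaves the average over the window. Ending the window at
  \<open>s - \<epsilon>\<close> keeps the support of \<open>\<phi>\<close> below \<open>T\<close>
  even if \<open>s = T\<close>. The envelope \<open>l\<close> depends on time alone, as an
  integrating factor in time must.\<close>

lemma weighted_time_average_bound:
  fixes v :: "real \<times> real \<Rightarrow> real^'m"
  assumes T: "0 < T" and sol: "entropy_solution T U f \<eta> q u0 u"
    and u_meas [measurable]: "(\<lambda>(t, x). u t x) \<in> borel_measurable (slab T)"
    and u0_meas [measurable]: "u0 \<in> borel_measurable borel"
    and uC: "AE (t, x) in slab T. u t x \<in> C" and u0C: "AE x in lborel. u0 x \<in> C"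
    and v: "Lv-lipschitz_on UNIV v" and vC: "\<And>z. v z \<in> C"
    and D_meas [measurable]: "vt \<in> borel_measurable borel" "vx \<in> borel_measurable borel"
    and D_le: "\<And>z. norm (vt z) \<le> Lv" "\<And>z. norm (vx z) \<le> Lv"
    and vt: "AE (t, x) in slab T. ((\<lambda>s. v (s, x)) has_vector_derivative vt (t, x)) (at t)"
    and vx: "AE (t, x) in slab T. ((\<lambda>z. v (t, z)) has_vector_derivative vx (t, x)) (at x)"
    and l_meas [measurable]: "l \<in> borel_measurable borel" and l: "\<And>t. 0 \<le> l t" "\<And>t. l t \<le> Bl"
    and vx_le: "AE (t, x) in slab T. norm (vx (t, x)) \<le> l t"
    and s: "s \<le> T" and \<epsilon>: "0 < \<epsilon>" "2 * \<epsilon> < s" and N: "0 < N"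
    and \<sigma>: "0 \<le> \<sigma>" "\<And>u v. u \<in> C \<Longrightarrow> v \<in> C \<Longrightarrow> \<bar>rel_q u v\<bar> \<le> \<sigma> * rel_eta u v"
  defines "A \<equiv> \<lambda>t. integral {0..t} (\<lambda>t. (Cu * Cf * l t + Cu\<^sup>2) / Cl)"
  shows "ennreal (exp (- A s) * Cl / (2 * \<epsilon>)) * (\<integral>\<^sup>+z. indicator {s - 2 * \<epsilon><..<s - \<epsilon>} (fst z) *
      (ennreal ((cone_weight N \<sigma> z)\<^sup>2) * ennreal ((norm (u (fst z) (snd z) - v z))\<^sup>2)) \<partial>slab T)
    \<le> ennreal (1 / 2) * (\<integral>\<^sup>+z. ennreal ((norm (vt z + D1 f (v z) (vx z)))\<^sup>2) * indicator {0<..<s} (fst z) \<partial>slab T)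
      + ennreal (Cu / 2) * (\<integral>\<^sup>+x. ennreal ((norm (u0 x - v (0, x)))\<^sup>2) \<partial>lborel)"
proof -
  define a where "a = (\<lambda>t. (Cu * Cf * l t + Cu\<^sup>2) / Cl)"
  have A_def': "A = (\<lambda>t. integral {0..t} a)" by (simp add: A_def a_def)
  have a_meas [measurable]: "a \<in> borel_measurable borel" unfolding a_def by measurable
  have a0: "0 \<le> a t" for t unfolding a_def using l Cl_pos Cu_pos Cf_pos by (intro divide_nonneg_nonneg add_nonneg_nonneg mult_nonneg_nonneg) auto
  define Ba where "Ba = (Cu * Cf * Bl + Cu\<^sup>2) / Cl"
  have aB: "a t \<le> Ba" for t
    unfolding a_def Ba_def using l(2) Cl_pos Cu_pos Cf_pos by (intro divide_right_mono add_mono mult_left_mono) auto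
  have A_app: "integral {0..t} a = A t" for t by (simp add: A_def')
  note A = integral_bounded_lipschitz[OF a_meas a0 aB, unfolded A_app]
  define e where "e = (\<lambda>t. exp (- A t))"
  have e01: "0 < e t" "e t \<le> 1" for t using A(3)[of t] by (auto simp: e_def)
  have e_mono: "t \<le> s \<Longrightarrow> e s \<le> e t" for s t using A(2) by (simp add: e_def)
  have e_lip: "Ba-lipschitz_on UNIV e"
  proof (rule lipschitz_onI)
    fix x y
    have "\<bar>exp (- b) - exp (- c)\<bar> \<le> \<bar>b - c\<bar>" if "0 \<le> b" "0 \<le> c" for b c :: real
    proof -
      have *: "exp (- b) - exp (- c) \<le> c - b" if "0 \<le> b" "b \<le> c" for b c :: real
      proof -
        have "exp (- b) * (1 - exp (- (c - b))) \<le> 1 * (c - b)"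
          using one_minus_exp_le[of "c - b"] that by (intro mult_mono) auto
        then show ?thesis by (simp add: right_diff_distrib exp_add[symmetric])
      qed
      show ?thesis using *[of b c] *[of c b] that by (cases "b \<le> c") auto
    qed
    then have "\<bar>e x - e y\<bar> \<le> \<bar>A x - A y\<bar>" unfolding e_def using A(3) by blast
    also have "\<dots> \<le> Ba * dist x y" using lipschitz_onD[OF A(1), of x y] by (simp add: dist_real_def)
    finally show "dist (e x) (e y) \<le> Ba * dist x y" by (simp add: dist_real_def)
  qed (use aB[of 0] a0[of 0] in simp)
  define c where "c = s - \<epsilon>"
  define \<kappa> where "\<kappa> = ramp c \<epsilon>"
  define J where "J = {s - 2 * \<epsilon><..<s - \<epsilon>}"
  have J: "J = {c - \<epsilon><..<c}" by (simp add: J_def c_def)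
  have [measurable]: "J \<in> sets borel" by (simp add: J_def)
  have \<kappa>: "0 \<le> \<kappa> t" "\<kappa> t \<le> 1" "c \<le> t \<Longrightarrow> \<kappa> t = 0" for t
    using ramp_simps[OF \<epsilon>(1)] by (auto simp: \<kappa>_def)
  define p where "p = cone_weight N \<sigma>"
  have p: "0 \<le> p z" "p z \<le> 1" for z using cone_weight_bounds[OF N \<sigma>(1)] by (auto simp: p_def)
  have p_far: "N \<le> \<bar>x\<bar> \<Longrightarrow> p (t, x) = 0" for t x using cone_weight_eq_0[OF N \<sigma>(1)] by (simp add: p_def)
  define \<phi> where "\<phi> = (\<lambda>z. (\<kappa> (fst z) * e (fst z)) * (p z)\<^sup>2)"
  have \<kappa>e01: "0 \<le> \<kappa> t * e t" "\<kappa> t * e t \<le> 1" for t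
    using \<kappa>(1,2)[of t] e01[of t] mult_mono[of "\<kappa> t" 1 "e t" 1] by auto
  have p01: "0 \<le> (p z)\<^sup>2" "(p z)\<^sup>2 \<le> 1" for z
    using p[of z] by (auto simp: power_le_one)
  have \<phi>01: "0 \<le> \<phi> z" "\<phi> z \<le> 1" for z
    unfolding \<phi>_def using \<kappa>e01[of "fst z"] p01[of z] mult_mono[of "\<kappa> (fst z) * e (fst z)" 1 "(p z)\<^sup>2" 1] by auto
  obtain L1 where L1: "L1-lipschitz_on UNIV (\<lambda>t. \<kappa> t * e t)"
    using bounded_bilinear.lipschitz_on_prod[OF bounded_bilinear_mult ramp_lipschitz[OF \<epsilon>(1), of c] e_lip, of 1 1]
      \<kappa> e01 by (auto simp: \<kappa>_def abs_of_pos less_imp_le)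
  note L1' = lipschitz_on_coordinate(1)[OF L1]
  have "\<exists>L2. L2-lipschitz_on UNIV (\<lambda>z. p z * p z)"
    using bounded_bilinear.lipschitz_on_prod[OF bounded_bilinear_mult cone_weight_lipschitz[OF N \<sigma>(1)] cone_weight_lipschitz[OF N \<sigma>(1)], of 1 1] p
    unfolding p_def by (metis abs_of_nonneg real_norm_def)
  then obtain L2 where L2: "L2-lipschitz_on UNIV (\<lambda>z. (p z)\<^sup>2)" by (auto simp: power2_eq_square)
  obtain L\<phi> where L\<phi>: "L\<phi>-lipschitz_on UNIV \<phi>"
    using bounded_bilinear.lipschitz_on_prod[OF bounded_bilinear_mult L1' L2, of 1 1] \<kappa>e01 p01
    unfolding \<phi>_def by (metis abs_of_nonneg real_norm_def)
  have cT: "c < T" using s \<epsilon> by (simp add: c_def)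
  have \<phi>_late: "\<phi> (t, x) = 0" if "c \<le> t" for t x using \<kappa>(3)[OF that] by (simp add: \<phi>_def)
  have \<phi>_far: "\<phi> (t, x) = 0" if "N \<le> \<bar>x\<bar>" for t x using p_far[OF that] by (simp add: \<phi>_def)
  obtain E where E: "integrable (slab T) E"
    "AE (t, x) in slab T. \<forall>\<phi>t \<phi>x vt vx.
       ((\<lambda>s. \<phi> (s, x)) has_real_derivative \<phi>t) (at t) \<longrightarrow> ((\<lambda>z. \<phi> (t, z)) has_real_derivative \<phi>x) (at x) \<longrightarrow>
       ((\<lambda>s. v (s, x)) has_vector_derivative vt) (at t) \<longrightarrow> ((\<lambda>z. v (t, z)) has_vector_derivative vx) (at x) \<longrightarrow>
       E (t, x) = rel_eta (u t x) (v (t, x)) * \<phi>t + rel_q (u t x) (v (t, x)) * \<phi>x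
         - \<phi> (t, x) * (D2 \<eta> (v (t, x)) vt (u t x - v (t, x)) + D2 \<eta> (v (t, x)) vx (f (u t x) - f (v (t, x))))"
    "integrable lborel (\<lambda>x. rel_eta (u0 x) (v (0, x)) * \<phi> (0, x))"
    "0 \<le> integral\<^sup>L (slab T) E + (LINT x|lborel. rel_eta (u0 x) (v (0, x)) * \<phi> (0, x))"
    by (rule relative_entropy_inequality[OF T sol v vC L\<phi> \<phi>01 cT, of N])
       (erule \<phi>_late, erule \<phi>_far, rule that)
  define W where "W = (\<lambda>z. u (fst z) (snd z) - v z)"
  define R where "R = (\<lambda>z. vt z + D1 f (v z) (vx z))"
  have v_cont: "continuous_on UNIV v" using v by (rule lipschitz_on_continuous_on)
  have v_meas [measurable]: "v \<in> borel_measurable borel" by (rule borel_measurable_continuous_onI[OF v_cont])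
  have p_meas [measurable]: "p \<in> borel_measurable borel"
    unfolding p_def using cone_weight_lipschitz[OF N \<sigma>(1)] lipschitz_on_continuous_on borel_measurable_continuous_onI by blast
  have \<phi>_meas [measurable]: "\<phi> \<in> borel_measurable borel"
    using L\<phi> lipschitz_on_continuous_on borel_measurable_continuous_onI by blast
  have D1f_cont: "continuous_on UNIV (\<lambda>z. D1 f (v z))"
    by (rule continuous_on_compose2[OF C2_on_continuous(2)[OF C2_f] v_cont]) (use vC C_sub_U in auto)
  have R_meas [measurable]: "R \<in> borel_measurable borel"
  proof -
    have "(\<lambda>z. D1 f (v z) (axis k 1)) \<in> borel_measurable borel" for k
      by (intro borel_measurable_continuous_onI continuous_intros D1f_cont)
    then have "(\<lambda>z. \<Sum>k\<in>UNIV. (vx z \<bullet> axis k 1) *\<^sub>R D1 f (v z) (axis k 1)) \<in> borel_measurable borel"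
      by measurable
    then have "(\<lambda>z. D1 f (v z) (vx z)) \<in> borel_measurable borel"
      by (simp only: blinfun_axis_expansion[symmetric])
    then show ?thesis unfolding R_def by measurable
  qed
  have [measurable]: "(\<lambda>z::real \<times> real. indicator J (fst z) :: real) \<in> borel_measurable borel"
    "(\<lambda>z::real \<times> real. indicator {0<..<s} (fst z) :: ennreal) \<in> borel_measurable borel"
    by (rule measurable_compose[OF borel_measurable_fst]; measurable)+
  obtain BR where BR: "norm (R z) \<le> BR" for z
  proof -
    have "compact C" "continuous_on C (D1 f)"
      using compact_C C2_on_continuous(2)[OF C2_f] C_sub_U continuous_on_subset by auto
    then have "bounded (D1 f ` C)" by (intro compact_imp_bounded compact_continuous_image)
    then obtain B where B: "\<And>w. w \<in> C \<Longrightarrow> norm (D1 f w) \<le> B" unfolding bounded_iff by auto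
    have "norm (R z) \<le> Lv + B * Lv" for z
    proof -
      have "norm (D1 f (v z) (vx z)) \<le> norm (D1 f (v z)) * norm (vx z)" by (rule norm_blinfun)
      also have "\<dots> \<le> B * Lv" using B[OF vC[of z]] D_le(2)[of z] order_trans[OF norm_ge_zero B[OF vC[of z]]]
        by (intro mult_mono) auto
      finally show ?thesis unfolding R_def
        using norm_triangle_ineq[of "vt z" "D1 f (v z) (vx z)"] D_le(1)[of z] by linarith
    qed
    then show ?thesis by (rule that)
  qed
  obtain BC where BC: "\<And>w. w \<in> C \<Longrightarrow> norm w \<le> BC"
    using compact_imp_bounded[OF compact_C] unfolding bounded_iff by blast
  have W_meas [measurable]: "W \<in> borel_measurable (slab T)"
  proof -
    have "(\<lambda>z. u (fst z) (snd z)) \<in> borel_measurable (slab T)" using u_meas by (simp add: split_beta')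
    then show ?thesis unfolding W_def using measurable_slab[OF v_meas] by measurable
  qed
  \<comment> \<open>Lower bound for the entropy in the window: the integrating factor is replaced by
    its smaller value \<open>e s\<close>, the entropy by \<open>Cl / 2\<close> times the square, and
    1/\<epsilon> is the slope of the ramp.\<close>
  define b1 where "b1 = (\<lambda>z. e s * Cl / (2 * \<epsilon>) * (indicator J (fst z) * (p z)\<^sup>2 * (norm (W z))\<^sup>2))"
  define b2 where "b2 = (\<lambda>z. \<phi> z * (norm (R z))\<^sup>2 / 2)"
  have uvC: "AE z in slab T. u (fst z) (snd z) \<in> C" using uC by (simp add: split_beta')
  have W_le: "norm (u1 - v z) \<le> 2 * BC" if "u1 \<in> C" for u1 z
    using norm_triangle_ineq4[of u1 "v z"] BC[OF that] BC[OF vC[of z]] by linarith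
  have b1_int: "integrable (slab T) b1"
  proof (rule integrable_slab_bounded)
    show "b1 \<in> borel_measurable (slab T)"
    proof -
      have "(\<lambda>z::real\<times>real. indicator J (fst z) * (p z)\<^sup>2) \<in> borel_measurable borel" by measurable
      from measurable_slab[OF this] show ?thesis unfolding b1_def by measurable
    qed
    show "AE z in slab T. \<bar>b1 z\<bar> \<le> (e s * Cl / (2 * \<epsilon>) * (1 * 1 * (2 * BC)\<^sup>2)) * indicator {- N..N} (snd z)"
      using uvC
    proof eventually_elim
      case (elim z)
      have k: "0 \<le> e s * Cl / (2 * \<epsilon>)" using e01 Cl_pos \<epsilon> by (simp add: less_imp_le)
      have "0 \<le> b1 z" unfolding b1_def using k by (intro mult_nonneg_nonneg) auto
      moreover have "b1 z \<le> e s * Cl / (2 * \<epsilon>) * (1 * 1 * (2 * BC)\<^sup>2)"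
        unfolding b1_def using k p01[of z] W_le[OF elim, of z]
        by (intro mult_left_mono mult_mono power_mono) (auto simp: W_def)
      moreover have "b1 z = 0" if "snd z \<notin> {- N..N}"
      proof -
        have "N \<le> \<bar>snd z\<bar>" using that by (auto simp: not_le)
        then show ?thesis using p_far[of "snd z" "fst z"] by (simp add: b1_def)
      qed
      ultimately show ?case by (auto simp: indicator_def)
    qed
  qed
  have b2_int: "integrable (slab T) b2"
  proof (rule integrable_slab_bounded)
    show "b2 \<in> borel_measurable (slab T)" unfolding b2_def by (rule measurable_slab) measurable
    show "AE z in slab T. \<bar>b2 z\<bar> \<le> (1 * BR\<^sup>2) * indicator {- N..N} (snd z)"
    proof (rule AE_I2)
      fix z :: "real \<times> real"
      have "0 \<le> b2 z" unfolding b2_def using \<phi>01 by simp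
      moreover have "\<phi> z * (norm (R z))\<^sup>2 \<le> 1 * BR\<^sup>2" using \<phi>01[of z] BR[of z] by (intro mult_mono power_mono) auto
      then have "b2 z \<le> 1 * BR\<^sup>2" unfolding b2_def using \<open>0 \<le> b2 z\<close> b2_def by simp
      moreover have "b2 z = 0" if "snd z \<notin> {- N..N}"
      proof -
        have "N \<le> \<bar>snd z\<bar>" using that by (auto simp: not_le)
        then show ?thesis using \<phi>_far[of "snd z" "fst z"] by (simp add: b2_def)
      qed
      ultimately show "\<bar>b2 z\<bar> \<le> (1 * BR\<^sup>2) * indicator {- N..N} (snd z)" by (auto simp: indicator_def)
    qed
  qed
  have "AE t in lborel. t \<noteq> c \<and> t \<noteq> c - \<epsilon> \<and> (0 < t \<longrightarrow> (A has_real_derivative a t) (at t))"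
    using AE_lborel_singleton[of c] AE_lborel_singleton[of "c - \<epsilon>"] A(4) by eventually_elim auto
  from AE_slab_fst[OF this, of T]
  have time: "AE z in slab T. fst z \<noteq> c \<and> fst z \<noteq> c - \<epsilon> \<and> (0 < fst z \<longrightarrow> (A has_real_derivative a (fst z)) (at (fst z)))" .
  have "AE z in slab T. fst z \<in> {0<..<T}" using AE_space[of "slab T"] by eventually_elim auto
  with time uC vt vx vx_le E(2) have key: "AE z in slab T. E z \<le> b2 z - b1 z"
  proof (eventually_elim, clarsimp)
    fix t x
    assume t: "0 < t" "t < T" and tc: "t \<noteq> c" "t \<noteq> c - \<epsilon>" and At: "(A has_real_derivative a t) (at t)"
      and uC: "u t x \<in> C" and vt: "((\<lambda>s. v (s, x)) has_vector_derivative vt (t, x)) (at t)"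
      and vx: "((\<lambda>z. v (t, z)) has_vector_derivative vx (t, x)) (at x)" and vx_le: "norm (vx (t, x)) \<le> l t"
      and E: "\<forall>\<phi>t. ((\<lambda>s. \<phi> (s, x)) has_real_derivative \<phi>t) (at t) \<longrightarrow>
       (\<forall>\<phi>x. ((\<lambda>z. \<phi> (t, z)) has_real_derivative \<phi>x) (at x) \<longrightarrow>
       (\<forall>vt. ((\<lambda>s. v (s, x)) has_vector_derivative vt) (at t) \<longrightarrow> (\<forall>vx. ((\<lambda>z. v (t, z)) has_vector_derivative vx) (at x) \<longrightarrow>
       E (t, x) = rel_eta (u t x) (v (t, x)) * \<phi>t + rel_q (u t x) (v (t, x)) * \<phi>x
         - \<phi> (t, x) * (D2 \<eta> (v (t, x)) vt (u t x - v (t, x)) + D2 \<eta> (v (t, x)) vx (f (u t x) - f (v (t, x)))))))"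
    define z where "z = (t, x)"
    define H where "H = rel_eta (u t x) (v z)"
    define Y where "Y = x / sqrt (1 + x\<^sup>2)"
    define I where "I = (indicator J t :: real)"
    have et: "(e has_real_derivative - a t * e t) (at t)"
      unfolding e_def by (rule DERIV_cong[OF DERIV_chain2[OF DERIV_exp DERIV_minus[OF At]]]) simp
    have \<kappa>t: "(\<kappa> has_real_derivative - (I / \<epsilon>)) (at t)"
      unfolding \<kappa>_def I_def J by (rule ramp_derivative) (use \<epsilon> tc in auto)
    have \<phi>t: "((\<lambda>s. \<phi> (s, x)) has_real_derivative
        (- (I / \<epsilon>) * e t * (p z)\<^sup>2 - a t * \<phi> z - \<kappa> t * e t * (2 * p z * \<sigma> / N))) (at t)"
      unfolding \<phi>_def fst_conv
      by (rule DERIV_cong[OF DERIV_mult[OF DERIV_mult[OF \<kappa>t et] cone_weight_derivatives(1)[OF N t(1), of \<sigma> x, folded p_def]]])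
         (simp add: z_def algebra_simps)
    have \<phi>x: "((\<lambda>y. \<phi> (t, y)) has_real_derivative - (\<kappa> t * e t * (2 * p z * Y / N))) (at x)"
      unfolding \<phi>_def fst_conv
      by (rule DERIV_cong[OF DERIV_cmult[OF cone_weight_derivatives(2)[OF N, of \<sigma> t x, folded p_def]]])
         (simp add: z_def Y_def)
    have Ez: "E z = H * (- (I / \<epsilon>) * e t * (p z)\<^sup>2 - a t * \<phi> z - \<kappa> t * e t * (2 * p z * \<sigma> / N))
        + rel_q (u t x) (v z) * - (\<kappa> t * e t * (2 * p z * Y / N))
        - \<phi> z * (D2 \<eta> (v z) (vt z) (u t x - v z) + D2 \<eta> (v z) (vx z) (f (u t x) - f (v z)))"
      using E \<phi>t \<phi>x vt vx unfolding H_def z_def by blast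
    have H: "Cl / 2 * (norm (W z))\<^sup>2 \<le> H" "0 \<le> H"
      using rel_eta_bounds(1)[OF uC vC[of z]] Cl_pos order_trans[of 0 "Cl / 2 * (norm (u t x - v z))\<^sup>2"]
      by (auto simp: H_def W_def z_def)
    have Y: "\<bar>Y\<bar> \<le> 1"
    proof -
      have "\<bar>x\<bar> \<le> sqrt (1 + x\<^sup>2)" by (rule real_le_rsqrt) simp
      then show ?thesis by (simp add: Y_def divide_le_eq add_pos_nonneg)
    qed
    \<comment> \<open>Common factor of both terms that come from differentiating the squared cone
      weight. With it taken out, the sign follows from the bound of \<open>rel_q\<close> by \<sigma>
      times \<open>H\<close> and from |Y| \<le> 1.\<close>
    define K where "K = \<kappa> t * e t * (2 * p z / N)"
    have K: "0 \<le> K" unfolding K_def using \<kappa>e01(1)[of t] p[of z] N by (intro mult_nonneg_nonneg[of "\<kappa> t * e t"]) auto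
    have "- (rel_q (u t x) (v z) * Y) \<le> \<bar>rel_q (u t x) (v z)\<bar> * \<bar>Y\<bar>"
      using abs_ge_minus_self[of "rel_q (u t x) (v z) * Y"] by (simp add: abs_mult)
    also have "\<dots> \<le> (\<sigma> * H) * 1"
      using \<sigma>(2)[OF uC vC[of z]] Y by (intro mult_mono) (auto simp: H_def intro: order_trans[OF abs_ge_zero])
    finally have "K * (- (rel_q (u t x) (v z) * Y) - \<sigma> * H) \<le> 0"
      using K by (intro mult_nonneg_nonpos) auto
    then have cone: "H * - (\<kappa> t * e t * (2 * p z * \<sigma> / N)) + rel_q (u t x) (v z) * - (\<kappa> t * e t * (2 * p z * Y / N)) \<le> 0"
      by (simp add: K_def algebra_simps)
    have "- (\<phi> z * (D2 \<eta> (v z) (vt z) (u t x - v z) + D2 \<eta> (v z) (vx z) (f (u t x) - f (v z))))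
      \<le> \<phi> z * ((norm (R z))\<^sup>2 / 2 + (Cu\<^sup>2 + Cu * Cf * norm (vx z)) / 2 * (norm (W z))\<^sup>2)"
      using dissipation_bound[OF uC vC[of z] \<phi>01(1)[of z], of "vt z" "vx z"] by (simp add: R_def W_def z_def)
    \<comment> \<open>The pointwise |v_x| gives way to the envelope \<open>l t\<close>, so the rate
      becomes a function of time that matches the derivative of \<open>A\<close>.\<close>
    also have "\<dots> \<le> \<phi> z * ((norm (R z))\<^sup>2 / 2 + (Cu\<^sup>2 + Cu * Cf * l t) / 2 * (2 / Cl * H))"
    proof -
      have "Cu\<^sup>2 + Cu * Cf * norm (vx z) \<le> Cu\<^sup>2 + Cu * Cf * l t"
        using vx_le Cu_pos Cf_pos by (simp add: z_def)
      moreover have "(norm (W z))\<^sup>2 \<le> 2 / Cl * H" using H Cl_pos by (simp add: field_simps)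
      ultimately show ?thesis
        using \<phi>01(1)[of z] Cu_pos Cf_pos l(1)[of t]
        by (intro mult_left_mono add_left_mono mult_mono) auto
    qed
    also have "\<dots> = b2 z + a t * \<phi> z * H"
    proof -
      have "(Cu\<^sup>2 + Cu * Cf * l t) / 2 * (2 / Cl * H) = a t * H"
        unfolding a_def exponent_eq[symmetric] by (simp only: mult.assoc)
      then show ?thesis by (simp add: b2_def distrib_left mult_ac)
    qed
    finally have diss: "- (\<phi> z * (D2 \<eta> (v z) (vt z) (u t x - v z) + D2 \<eta> (v z) (vx z) (f (u t x) - f (v z))))
      \<le> b2 z + a t * \<phi> z * H" .
    have "b1 z \<le> (I / \<epsilon>) * e t * (p z)\<^sup>2 * H"
    proof (cases "t \<in> J")
      case True
      then have "t \<le> s" using \<epsilon> by (simp add: J_def)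
      then have "e s * (Cl / 2 * (norm (W z))\<^sup>2) \<le> e t * H"
        using e_mono H e01 Cl_pos by (intro mult_mono) (auto intro: less_imp_le)
      then have "(e s * (Cl / 2 * (norm (W z))\<^sup>2)) * ((p z)\<^sup>2 / \<epsilon>) \<le> (e t * H) * ((p z)\<^sup>2 / \<epsilon>)"
        using \<epsilon> by (intro mult_right_mono) auto
      then show ?thesis using True by (simp add: b1_def I_def z_def mult_ac)
    next
      case False
      then show ?thesis by (simp add: b1_def I_def z_def)
    qed
    moreover have "H * (- (I / \<epsilon>) * e t * (p z)\<^sup>2 - a t * \<phi> z - \<kappa> t * e t * (2 * p z * \<sigma> / N))
      = - ((I / \<epsilon>) * e t * (p z)\<^sup>2 * H) - a t * \<phi> z * H + H * - (\<kappa> t * e t * (2 * p z * \<sigma> / N))"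
      by (simp add: algebra_simps)
    ultimately show "E (t, x) \<le> b2 (t, x) - b1 (t, x)"
      using cone diss unfolding z_def[symmetric] Ez by linarith
  qed
  have "integral\<^sup>L (slab T) E \<le> integral\<^sup>L (slab T) b2 - integral\<^sup>L (slab T) b1"
    using integral_mono_AE[OF E(1) Bochner_Integration.integrable_diff[OF b2_int b1_int] key] b1_int b2_int by simp
  then have main: "integral\<^sup>L (slab T) b1 \<le> integral\<^sup>L (slab T) b2 + (LINT x|lborel. rel_eta (u0 x) (v (0, x)) * \<phi> (0, x))"
    using E(4) by linarith
  have b1_val: "ennreal (integral\<^sup>L (slab T) b1) = ennreal (exp (- A s) * Cl / (2 * \<epsilon>)) * (\<integral>\<^sup>+z. indicator J (fst z) *
      (ennreal ((cone_weight N \<sigma> z)\<^sup>2) * ennreal ((norm (u (fst z) (snd z) - v z))\<^sup>2)) \<partial>slab T)"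
  proof -
    have k: "0 \<le> e s * Cl / (2 * \<epsilon>)" using e01 Cl_pos \<epsilon> by (simp add: less_imp_le)
    have b1_nonneg: "0 \<le> b1 z" for z unfolding b1_def by (rule mult_nonneg_nonneg[OF k]) simp
    have pJ: "(\<lambda>z::real\<times>real. indicator J (fst z) * (p z)\<^sup>2) \<in> borel_measurable (slab T)"
      by (rule measurable_slab) measurable
    have "ennreal (integral\<^sup>L (slab T) b1) = (\<integral>\<^sup>+z. ennreal (b1 z) \<partial>slab T)"
      using b1_int b1_nonneg by (intro nn_integral_eq_integral[symmetric] AE_I2)
    also have "\<dots> = (\<integral>\<^sup>+z. ennreal (e s * Cl / (2 * \<epsilon>)) * ennreal (indicator J (fst z) * (p z)\<^sup>2 * (norm (W z))\<^sup>2) \<partial>slab T)"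
      unfolding b1_def using k by (intro nn_integral_cong) (simp add: ennreal_mult del: times_divide_eq_right times_divide_eq_left)
    also have "\<dots> = ennreal (e s * Cl / (2 * \<epsilon>)) * (\<integral>\<^sup>+z. ennreal (indicator J (fst z) * (p z)\<^sup>2 * (norm (W z))\<^sup>2) \<partial>slab T)"
      by (intro nn_integral_cmult measurable_compose[OF _ measurable_ennreal] borel_measurable_times[OF pJ])
         measurable
    also have "(\<integral>\<^sup>+z. ennreal (indicator J (fst z) * (p z)\<^sup>2 * (norm (W z))\<^sup>2) \<partial>slab T) = (\<integral>\<^sup>+z. indicator J (fst z) *
      (ennreal ((cone_weight N \<sigma> z)\<^sup>2) * ennreal ((norm (u (fst z) (snd z) - v z))\<^sup>2)) \<partial>slab T)"
      by (intro nn_integral_cong) (auto simp: W_def p_def indicator_def ennreal_mult)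
    finally show ?thesis by (simp add: e_def)
  qed
  have b2_val: "ennreal (integral\<^sup>L (slab T) b2) \<le> ennreal (1 / 2) * (\<integral>\<^sup>+z. ennreal ((norm (R z))\<^sup>2) * indicator {0<..<s} (fst z) \<partial>slab T)"
  proof -
    have "ennreal (integral\<^sup>L (slab T) b2) = (\<integral>\<^sup>+z. ennreal (b2 z) \<partial>slab T)"
      using b2_int \<phi>01 by (intro nn_integral_eq_integral[symmetric] AE_I2) (auto simp: b2_def)
    also have "\<dots> \<le> (\<integral>\<^sup>+z. ennreal (1 / 2) * (ennreal ((norm (R z))\<^sup>2) * indicator {0<..<s} (fst z)) \<partial>slab T)"
    proof (intro nn_integral_mono)
      fix z assume "z \<in> space (slab T)"
      then have z: "0 < fst z" by auto
      show "ennreal (b2 z) \<le> ennreal (1 / 2) * (ennreal ((norm (R z))\<^sup>2) * indicator {0<..<s} (fst z))"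
      proof (cases "fst z < s")
        case True
        have "b2 z \<le> 1 / 2 * (norm (R z))\<^sup>2"
          unfolding b2_def using mult_right_mono[OF \<phi>01(2)[of z], of "(norm (R z))\<^sup>2"] by simp
        then have "ennreal (b2 z) \<le> ennreal (1 / 2 * (norm (R z))\<^sup>2)" by (rule ennreal_leI)
        also have "\<dots> = ennreal (1 / 2) * ennreal ((norm (R z))\<^sup>2)" by (rule ennreal_mult) auto
        finally show ?thesis using True z by (simp only: indicator_simps greaterThanLessThan_iff mult_1_right simp_thms)
      next
        case False
        then have "\<phi> z = 0" using \<phi>_late[of "fst z" "snd z"] \<epsilon> by (simp add: c_def)
        then show ?thesis by (simp add: b2_def)
      qed
    qed
    also have "\<dots> = ennreal (1 / 2) * (\<integral>\<^sup>+z. ennreal ((norm (R z))\<^sup>2) * indicator {0<..<s} (fst z) \<partial>slab T)"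
      by (rule nn_integral_cmult) (rule measurable_slab, measurable)
    finally show ?thesis .
  qed
  have init_val: "ennreal (LINT x|lborel. rel_eta (u0 x) (v (0, x)) * \<phi> (0, x))
      \<le> ennreal (Cu / 2) * (\<integral>\<^sup>+x. ennreal ((norm (u0 x - v (0, x)))\<^sup>2) \<partial>lborel)"
  proof -
    have "AE x in lborel. 0 \<le> rel_eta (u0 x) (v (0, x)) * \<phi> (0, x)"
      using u0C
    proof eventually_elim
      case (elim x)
      have "0 \<le> rel_eta (u0 x) (v (0, x))" using rel_eta_bounds(1)[OF elim vC, of "(0, x)"] Cl_pos
        by (meson mult_nonneg_nonneg divide_nonneg_pos less_imp_le order_trans zero_le_power2 zero_less_numeral)
      then show ?case using \<phi>01 by simp
    qed
    then have "ennreal (LINT x|lborel. rel_eta (u0 x) (v (0, x)) * \<phi> (0, x))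
        = (\<integral>\<^sup>+x. ennreal (rel_eta (u0 x) (v (0, x)) * \<phi> (0, x)) \<partial>lborel)"
      using E(3) by (intro nn_integral_eq_integral[symmetric])
    also have "\<dots> \<le> (\<integral>\<^sup>+x. ennreal (Cu / 2) * ennreal ((norm (u0 x - v (0, x)))\<^sup>2) \<partial>lborel)"
    proof (rule nn_integral_mono_AE, use u0C in eventually_elim)
      case (elim x)
      have "rel_eta (u0 x) (v (0, x)) * \<phi> (0, x) \<le> Cu / 2 * (norm (u0 x - v (0, x)))\<^sup>2 * 1"
        using rel_eta_bounds(2)[OF elim vC, of "(0, x)"] \<phi>01[of "(0, x)"] Cu_pos by (intro mult_mono) auto
      then have "ennreal (rel_eta (u0 x) (v (0, x)) * \<phi> (0, x)) \<le> ennreal (Cu / 2 * (norm (u0 x - v (0, x)))\<^sup>2)"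
        by (intro ennreal_leI) simp
      also have "\<dots> = ennreal (Cu / 2) * ennreal ((norm (u0 x - v (0, x)))\<^sup>2)"
        using Cu_pos by (intro ennreal_mult) auto
      finally show ?case .
    qed
    also have "\<dots> = ennreal (Cu / 2) * (\<integral>\<^sup>+x. ennreal ((norm (u0 x - v (0, x)))\<^sup>2) \<partial>lborel)"
      by (rule nn_integral_cmult) measurable
    finally show ?thesis .
  qed
  have "ennreal (integral\<^sup>L (slab T) b1) \<le> ennreal (integral\<^sup>L (slab T) b2 + (LINT x|lborel. rel_eta (u0 x) (v (0, x)) * \<phi> (0, x)))"
    using main by (rule ennreal_leI)
  also have "\<dots> \<le> ennreal (integral\<^sup>L (slab T) b2) + ennreal (LINT x|lborel. rel_eta (u0 x) (v (0, x)) * \<phi> (0, x))"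
    by (rule ennreal_plus_le)
  also have "\<dots> \<le> ennreal (1 / 2) * (\<integral>\<^sup>+z. ennreal ((norm (R z))\<^sup>2) * indicator {0<..<s} (fst z) \<partial>slab T)
      + ennreal (Cu / 2) * (\<integral>\<^sup>+x. ennreal ((norm (u0 x - v (0, x)))\<^sup>2) \<partial>lborel)"
    by (intro add_mono b2_val init_val)
  finally show ?thesis unfolding b1_val J_def R_def .
qed

end

section \<open>Weak limits\<close>

text \<open>Nonnegativity preserves inequalities between functions when they are multiplied by the
  test function and integrated.\<close>

definition bump :: "(real \<Rightarrow> real) \<Rightarrow> bool" where
  "bump \<psi> \<longleftrightarrow> (\<exists>L. L-lipschitz_on UNIV \<psi>) \<and> (\<exists>r. \<forall>x. r < \<bar>x\<bar> \<longrightarrow> \<psi> x = 0) \<and> (\<forall>x. 0 \<le> \<psi> x)"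

text \<open>Integrability belongs to the notion: the integral of a non-integrable function is 0 by
  convention, and convergence of such values would say nothing.\<close>

definition weak_limit :: "(nat \<Rightarrow> real \<Rightarrow> 'b::euclidean_space) \<Rightarrow> (real \<Rightarrow> 'b) \<Rightarrow> bool" where
  "weak_limit X h \<longleftrightarrow> (\<forall>\<psi>. bump \<psi> \<longrightarrow>
     (\<forall>k. integrable lborel (\<lambda>x. \<psi> x *\<^sub>R X k x)) \<and> integrable lborel (\<lambda>x. \<psi> x *\<^sub>R h x) \<and>
     (\<lambda>k. LINT x|lborel. \<psi> x *\<^sub>R X k x) \<longlonglongrightarrow> (LINT x|lborel. \<psi> x *\<^sub>R h x))"

lemma bump_lipschitz: "bump \<psi> \<Longrightarrow> \<exists>L. L-lipschitz_on UNIV \<psi>"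
  and bump_nonneg: "bump \<psi> \<Longrightarrow> 0 \<le> \<psi> x"
  by (auto simp: bump_def)

lemma bump_measurable: "bump \<psi> \<Longrightarrow> \<psi> \<in> borel_measurable borel"
  using bump_lipschitz lipschitz_on_continuous_on borel_measurable_continuous_onI by blast

lemma bump_support:
  assumes "bump \<psi>"
  obtains r B where "0 < r" "0 \<le> B" "\<And>x. r < \<bar>x\<bar> \<Longrightarrow> \<psi> x = 0" "\<And>x. \<psi> x \<le> B"
proof -
  from assms obtain L r where L: "L-lipschitz_on UNIV \<psi>" and r: "\<And>x. r < \<bar>x\<bar> \<Longrightarrow> \<psi> x = 0"
    by (auto simp: bump_def)
  have L0: "0 \<le> L" using L by (rule lipschitz_on_nonneg)
  define s where "s = \<bar>r\<bar> + 1"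
  have "\<psi> x \<le> L * (2 * s)" for x
  proof (cases "\<bar>x\<bar> \<le> s")
    case True
    have "\<psi> s = 0" by (rule r) (simp add: s_def)
    then have "\<psi> x \<le> L * dist x s" using lipschitz_onD[OF L, of x s] by (simp add: dist_real_def)
    also have "\<dots> \<le> L * (2 * s)" using True L0 by (intro mult_left_mono) (auto simp: dist_real_def)
    finally show ?thesis .
  next
    case False
    then have "\<psi> x = 0" by (intro r) (simp add: s_def)
    then show ?thesis using L0 by (simp add: s_def)
  qed
  moreover have "\<psi> x = 0" if "s < \<bar>x\<bar>" for x using that by (intro r) (simp add: s_def)
  moreover have "0 < s" "0 \<le> L * (2 * s)" using L0 by (auto simp: s_def)
  ultimately show ?thesis by (rule_tac that)
qed

text \<open>For \<epsilon> \<ge> 0, a trapezoid over [0, \<epsilon>] with sides of slope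
  \<open>Suc n\<close>. These functions decrease to the indicator of the interval as
  \<open>n\<close> grows, so that averages over intervals become limits of integrals against
  bumps.\<close>

definition trap :: "nat \<Rightarrow> real \<Rightarrow> real \<Rightarrow> real" where
  "trap n \<epsilon> y = max 0 (1 - real (Suc n) * max 0 (max (- y) (y - \<epsilon>)))"

lemma trap_bounds: "0 \<le> trap n \<epsilon> y" "trap n \<epsilon> y \<le> 1" "trap n \<epsilon> y \<le> trap 0 \<epsilon> y"
proof -
  show "0 \<le> trap n \<epsilon> y" "trap n \<epsilon> y \<le> 1" by (auto simp: trap_def)
  define m where "m = max 0 (max (- y) (y - \<epsilon>))"
  have "1 * m \<le> real (Suc n) * m" by (intro mult_right_mono) (auto simp: m_def)
  moreover have "trap 0 \<epsilon> y = max 0 (1 - m)" by (simp add: trap_def m_def)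
  moreover have "trap n \<epsilon> y = max 0 (1 - real (Suc n) * m)" by (simp only: trap_def m_def)
  ultimately show "trap n \<epsilon> y \<le> trap 0 \<epsilon> y" by linarith
qed

lemma trap_eq_1: "y \<in> {0..\<epsilon>} \<Longrightarrow> trap n \<epsilon> y = 1"
  by (auto simp: trap_def)

lemma trap_eq_0:
  assumes "y \<notin> {- (1 / Suc n)..\<epsilon> + 1 / Suc n}"
  shows "trap n \<epsilon> y = 0"
proof -
  have "1 / real (Suc n) \<le> max 0 (max (- y) (y - \<epsilon>))" using assms by auto
  then have "1 \<le> real (Suc n) * max 0 (max (- y) (y - \<epsilon>))"
    by (simp add: divide_le_eq mult.commute del: of_nat_Suc)
  then show ?thesis by (simp add: trap_def)
qed

lemma trap_tendsto: "(\<lambda>n. trap n \<epsilon> y) \<longlonglongrightarrow> indicator {0..\<epsilon>} y"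
proof (cases "y \<in> {0..\<epsilon>}")
  case True
  then show ?thesis by (simp add: trap_eq_1)
next
  case False
  then obtain d where d: "d > 0" "y < - d \<or> \<epsilon> + d < y"
  proof (cases "y < 0")
    case True
    then show ?thesis by (intro that[of "- y / 2"]) auto
  next
    case False
    with \<open>y \<notin> {0..\<epsilon>}\<close> have "\<epsilon> < y" by auto
    then show ?thesis by (intro that[of "(y - \<epsilon>) / 2"]) (auto simp: field_simps)
  qed
  obtain N where N: "1 / Suc N < d" using d nat_approx_posE by blast
  have "trap n \<epsilon> y = 0" if "n \<ge> N" for n
  proof (rule trap_eq_0)
    have "1 / real (Suc n) \<le> 1 / real (Suc N)" using that by (intro divide_left_mono) auto
    then show "y \<notin> {- (1 / Suc n)..\<epsilon> + 1 / Suc n}" using d N by auto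
  qed
  then have "eventually (\<lambda>n. trap n \<epsilon> y = 0) sequentially" by (auto simp: eventually_sequentially)
  then show ?thesis using False by (simp add: tendsto_eventually)
qed

lemma bump_trap: "bump (\<lambda>z. trap n \<epsilon> (z - x))"
  unfolding bump_def
proof (intro conjI exI allI impI)
  show "(real (Suc n))-lipschitz_on UNIV (\<lambda>z. trap n \<epsilon> (z - x))"
  proof (rule lipschitz_onI)
    fix y z
    define d where "d = (\<lambda>z. max 0 (max (- (z - x)) (z - x - \<epsilon>)))"
    have "\<bar>real (Suc n) * d y - real (Suc n) * d z\<bar> \<le> real (Suc n) * \<bar>y - z\<bar>"
      unfolding right_diff_distrib[symmetric] abs_mult d_def by (intro mult_mono) auto
    moreover have "\<bar>trap n \<epsilon> (y - x) - trap n \<epsilon> (z - x)\<bar> \<le> \<bar>real (Suc n) * d y - real (Suc n) * d z\<bar>"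
      unfolding trap_def d_def by linarith
    ultimately show "dist (trap n \<epsilon> (y - x)) (trap n \<epsilon> (z - x)) \<le> real (Suc n) * dist y z"
      by (simp add: dist_real_def)
  qed simp
  fix z assume z: "\<bar>x\<bar> + \<bar>\<epsilon>\<bar> + 1 < \<bar>z\<bar>"
  have "1 / real (Suc n) \<le> 1" by simp
  with z have "\<not> (- (1 / real (Suc n)) \<le> z - x \<and> z - x \<le> \<epsilon> + 1 / real (Suc n))" by linarith
  then show "trap n \<epsilon> (z - x) = 0" by (intro trap_eq_0) (simp only: atLeastAtMost_iff not_False_eq_True)
qed (rule trap_bounds)

section \<open>Averages over short intervals and stability under weak limits\<close>

lemma set_integrable_if_bump_integrable:
  fixes h :: "real \<Rightarrow> 'b::euclidean_space"
  assumes [measurable]: "h \<in> borel_measurable borel"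
    and h: "\<And>\<psi>. bump \<psi> \<Longrightarrow> integrable lborel (\<lambda>x. \<psi> x *\<^sub>R h x)"
  shows "set_integrable lborel {a..b} h"
  unfolding set_integrable_def
proof (rule Bochner_Integration.integrable_bound[OF h[OF bump_trap[of 0 "b - a" a]]])
  show "AE x in lborel. norm (indicat_real {a..b} x *\<^sub>R h x) \<le> norm (trap 0 (b - a) (x - a) *\<^sub>R h x)"
    by (intro AE_I2) (auto simp: indicator_def trap_eq_1)
qed measurable

lemma trap_integral_tendsto:
  fixes h :: "real \<Rightarrow> 'b::euclidean_space"
  assumes [measurable]: "h \<in> borel_measurable borel"
    and h: "\<And>\<psi>. bump \<psi> \<Longrightarrow> integrable lborel (\<lambda>x. \<psi> x *\<^sub>R h x)"
  shows "(\<lambda>n. LINT z|lborel. trap n \<epsilon> (z - x) *\<^sub>R h z) \<longlonglongrightarrow> (LINT z|lborel. indicator {x..x + \<epsilon>} z *\<^sub>R h z)"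
proof (rule integral_dominated_convergence)
  have [measurable]: "(\<lambda>z. trap n \<epsilon> (z - x)) \<in> borel_measurable borel" for n
    by (rule bump_measurable[OF bump_trap])
  show "integrable lborel (\<lambda>z. norm (trap 0 \<epsilon> (z - x) *\<^sub>R h z))"
    by (rule integrable_norm[OF h[OF bump_trap]])
  show "(\<lambda>z. trap n \<epsilon> (z - x) *\<^sub>R h z) \<in> borel_measurable lborel" for n by measurable
  show "AE z in lborel. norm (trap n \<epsilon> (z - x) *\<^sub>R h z) \<le> norm (trap 0 \<epsilon> (z - x) *\<^sub>R h z)" for n
    using trap_bounds by (intro AE_I2) (auto intro!: mult_right_mono simp: abs_of_nonneg)
  have "(\<lambda>n. trap n \<epsilon> (z - x)) \<longlonglongrightarrow> indicator {x..x + \<epsilon>} z" for z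
    using trap_tendsto[of \<epsilon> "z - x"] by (simp add: indicator_def algebra_simps)
  then show "AE z in lborel. (\<lambda>n. trap n \<epsilon> (z - x) *\<^sub>R h z) \<longlonglongrightarrow> indicator {x..x + \<epsilon>} z *\<^sub>R h z"
    by (intro AE_I2 tendsto_intros)
qed measurable

text \<open>The averages are forward difference quotients of a primitive, which is differentiable
  almost everywhere; the primitives start at -m for all natural m, so that every point is
  covered.\<close>

lemma interval_average_tendsto:
  fixes h :: "real \<Rightarrow> 'b::euclidean_space"
  assumes h: "\<And>a b. set_integrable lborel {a..b} h"
  shows "AE x in lborel. (\<lambda>n. real (Suc n) *\<^sub>R (LINT z|lborel. indicator {x..x + 1 / Suc n} z *\<^sub>R h z)) \<longlonglongrightarrow> h x"
proof -
  have int: "h integrable_on {a..b}" "integral {a..b} h = (LINT z|lborel. indicator {a..b} z *\<^sub>R h z)" for a b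
    using set_borel_integral_eq_integral[OF h[of a b]] by (auto simp: set_lebesgue_integral_def)
  have "AE x in lborel. \<forall>m::nat. x \<in> {- real m<..<real m} \<longrightarrow>
      ((\<lambda>y. integral {- real m..y} h) has_vector_derivative h x) (at x)"
    unfolding AE_all_countable AE_lborel_iff_negligible
    using negligible_not_derivative_integral[OF int(1)]
    by (auto elim!: negligible_subset)
  then show ?thesis
  proof eventually_elim
    case (elim x)
    obtain m where "\<bar>x\<bar> < real m" using reals_Archimedean2 by blast
    then have m: "x \<in> {- real m<..<real m}" by auto
    have "integral {- real m..x + 1 / Suc n} h - integral {- real m..x} h
        = (LINT z|lborel. indicator {x..x + 1 / Suc n} z *\<^sub>R h z)" for n
      using Henstock_Kurzweil_Integration.integral_combine[of "- real m" x "x + 1 / Suc n" h] m int by (simp add: algebra_simps)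
    then show ?case using has_vector_derivative_difference_quotient[OF elim[rule_format, OF m]] by simp
  qed
qed

text \<open>Fatou's lemma with bounds that may vary along the sequence.\<close>

lemma nn_integral_le_tendsto:
  assumes m: "\<And>n. f n \<in> borel_measurable M"
    and lim: "AE x in M. (\<lambda>n. f n x) \<longlonglongrightarrow> g x"
    and le: "\<And>n. (\<integral>\<^sup>+x. f n x \<partial>M) \<le> B n" and B: "B \<longlonglongrightarrow> b"
  shows "(\<integral>\<^sup>+x. g x \<partial>M) \<le> (b :: ennreal)"
proof -
  have "(\<integral>\<^sup>+x. g x \<partial>M) = (\<integral>\<^sup>+x. liminf (\<lambda>n. f n x) \<partial>M)"
    using lim by (intro nn_integral_cong_AE) (auto elim!: eventually_mono simp: lim_imp_Liminf)
  also have "\<dots> \<le> liminf (\<lambda>n. \<integral>\<^sup>+x. f n x \<partial>M)" by (rule nn_integral_liminf[OF m])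
  also have "\<dots> \<le> liminf B" by (intro Liminf_mono eventually_sequentiallyI le)
  also have "\<dots> = b" using B by (intro lim_imp_Liminf) auto
  finally show ?thesis .
qed

text \<open>A closed convex set is an intersection of half-spaces. An affine inequality survives the
  weak limit, then the passage from trapezoids to an interval; so interval averages of
  \<open>h\<close> stay in \<open>C\<close>, and almost every value of \<open>h\<close> is a limit
  of such averages. It serves to place the initial datum in \<open>C\<close>, which is known for the
  solution only almost everywhere in the slab.\<close>

lemma weak_limit_in_closed_convex:
  fixes h :: "real \<Rightarrow> 'b::euclidean_space"
  assumes C: "closed C" "convex C" and X: "\<And>k. AE x in lborel. X k x \<in> C"
    and w: "weak_limit X h" and [measurable]: "h \<in> borel_measurable borel"
  shows "AE x in lborel. h x \<in> C"
proof -
  have hi: "integrable lborel (\<lambda>x. \<psi> x *\<^sub>R h x)" if "bump \<psi>" for \<psi>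
    using w that by (auto simp: weak_limit_def)
  have avg: "(1 / \<epsilon>) *\<^sub>R (LINT z|lborel. indicator {x..x + \<epsilon>} z *\<^sub>R h z) \<in> C" if \<epsilon>: "0 < \<epsilon>" for x \<epsilon> :: real
  proof (rule ccontr)
    assume "\<not> ?thesis"
    then obtain a b where ab: "a \<bullet> ((1 / \<epsilon>) *\<^sub>R (LINT z|lborel. indicator {x..x + \<epsilon>} z *\<^sub>R h z)) < b"
      "\<And>c. c \<in> C \<Longrightarrow> b < a \<bullet> c"
      using separating_hyperplane_closed_point[OF C(2,1)] by blast
    \<comment> \<open>A nonnegative test function turns the half-space condition on the sequence
      into an inequality between integrals, which passes to the limit.\<close>
    have pos: "b * (LINT z|lborel. \<psi> z) \<le> a \<bullet> (LINT z|lborel. \<psi> z *\<^sub>R h z)" if \<psi>: "bump \<psi>" for \<psi>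
    proof (rule LIMSEQ_le_const)
      show "(\<lambda>k. a \<bullet> (LINT z|lborel. \<psi> z *\<^sub>R X k z)) \<longlonglongrightarrow> a \<bullet> (LINT z|lborel. \<psi> z *\<^sub>R h z)"
        using w \<psi> by (intro tendsto_intros) (auto simp: weak_limit_def)
      have int: "integrable lborel (\<lambda>z. \<psi> z *\<^sub>R X k z)" for k using w \<psi> by (auto simp: weak_limit_def)
      have int\<psi>: "integrable lborel \<psi>"
      proof -
        obtain r B where "0 < r" "0 \<le> B" "\<And>x. r < \<bar>x\<bar> \<Longrightarrow> \<psi> x = 0" "\<And>x. \<psi> x \<le> B"
          using bump_support[OF \<psi>] by blast
        then show ?thesis
          by (intro bounded_compact_support_integrable[of _ B r] bump_measurable[OF \<psi>])
             (auto simp: bump_nonneg[OF \<psi>])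
      qed
      have "b * (LINT z|lborel. \<psi> z) \<le> a \<bullet> (LINT z|lborel. \<psi> z *\<^sub>R X k z)" for k
      proof -
        have "(LINT z|lborel. b * \<psi> z) \<le> (LINT z|lborel. a \<bullet> (\<psi> z *\<^sub>R X k z))"
        proof (rule integral_mono_AE)
          show "AE z in lborel. b * \<psi> z \<le> a \<bullet> (\<psi> z *\<^sub>R X k z)"
            using X[of k]
          proof eventually_elim
            case (elim z)
            then show ?case using mult_right_mono[of b "a \<bullet> X k z" "\<psi> z"] ab(2)[OF elim] bump_nonneg[OF \<psi>, of z]
              by (simp add: mult.commute)
          qed
          show "integrable lborel (\<lambda>z. a \<bullet> (\<psi> z *\<^sub>R X k z))" by (rule integrable_inner_right) (rule int)
        qed (use int\<psi> in simp)
        moreover have "(LINT z|lborel. a \<bullet> (\<psi> z *\<^sub>R X k z)) = a \<bullet> (LINT z|lborel. \<psi> z *\<^sub>R X k z)"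
          by (rule integral_inner_right) (rule int)
        ultimately show ?thesis by simp
      qed
      then show "\<exists>N. \<forall>k\<ge>N. b * (LINT z|lborel. \<psi> z) \<le> a \<bullet> (LINT z|lborel. \<psi> z *\<^sub>R X k z)" by blast
    qed
    have "b * (LINT z|lborel. indicator {x..x + \<epsilon>} z *\<^sub>R (1::real)) \<le> a \<bullet> (LINT z|lborel. indicator {x..x + \<epsilon>} z *\<^sub>R h z)"
    proof (rule LIMSEQ_le)
      show "(\<lambda>n. a \<bullet> (LINT z|lborel. trap n \<epsilon> (z - x) *\<^sub>R h z)) \<longlonglongrightarrow> a \<bullet> (LINT z|lborel. indicator {x..x + \<epsilon>} z *\<^sub>R h z)"
        by (intro tendsto_intros trap_integral_tendsto hi) auto
      show "(\<lambda>n. b * (LINT z|lborel. trap n \<epsilon> (z - x) *\<^sub>R (1::real))) \<longlonglongrightarrow> b * (LINT z|lborel. indicator {x..x + \<epsilon>} z *\<^sub>R (1::real))"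
      proof (intro tendsto_intros trap_integral_tendsto)
        fix \<psi> assume \<psi>: "bump \<psi>"
        obtain r B where "0 < r" "0 \<le> B" "\<And>x. r < \<bar>x\<bar> \<Longrightarrow> \<psi> x = 0" "\<And>x. \<psi> x \<le> B"
          using bump_support[OF \<psi>] by blast
        then show "integrable lborel (\<lambda>x. \<psi> x *\<^sub>R (1::real))"
          by (intro bounded_compact_support_integrable[of _ B r])
             (auto simp: bump_nonneg[OF \<psi>] bump_measurable[OF \<psi>])
      qed auto
      show "\<exists>N. \<forall>n\<ge>N. b * (LINT z|lborel. trap n \<epsilon> (z - x) *\<^sub>R (1::real)) \<le> a \<bullet> (LINT z|lborel. trap n \<epsilon> (z - x) *\<^sub>R h z)"
        using pos[OF bump_trap] by simp
    qed
    then have "b * \<epsilon> \<le> a \<bullet> (LINT z|lborel. indicator {x..x + \<epsilon>} z *\<^sub>R h z)" using \<epsilon> by simp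
    with ab(1) \<epsilon> show False by (simp add: divide_less_eq mult.commute)
  qed
  have "AE x in lborel. (\<lambda>n. real (Suc n) *\<^sub>R (LINT z|lborel. indicator {x..x + 1 / Suc n} z *\<^sub>R h z)) \<longlonglongrightarrow> h x"
    by (intro interval_average_tendsto set_integrable_if_bump_integrable hi) auto
  then show ?thesis
  proof eventually_elim
    case (elim x)
    have "real (Suc n) *\<^sub>R (LINT z|lborel. indicator {x..x + 1 / Suc n} z *\<^sub>R h z) \<in> C" for n
      using avg[of "1 / real (Suc n)" x] by simp
    then show ?case by (rule closed_sequentially[OF C(1) _ elim])
  qed
qed

lemma ennreal_mult_split: "0 \<le> s \<Longrightarrow> 0 \<le> m \<Longrightarrow> ennreal (s * (s * m)) = ennreal s * (ennreal s * ennreal m)"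
  by (simp add: ennreal_mult)

text \<open>Convergence is known against bumps only, not against all of L^2. Integrals against
  translated trapezoids converge pointwise, and their L^2 norm is at most the length of the base of
  the trapezoid times the norm of \<open>X k\<close>. Fatou's lemma is then used three times: as
  \<open>k\<close> grows, as the trapezoid tightens to an interval, and as the interval shrinks to a
  point.\<close>

lemma weak_limit_L2_bound:
  fixes h :: "real \<Rightarrow> 'b::euclidean_space"
  assumes w: "weak_limit X h" and h_meas [measurable]: "h \<in> borel_measurable borel"
    and X_meas [measurable]: "\<And>k. X k \<in> borel_measurable borel"
    and B: "\<And>k. (\<integral>\<^sup>+x. ennreal ((norm (X k x))\<^sup>2) \<partial>lborel) \<le> B"
  shows "(\<integral>\<^sup>+x. ennreal ((norm (h x))\<^sup>2) \<partial>lborel) \<le> B"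
proof -
  have hi: "integrable lborel (\<lambda>x. \<psi> x *\<^sub>R h x)" if "bump \<psi>" for \<psi>
    using w that by (auto simp: weak_limit_def)
  have Xi: "integrable lborel (\<lambda>x. \<psi> x *\<^sub>R X k x)" if "bump \<psi>" for \<psi> k
    using w that by (auto simp: weak_limit_def)
  have trap_meas2 [measurable]: "(\<lambda>(x, z). trap n \<epsilon> (z - x)) \<in> borel_measurable (lborel \<Otimes>\<^sub>M lborel)" for n \<epsilon>
    unfolding trap_def by measurable
  have trap_meas1 [measurable]: "(\<lambda>z. trap n \<epsilon> (z - x)) \<in> borel_measurable borel" for n \<epsilon> x
    by (rule bump_measurable[OF bump_trap])
  define F where "F = (\<lambda>g n \<epsilon> x. LINT z|lborel. trap n \<epsilon> (z - x) *\<^sub>R (g z :: 'b))"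
  have F_meas: "(\<lambda>x. ennreal ((norm (F g n \<epsilon> x))\<^sup>2)) \<in> borel_measurable lborel"
    if [measurable]: "g \<in> borel_measurable borel" for g n \<epsilon>
    unfolding F_def by measurable
  \<comment> \<open>Young's inequality for convolutions: the integral of the kernel in either
    variable is at most the base \<epsilon> + 2/(n+1) of the trapezoid.\<close>
  have smooth: "(\<integral>\<^sup>+x. ennreal ((norm (F (X k) n \<epsilon> x))\<^sup>2) \<partial>lborel) \<le> (ennreal (\<epsilon> + 2 / Suc n))\<^sup>2 * B"
    if \<epsilon>: "0 < \<epsilon>" for k n \<epsilon>
  proof -
    define d where "d = 1 / real (Suc n)"
    have d: "0 < d" by (simp add: d_def)
    define \<theta> where "\<theta> = (\<lambda>x z. ennreal (trap n \<epsilon> (z - x)))"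
    have \<theta>_le: "\<theta> x z \<le> indicator {x - d..x + \<epsilon> + d} z" for x z
      using trap_bounds(2)[of n \<epsilon> "z - x"] trap_eq_0[of "z - x" n \<epsilon>] by (auto simp: \<theta>_def indicator_def d_def)
    have \<theta>_le': "\<theta> x z \<le> indicator {z - \<epsilon> - d..z + d} x" for x z
      using trap_bounds(2)[of n \<epsilon> "z - x"] trap_eq_0[of "z - x" n \<epsilon>] by (auto simp: \<theta>_def indicator_def d_def)
    have \<theta>1: "(\<integral>\<^sup>+z. \<theta> x z \<partial>lborel) \<le> ennreal (\<epsilon> + 2 * d)" for x
    proof -
      have "(\<integral>\<^sup>+z. \<theta> x z \<partial>lborel) \<le> (\<integral>\<^sup>+z. indicator {x - d..x + \<epsilon> + d} z \<partial>lborel)"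
        by (intro nn_integral_mono \<theta>_le)
      also have "\<dots> = ennreal (\<epsilon> + 2 * d)" using \<epsilon> d by (simp add: algebra_simps)
      finally show ?thesis .
    qed
    have \<theta>2: "(\<integral>\<^sup>+x. \<theta> x z \<partial>lborel) \<le> ennreal (\<epsilon> + 2 * d)" for z
    proof -
      have "(\<integral>\<^sup>+x. \<theta> x z \<partial>lborel) \<le> (\<integral>\<^sup>+x. indicator {z - \<epsilon> - d..z + d} x \<partial>lborel)"
        by (intro nn_integral_mono \<theta>_le')
      also have "\<dots> = ennreal (\<epsilon> + 2 * d)" using \<epsilon> d by (simp add: algebra_simps)
      finally show ?thesis .
    qed
    define y where "y = (\<lambda>z. ennreal (norm (X k z)))"
    have [measurable]: "y \<in> borel_measurable borel" unfolding y_def by measurable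
    have [measurable]: "(\<lambda>z. \<theta> x z) \<in> borel_measurable borel" for x unfolding \<theta>_def by measurable
    have \<theta>_meas2 [measurable]: "(\<lambda>(x, z). \<theta> x z) \<in> borel_measurable (lborel \<Otimes>\<^sub>M lborel)"
      using trap_meas2[of n \<epsilon>] unfolding \<theta>_def by measurable
    have pt: "ennreal ((norm (F (X k) n \<epsilon> x))\<^sup>2) \<le> ennreal (\<epsilon> + 2 * d) * (\<integral>\<^sup>+z. \<theta> x z * (y z)\<^sup>2 \<partial>lborel)" for x
    proof -
      have "ennreal (norm (F (X k) n \<epsilon> x)) \<le> (\<integral>\<^sup>+z. ennreal (norm (trap n \<epsilon> (z - x) *\<^sub>R X k z)) \<partial>lborel)"
        unfolding F_def by (rule integral_norm_bound_ennreal[OF Xi[OF bump_trap]])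
      \<comment> \<open>The kernel is split into two square roots, so that Cauchy-Schwarz leaves one
        copy of it with the squared function.\<close>
      also have "\<dots> = (\<integral>\<^sup>+z. ennreal (sqrt (trap n \<epsilon> (z - x))) * (ennreal (sqrt (trap n \<epsilon> (z - x))) * y z) \<partial>lborel)"
      proof (intro nn_integral_cong)
        fix z
        have "norm (trap n \<epsilon> (z - x) *\<^sub>R X k z) = sqrt (trap n \<epsilon> (z - x)) * (sqrt (trap n \<epsilon> (z - x)) * norm (X k z))"
          using trap_bounds(1)[of n \<epsilon> "z - x"] by (simp add: mult.assoc[symmetric])
        then show "ennreal (norm (trap n \<epsilon> (z - x) *\<^sub>R X k z)) =
            ennreal (sqrt (trap n \<epsilon> (z - x))) * (ennreal (sqrt (trap n \<epsilon> (z - x))) * y z)"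
          using trap_bounds(1)[of n \<epsilon> "z - x"] by (simp only: y_def ennreal_mult_split real_sqrt_ge_zero norm_ge_zero)
      qed
      finally have "(ennreal (norm (F (X k) n \<epsilon> x)))\<^sup>2 \<le>
          (\<integral>\<^sup>+z. ennreal (sqrt (trap n \<epsilon> (z - x))) * (ennreal (sqrt (trap n \<epsilon> (z - x))) * y z) \<partial>lborel)\<^sup>2"
        by (rule power_mono) simp
      also have "\<dots> \<le> (\<integral>\<^sup>+z. (ennreal (sqrt (trap n \<epsilon> (z - x))))\<^sup>2 \<partial>lborel) *
          (\<integral>\<^sup>+z. (ennreal (sqrt (trap n \<epsilon> (z - x))) * y z)\<^sup>2 \<partial>lborel)"
        by (rule Cauchy_Schwarz_nn_integral) measurable
      also have "\<dots> = (\<integral>\<^sup>+z. \<theta> x z \<partial>lborel) * (\<integral>\<^sup>+z. \<theta> x z * (y z)\<^sup>2 \<partial>lborel)"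
        using trap_bounds(1) by (simp add: \<theta>_def power_mult_distrib ennreal_power)
      also have "\<dots> \<le> ennreal (\<epsilon> + 2 * d) * (\<integral>\<^sup>+z. \<theta> x z * (y z)\<^sup>2 \<partial>lborel)"
        by (intro mult_right_mono \<theta>1) simp
      finally show ?thesis by (simp add: ennreal_power)
    qed
    have "(\<integral>\<^sup>+x. ennreal ((norm (F (X k) n \<epsilon> x))\<^sup>2) \<partial>lborel)
        \<le> (\<integral>\<^sup>+x. ennreal (\<epsilon> + 2 * d) * (\<integral>\<^sup>+z. \<theta> x z * (y z)\<^sup>2 \<partial>lborel) \<partial>lborel)"
      by (intro nn_integral_mono pt)
    also have "\<dots> = ennreal (\<epsilon> + 2 * d) * (\<integral>\<^sup>+x. (\<integral>\<^sup>+z. \<theta> x z * (y z)\<^sup>2 \<partial>lborel) \<partial>lborel)"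
      by (rule nn_integral_cmult) measurable
    also have "(\<integral>\<^sup>+x. (\<integral>\<^sup>+z. \<theta> x z * (y z)\<^sup>2 \<partial>lborel) \<partial>lborel) = (\<integral>\<^sup>+z. (\<integral>\<^sup>+x. \<theta> x z * (y z)\<^sup>2 \<partial>lborel) \<partial>lborel)"
      by (rule lborel_pair.Fubini'[symmetric]) measurable
    also have "\<dots> = (\<integral>\<^sup>+z. (\<integral>\<^sup>+x. \<theta> x z \<partial>lborel) * (y z)\<^sup>2 \<partial>lborel)"
      by (intro nn_integral_cong nn_integral_multc) (simp add: \<theta>_def trap_def)
    also have "\<dots> \<le> (\<integral>\<^sup>+z. ennreal (\<epsilon> + 2 * d) * (y z)\<^sup>2 \<partial>lborel)"
      by (intro nn_integral_mono mult_right_mono \<theta>2) simp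
    also have "\<dots> = ennreal (\<epsilon> + 2 * d) * (\<integral>\<^sup>+z. (y z)\<^sup>2 \<partial>lborel)"
      by (rule nn_integral_cmult) measurable
    also have "(\<integral>\<^sup>+z. (y z)\<^sup>2 \<partial>lborel) \<le> B"
      using B[of k] by (simp add: y_def ennreal_power)
    finally show ?thesis
      by (simp add: d_def power2_eq_square mult.assoc mult_left_mono)
  qed
  have smooth_h: "(\<integral>\<^sup>+x. ennreal ((norm (F h n \<epsilon> x))\<^sup>2) \<partial>lborel) \<le> (ennreal (\<epsilon> + 2 / Suc n))\<^sup>2 * B"
    if \<epsilon>: "0 < \<epsilon>" for n \<epsilon>
  proof (rule nn_integral_le_tendsto[where f = "\<lambda>k x. ennreal ((norm (F (X k) n \<epsilon> x))\<^sup>2)" and B = "\<lambda>_. (ennreal (\<epsilon> + 2 / Suc n))\<^sup>2 * B"])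
    show "AE x in lborel. (\<lambda>k. ennreal ((norm (F (X k) n \<epsilon> x))\<^sup>2)) \<longlonglongrightarrow> ennreal ((norm (F h n \<epsilon> x))\<^sup>2)"
      unfolding F_def using w bump_trap by (intro AE_I2 tendsto_intros tendsto_ennrealI) (auto simp: weak_limit_def)
  qed (use F_meas X_meas smooth[OF \<epsilon>] in auto)
  define G where "G = (\<lambda>\<epsilon> x. LINT z|lborel. indicator {x..x + \<epsilon>} z *\<^sub>R h z)"
  have G_lim: "(\<lambda>n. F h n \<epsilon> x) \<longlonglongrightarrow> G \<epsilon> x" for \<epsilon> x
    unfolding F_def G_def by (rule trap_integral_tendsto[OF h_meas hi])
  have G_bound: "(\<integral>\<^sup>+x. ennreal ((norm (G \<epsilon> x))\<^sup>2) \<partial>lborel) \<le> (ennreal \<epsilon>)\<^sup>2 * B" if \<epsilon>: "0 < \<epsilon>" for \<epsilon>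
  proof (rule nn_integral_le_tendsto[where f = "\<lambda>n x. ennreal ((norm (F h n \<epsilon> x))\<^sup>2)" and B = "\<lambda>n. (ennreal (\<epsilon> + 2 / Suc n))\<^sup>2 * B"])
    show "AE x in lborel. (\<lambda>n. ennreal ((norm (F h n \<epsilon> x))\<^sup>2)) \<longlonglongrightarrow> ennreal ((norm (G \<epsilon> x))\<^sup>2)"
      by (intro AE_I2 tendsto_intros tendsto_ennrealI G_lim)
    have "(\<lambda>n. 2 / real (Suc n)) \<longlonglongrightarrow> 0"
      using tendsto_mult[OF tendsto_const[of 2] LIMSEQ_inverse_real_of_nat] by (simp add: inverse_eq_divide)
    then have "(\<lambda>n. ennreal ((\<epsilon> + 2 / Suc n)\<^sup>2)) \<longlonglongrightarrow> ennreal ((\<epsilon> + 0)\<^sup>2)"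
      by (intro tendsto_intros tendsto_ennrealI)
    then have "(\<lambda>n. (ennreal (\<epsilon> + 2 / Suc n))\<^sup>2) \<longlonglongrightarrow> (ennreal \<epsilon>)\<^sup>2"
      using \<epsilon> by (subst (1 2) ennreal_power) (auto simp del: of_nat_Suc)
    \<comment> \<open>\<open>B\<close> may be infinite; multiplication is still continuous because
      the other factor is neither 0 nor infinite.\<close>
    moreover have "(ennreal \<epsilon>)\<^sup>2 \<noteq> 0" "(ennreal \<epsilon>)\<^sup>2 \<noteq> \<top>"
      using \<epsilon> by (simp_all add: ennreal_power[of \<epsilon>, OF less_imp_le[OF \<epsilon>]])
    ultimately show "(\<lambda>n. (ennreal (\<epsilon> + 2 / Suc n))\<^sup>2 * B) \<longlonglongrightarrow> (ennreal \<epsilon>)\<^sup>2 * B"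
      by (intro tendsto_mult_ennreal tendsto_const) (auto simp: ennreal_power)
  qed (use F_meas h_meas smooth_h[OF \<epsilon>] in auto)
  have G_meas: "G \<epsilon> \<in> borel_measurable lborel" for \<epsilon>
  proof (rule borel_measurable_LIMSEQ_metric)
    show "(\<lambda>x. F h n \<epsilon> x) \<in> borel_measurable lborel" for n unfolding F_def by measurable
  qed (rule G_lim)
  have [measurable]: "G \<epsilon> \<in> borel_measurable borel" for \<epsilon>
    using G_meas[of \<epsilon>] by simp
  have avg: "AE x in lborel. (\<lambda>n. real (Suc n) *\<^sub>R (LINT z|lborel. indicator {x..x + 1 / Suc n} z *\<^sub>R h z)) \<longlonglongrightarrow> h x"
    by (intro interval_average_tendsto set_integrable_if_bump_integrable[OF h_meas hi])
  show ?thesis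
  proof (rule nn_integral_le_tendsto[where f = "\<lambda>n x. ennreal ((norm (real (Suc n) *\<^sub>R G (1 / Suc n) x))\<^sup>2)" and B = "\<lambda>_. B"])
    show "AE x in lborel. (\<lambda>n. ennreal ((norm (real (Suc n) *\<^sub>R G (1 / Suc n) x))\<^sup>2)) \<longlonglongrightarrow> ennreal ((norm (h x))\<^sup>2)"
      using avg by eventually_elim (unfold G_def, intro tendsto_intros tendsto_ennrealI)
    show "(\<lambda>x. ennreal ((norm (real (Suc n) *\<^sub>R G (1 / Suc n) x))\<^sup>2)) \<in> borel_measurable lborel" for n
      by measurable
    fix n
    define m where "m = real (Suc n)"
    have m: "0 < m" by (simp add: m_def)
    have "(\<integral>\<^sup>+x. ennreal ((norm (m *\<^sub>R G (1 / m) x))\<^sup>2) \<partial>lborel)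
        = (\<integral>\<^sup>+x. ennreal (m\<^sup>2) * ennreal ((norm (G (1 / m) x))\<^sup>2) \<partial>lborel)"
      using m by (intro nn_integral_cong) (simp add: power_mult_distrib ennreal_mult)
    also have "\<dots> = ennreal (m\<^sup>2) * (\<integral>\<^sup>+x. ennreal ((norm (G (1 / m) x))\<^sup>2) \<partial>lborel)"
      by (intro nn_integral_cmult) measurable
    also have "\<dots> \<le> ennreal (m\<^sup>2) * ((ennreal (1 / m))\<^sup>2 * B)"
      using G_bound[of "1 / m"] m by (intro mult_left_mono) auto
    also have "\<dots> = ennreal (m\<^sup>2 * (1 / m)\<^sup>2) * B"
      using m by (simp add: ennreal_power ennreal_mult mult.assoc)
    also have "\<dots> = B" using m by (simp add: power_one_over)
    finally show "(\<integral>\<^sup>+x. ennreal ((norm (real (Suc n) *\<^sub>R G (1 / Suc n) x))\<^sup>2) \<partial>lborel) \<le> B"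
      by (simp add: m_def)
  qed simp
qed

section \<open>Stability for a fixed parameter\<close>

lemma lipschitz_derivative_le:
  fixes F :: "real \<Rightarrow> real"
  assumes F: "L-lipschitz_on UNIV F" and d: "(F has_real_derivative d) (at x)"
  shows "\<bar>d\<bar> \<le> L"
proof (rule LIMSEQ_le_const2)
  show "(\<lambda>n. \<bar>real (Suc n) *\<^sub>R (F (x + 1 / Suc n) - F x)\<bar>) \<longlonglongrightarrow> \<bar>d\<bar>"
    using has_vector_derivative_difference_quotient[of F d x] d
    by (intro tendsto_rabs) (simp add: has_real_derivative_iff_has_vector_derivative)
  have "\<bar>real (Suc n) *\<^sub>R (F (x + 1 / Suc n) - F x)\<bar> \<le> L" for n
  proof -
    have "\<bar>F (x + 1 / Suc n) - F x\<bar> \<le> L * (1 / Suc n)"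
      using lipschitz_onD[OF F, of "x + 1 / Suc n" x] by (simp add: dist_real_def)
    then show ?thesis by (simp add: abs_mult pos_le_divide_eq mult.commute del: of_nat_Suc)
  qed
  then show "\<exists>N. \<forall>n\<ge>N. \<bar>real (Suc n) *\<^sub>R (F (x + 1 / Suc n) - F x)\<bar> \<le> L" by blast
qed

lemma weak_limit_diff:
  assumes "weak_limit X h" "weak_limit Y g"
  shows "weak_limit (\<lambda>k x. X k x - Y k x) (\<lambda>x. h x - g x)"
  using assms unfolding weak_limit_def
  by (auto simp: scaleR_diff_right intro!: tendsto_diff)

lemma bump_scaleR_integrable:
  fixes g :: "real \<Rightarrow> 'b::euclidean_space"
  assumes \<psi>: "bump \<psi>" and g: "continuous_on UNIV g"
  shows "integrable lborel (\<lambda>x. \<psi> x *\<^sub>R g x)"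
proof -
  obtain r B where r: "0 < r" "0 \<le> B" "\<And>x. r < \<bar>x\<bar> \<Longrightarrow> \<psi> x = 0" "\<And>x. \<psi> x \<le> B"
    by (rule bump_support[OF \<psi>]) (rule that)
  have "bounded (g ` {- r..r})"
    by (intro compact_imp_bounded compact_continuous_image continuous_on_subset[OF g]) auto
  then obtain K where K: "\<And>x. x \<in> {- r..r} \<Longrightarrow> norm (g x) \<le> K"
    unfolding bounded_iff by blast
  have [measurable]: "\<psi> \<in> borel_measurable borel" "g \<in> borel_measurable borel"
    using bump_measurable[OF \<psi>] borel_measurable_continuous_onI[OF g] by auto
  have "norm (\<psi> x *\<^sub>R g x) \<le> B * \<bar>K\<bar>" for x
  proof (cases "\<bar>x\<bar> \<le> r")
    case True
    then have "x \<in> {- r..r}" by (simp add: abs_le_iff)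
    then have "norm (g x) \<le> \<bar>K\<bar>" using K abs_ge_self order_trans by blast
    then show ?thesis using r(2) r(4)[of x] bump_nonneg[OF \<psi>, of x] by (auto intro!: mult_mono)
  qed (use r in auto)
  then show ?thesis by (rule bounded_compact_support_integrable[rotated]) (use r in auto)
qed

lemma weak_limit_lipschitz:
  fixes v :: "real \<times> real \<Rightarrow> 'b::euclidean_space"
  assumes v: "L-lipschitz_on UNIV v" and t: "\<tau> \<longlonglongrightarrow> s"
  shows "weak_limit (\<lambda>k x. v (\<tau> k, x)) (\<lambda>x. v (s, x))"
  unfolding weak_limit_def
proof (intro allI impI conjI)
  fix \<psi> assume \<psi>: "bump \<psi>"
  have cont: "continuous_on UNIV (\<lambda>x. v (t, x))" for t
    using lipschitz_slice(2)[OF v] by (rule lipschitz_on_continuous_on)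
  have int: "integrable lborel (\<lambda>x. \<psi> x *\<^sub>R v (t, x))" for t by (rule bump_scaleR_integrable[OF \<psi> cont])
  show "integrable lborel (\<lambda>x. \<psi> x *\<^sub>R v (\<tau> k, x))" "integrable lborel (\<lambda>x. \<psi> x *\<^sub>R v (s, x))" for k
    by (rule int)+
  have int1: "integrable lborel (\<lambda>x. \<psi> x *\<^sub>R (1::real))" by (rule bump_scaleR_integrable[OF \<psi>]) simp
  define J where "J = (LINT x|lborel. \<psi> x *\<^sub>R (1::real))"
  show "(\<lambda>k. LINT x|lborel. \<psi> x *\<^sub>R v (\<tau> k, x)) \<longlonglongrightarrow> (LINT x|lborel. \<psi> x *\<^sub>R v (s, x))"
  proof (rule LIM_zero_cancel, rule Lim_null_comparison)
    show "\<forall>\<^sub>F k in sequentially. norm ((LINT x|lborel. \<psi> x *\<^sub>R v (\<tau> k, x)) - (LINT x|lborel. \<psi> x *\<^sub>R v (s, x)))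
        \<le> L * \<bar>\<tau> k - s\<bar> * J"
    proof (intro always_eventually allI)
      fix k
      have "norm ((LINT x|lborel. \<psi> x *\<^sub>R v (\<tau> k, x)) - (LINT x|lborel. \<psi> x *\<^sub>R v (s, x)))
          = norm (LINT x|lborel. \<psi> x *\<^sub>R v (\<tau> k, x) - \<psi> x *\<^sub>R v (s, x))"
        using int by simp
      also have "\<dots> \<le> (LINT x|lborel. L * \<bar>\<tau> k - s\<bar> * (\<psi> x *\<^sub>R 1))"
      proof (rule Bochner_Integration.integral_norm_bound_integral)
        fix x
        have "norm (v (\<tau> k, x) - v (s, x)) \<le> L * \<bar>\<tau> k - s\<bar>"
          using lipschitz_onD[OF lipschitz_slice(1)[OF v], of "\<tau> k" s x] by (simp add: dist_norm)
        then have "\<psi> x * norm (v (\<tau> k, x) - v (s, x)) \<le> \<psi> x * (L * \<bar>\<tau> k - s\<bar>)"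
          using bump_nonneg[OF \<psi>] by (rule mult_left_mono)
        then show "norm (\<psi> x *\<^sub>R v (\<tau> k, x) - \<psi> x *\<^sub>R v (s, x)) \<le> L * \<bar>\<tau> k - s\<bar> * (\<psi> x *\<^sub>R 1)"
          using bump_nonneg[OF \<psi>, of x] by (simp add: scaleR_diff_right[symmetric] mult.commute)
      qed (use int int1 in auto)
      also have "\<dots> = L * \<bar>\<tau> k - s\<bar> * J" unfolding J_def by simp
      finally show "norm ((LINT x|lborel. \<psi> x *\<^sub>R v (\<tau> k, x)) - (LINT x|lborel. \<psi> x *\<^sub>R v (s, x)))
        \<le> L * \<bar>\<tau> k - s\<bar> * J" .
    qed
    have "(\<lambda>k. L * \<bar>\<tau> k - s\<bar> * J) \<longlonglongrightarrow> L * \<bar>s - s\<bar> * J" by (intro tendsto_intros t)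
    then show "(\<lambda>k. L * \<bar>\<tau> k - s\<bar> * J) \<longlonglongrightarrow> 0" by simp
  qed
qed

lemma weakly_continuous_bump:
  assumes "weakly_continuous_in_time T u" "bump \<psi>"
  shows "t \<in> {0..T} \<Longrightarrow> integrable lborel (\<lambda>x. \<psi> x *\<^sub>R u t x)"
    "continuous_on {0..T} (\<lambda>t. LINT x|lborel. \<psi> x *\<^sub>R u t x)"
  using assms unfolding weakly_continuous_in_time_def bump_def by blast+

lemma weak_limit_in_time:
  assumes u: "weakly_continuous_in_time T u" and t: "\<And>k. \<tau> k \<in> {0..T}" "s \<in> {0..T}" "\<tau> \<longlonglongrightarrow> s"
  shows "weak_limit (\<lambda>k. u (\<tau> k)) (u s)"
  unfolding weak_limit_def
proof (intro allI impI conjI)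
  fix \<psi> assume \<psi>: "bump \<psi>"
  show "integrable lborel (\<lambda>x. \<psi> x *\<^sub>R u (\<tau> k) x)" for k using weakly_continuous_bump(1)[OF u \<psi> t(1)] .
  show "integrable lborel (\<lambda>x. \<psi> x *\<^sub>R u s x)" using weakly_continuous_bump(1)[OF u \<psi> t(2)] .
  show "(\<lambda>k. LINT x|lborel. \<psi> x *\<^sub>R u (\<tau> k) x) \<longlonglongrightarrow> (LINT x|lborel. \<psi> x *\<^sub>R u s x)"
    by (rule continuous_on_tendsto_compose[OF weakly_continuous_bump(2)[OF u \<psi>] t(3,2)])
       (use t(1) in auto)
qed

lemma AE_slab_sections:
  assumes "AE z in slab T. P z"
  shows "AE t in lborel. t \<in> {0<..<T} \<longrightarrow> (AE x in lborel. P (t, x))"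
proof -
  have "AE z in lborel \<Otimes>\<^sub>M lborel. fst z \<in> {0<..<T} \<longrightarrow> P z"
    using assms unfolding AE_slab_iff lborel_prod .
  from lborel_pair.AE_pair[OF this] show ?thesis
    by eventually_elim (auto elim: eventually_mono)
qed

lemma AE_Ex_in_interval:
  assumes "AE t in lborel. P t" "(a::real) < b"
  shows "\<exists>t\<in>{a<..<b}. P t"
proof (rule ccontr)
  assume *: "\<not> ?thesis"
  have "negligible {t. \<not> P t}" using assms(1) by (simp add: AE_lborel_iff_negligible)
  then have "negligible {a<..<b}" by (rule negligible_subset) (use * in auto)
  moreover have "\<not> negligible {a<..<b}"
    using assms(2) by (intro open_not_negligible) auto
  ultimately show False by simp
qed

section \<open>The initial datum and the bound at an exact time\<close>

context relative_entropy
begin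

text \<open>The datum \<open>u0\<close> enters through the weak formulation, the value
  \<open>u 0\<close> through weak continuity. Testing with \<open>\<psi>\<close> times a ramp over
  (0, \<epsilon>) gives the mean over these times of the integral of \<open>u\<close> against
  \<open>\<psi>\<close>, up to a flux term of order \<epsilon>; as \<epsilon> tends to 0 the two
  values are identified.\<close>

lemma initial_value:
  assumes T: "0 < T" and sol: "weak_solution T U f u0 u"
    and wc: "weakly_continuous_in_time T u"
    and u_meas [measurable]: "(\<lambda>(t, x). u t x) \<in> borel_measurable (slab T)"
    and uC: "AE (t, x) in slab T. u t x \<in> C" and \<psi>: "bump \<psi>"
  shows "integrable lborel (\<lambda>x. \<psi> x *\<^sub>R u0 x)"
    "(LINT x|lborel. \<psi> x *\<^sub>R u0 x) = (LINT x|lborel. \<psi> x *\<^sub>R u 0 x)"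
proof -
  obtain r B where r: "0 < r" "0 \<le> B" "\<And>x. r < \<bar>x\<bar> \<Longrightarrow> \<psi> x = 0" "\<And>x. \<psi> x \<le> B"
    by (rule bump_support[OF \<psi>]) (rule that)
  obtain L where L: "L-lipschitz_on UNIV \<psi>" using bump_lipschitz[OF \<psi>] by blast
  have L0: "0 \<le> L" using L by (rule lipschitz_on_nonneg)
  have \<psi>0: "0 \<le> \<psi> x" for x by (rule bump_nonneg[OF \<psi>])
  have [measurable]: "\<psi> \<in> borel_measurable borel" by (rule bump_measurable[OF \<psi>])
  obtain Bu where Bu: "\<And>w. w \<in> C \<Longrightarrow> norm w \<le> Bu"
    using compact_imp_bounded[OF compact_C] unfolding bounded_iff by blast
  have "bounded (f ` C)"
    using C2_on_continuous(1)[OF C2_f] C_sub_U compact_C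
    by (meson compact_continuous_image compact_imp_bounded continuous_on_subset)
  then obtain Bf' where "\<And>w. w \<in> C \<Longrightarrow> norm (f w) \<le> Bf'" unfolding bounded_iff by auto
  then have Bf: "norm (f w) \<le> \<bar>Bf'\<bar>" if "w \<in> C" for w using that by (meson abs_ge_self order_trans)
  define m where "m = (\<lambda>t. LINT x|lborel. \<psi> x *\<^sub>R u t x)"
  define I0 where "I0 = (LINT x|lborel. \<psi> x *\<^sub>R u0 x)"
  obtain \<psi>' where "\<psi>' \<in> borel_measurable borel"
    and "AE x in lborel. (\<psi> has_real_derivative \<psi>' x) (at x)"
    and "\<And>a b. a \<le> b \<Longrightarrow> (\<psi>' has_integral (\<psi> b - \<psi> a)) {a..b}"
    by (rule lipschitz_real_ex_derivative[OF L]) (rule that)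
  from this(2) have D': "AE x in lborel. \<exists>d. \<bar>d\<bar> \<le> L \<and> (\<psi> has_real_derivative d) (at x)"
    by eventually_elim (use lipschitz_derivative_le[OF L] in blast)
  \<comment> \<open>\<open>\<delta>\<close> measures the oscillation of \<open>m\<close> near time
    0. The second summand bounds the flux: duration \<epsilon>, width 2r, slope \<open>L\<close> of
    \<open>\<psi>\<close>, and \<open>\<bar>Bf'\<bar>\<close> for the size of the flux.\<close>
  have main: "integrable lborel (\<lambda>x. \<psi> x *\<^sub>R u0 x) \<and> norm (m 0 - I0) \<le> \<delta> + \<epsilon> * (2 * r * (L * \<bar>Bf'\<bar>))"
    if \<epsilon>: "0 < \<epsilon>" "\<epsilon> < T" and \<delta>: "\<And>t. 0 < t \<Longrightarrow> t < \<epsilon> \<Longrightarrow> norm (m t - m 0) \<le> \<delta>" for \<epsilon> \<delta>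
  proof -
    define \<phi> where "\<phi> = (\<lambda>z. ramp \<epsilon> \<epsilon> (fst z) * \<psi> (snd z))"
    note lip1 = lipschitz_on_coordinate(1)[OF ramp_lipschitz[OF \<epsilon>(1), of \<epsilon>]]
    note lip2 = lipschitz_on_coordinate(2)[OF L]
    have "norm (ramp \<epsilon> \<epsilon> t) \<le> 1" "norm (\<psi> x) \<le> B" for t x
      using ramp_simps[OF \<epsilon>(1)] \<psi>0 r(4) by (auto simp: abs_of_nonneg)
    then obtain L\<phi> where L\<phi>: "L\<phi>-lipschitz_on UNIV \<phi>"
      using bounded_bilinear.lipschitz_on_prod[OF bounded_bilinear_mult lip1 lip2, of 1 B] unfolding \<phi>_def by blast
    have test: "test_function T \<phi>"
    proof (rule test_functionI[OF L\<phi> \<epsilon>(2)])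
      show "\<phi> (t, x) = 0" if "\<epsilon> \<le> t" for t x using ramp_simps(3)[OF \<epsilon>(1) that] by (simp add: \<phi>_def)
      show "\<phi> (t, x) = 0" if "r + 1 \<le> \<bar>x\<bar>" for t x using r(3)[of x] that by (simp add: \<phi>_def)
    qed
    have \<phi>00: "\<phi> (0, x) = \<psi> x" for x using \<epsilon> by (simp add: \<phi>_def ramp_def)
    define g where "g = (\<lambda>(t, x). dt_test \<phi> (t, x) *\<^sub>R u t x + dx_test \<phi> (t, x) *\<^sub>R f (u t x))"
    have g: "integrable (slab T) g" "integrable lborel (\<lambda>x. \<psi> x *\<^sub>R u0 x)" "integral\<^sup>L (slab T) g + I0 = 0"
      using sol test unfolding weak_solution_def Let_def g_def I0_def by (auto simp: \<phi>00)
    define J where "J = {0<..<\<epsilon>}"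
    have [measurable]: "J \<in> sets borel" by (simp add: J_def)
    have [measurable]: "(\<lambda>z::real \<times> real. indicator J (fst z) :: real) \<in> borel_measurable (slab T)"
      by (rule measurable_slab, rule measurable_compose[OF borel_measurable_fst]) measurable
    have [measurable]: "(\<lambda>z::real \<times> real. \<psi> (snd z)) \<in> borel_measurable (slab T)"
      by (rule measurable_slab, rule borel_measurable_continuous_onI, rule lipschitz_on_continuous_on[OF lip2])
    have u_meas' [measurable]: "(\<lambda>z. u (fst z) (snd z)) \<in> borel_measurable (slab T)"
      using u_meas by (simp add: split_beta')
    define g1 where "g1 = (\<lambda>z. (indicator J (fst z) * \<psi> (snd z) / \<epsilon>) *\<^sub>R u (fst z) (snd z))"
    have g1_meas: "g1 \<in> borel_measurable (slab T)" unfolding g1_def by measurable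
    have bd: "integrable (slab T) (\<lambda>z. indicator {0..\<epsilon>} (fst z) * indicator {- r..r} (snd z) * (c::real))"
      "(LINT z|slab T. indicator {0..\<epsilon>} (fst z) * indicator {- r..r} (snd z) * c) = \<epsilon> * (2 * r * c)" for c
    proof -
      have eq: "indicator {0..\<epsilon>} (fst z) * indicator {- r..r} (snd z) * c = indicator (cbox (0, - r) (\<epsilon>, r)) z * c" for z :: "real \<times> real"
        by (cases z) (auto simp: indicator_def cbox_Pair_eq)
      have i: "integrable lborel (\<lambda>z::real\<times>real. indicator (cbox (0, - r) (\<epsilon>, r)) z * c)"
        by (intro integrable_mult_left integrable_real_indicator) (auto simp: emeasure_lborel_cbox_eq)
      show "integrable (slab T) (\<lambda>z. indicator {0..\<epsilon>} (fst z) * indicator {- r..r} (snd z) * c)"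
        unfolding eq slab_def by (subst integrable_restrict_space)
          (auto simp: borel_Times simp del: real_scaleR_def intro!: integrable_mult_indicator i)
      have "(LINT z|slab T. indicator (cbox (0, - r) (\<epsilon>, r)) z * c) = (LINT z|lborel. indicator (cbox (0, - r) (\<epsilon>, r)) z * c)"
        unfolding slab_def
      proof (subst integral_restrict_space)
        show "(LINT z|lborel. indicator ({0<..<T} \<times> UNIV) z *\<^sub>R (indicator (cbox (0, - r) (\<epsilon>, r)) z * c))
          = (LINT z|lborel. indicator (cbox (0, - r) (\<epsilon>, r)) z * c)"
        proof (rule integral_cong_AE)
          have "AE z::real\<times>real in lborel. fst z \<noteq> 0"
            by (rule AE_lborel_coordinate(1)[OF AE_lborel_singleton])
          then show "AE z in lborel. indicator ({0<..<T} \<times> UNIV) z *\<^sub>R (indicator (cbox (0, - r) (\<epsilon>, r)) z * c)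
            = indicator (cbox (0, - r) (\<epsilon>, r)) z * c"
            by eventually_elim (use \<epsilon> in \<open>auto simp: indicator_def cbox_Pair_eq\<close>)
        qed (auto intro!: borel_measurable_times borel_measurable_scaleR borel_measurable_indicator simp: borel_Times)
      qed (auto simp: borel_Times)
      also have "\<dots> = \<epsilon> * (2 * r * c)"
        using \<epsilon> r(1) by (simp add: measure_lborel_cbox_eq Basis_prod_def prod.union_disjoint inner_Basis)
      finally show "(LINT z|slab T. indicator {0..\<epsilon>} (fst z) * indicator {- r..r} (snd z) * c) = \<epsilon> * (2 * r * c)"
        unfolding eq .
    qed
    have g1_int: "integrable (slab T) g1"
    proof (rule Bochner_Integration.integrable_bound[OF bd(1)[of "B / \<epsilon> * \<bar>Bu\<bar>"] g1_meas])
      show "AE z in slab T. norm (g1 z) \<le> norm (indicator {0..\<epsilon>} (fst z) * indicator {- r..r} (snd z) * (B / \<epsilon> * \<bar>Bu\<bar>))"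
        using uC
      proof eventually_elim
        case (elim z)
        have "\<psi> (snd z) / \<epsilon> * norm (u (fst z) (snd z)) \<le> B / \<epsilon> * \<bar>Bu\<bar>"
          using Bu[of "u (fst z) (snd z)"] elim r(2,4) \<psi>0 \<epsilon> by (intro mult_mono divide_right_mono) (auto simp: split_beta)
        moreover have "\<psi> (snd z) = 0" if "\<not> (- r \<le> snd z \<and> snd z \<le> r)" using that by (intro r(3)) auto
        ultimately show ?case using \<epsilon> \<psi>0[of "snd z"] r(2)
          by (auto simp: g1_def J_def indicator_def abs_mult)
      qed
    qed
    \<comment> \<open>The part of \<open>g\<close> with the time derivative is \<open>- g1\<close>
      almost everywhere, so only the flux term contributes to the difference.\<close>
    have g_close: "norm (integral\<^sup>L (slab T) g - integral\<^sup>L (slab T) (\<lambda>z. - g1 z)) \<le> \<epsilon> * (2 * r * (L * \<bar>Bf'\<bar>))"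
    proof -
      have int_d: "integrable (slab T) (\<lambda>z. g z - - g1 z)" using g(1) g1_int by auto
      have "AE t in lborel. t \<noteq> 0 \<and> t \<noteq> \<epsilon>"
        using AE_lborel_singleton[of 0] AE_lborel_singleton[of \<epsilon>] by eventually_elim auto
      from AE_slab_fst[OF this, of T] have t: "AE z in slab T. fst z \<noteq> 0 \<and> fst z \<noteq> \<epsilon>" .
      have "AE z::real\<times>real in lborel. \<exists>d. \<bar>d\<bar> \<le> L \<and> (\<psi> has_real_derivative d) (at (snd z))"
        by (rule AE_lborel_coordinate(2)[OF D'])
      then have x: "AE z in slab T. \<exists>d. \<bar>d\<bar> \<le> L \<and> (\<psi> has_real_derivative d) (at (snd z))"
        unfolding AE_slab_iff by eventually_elim auto
      have "AE z in slab T. norm (g z - - g1 z) \<le> indicator {0..\<epsilon>} (fst z) * indicator {- r..r} (snd z) * (L * \<bar>Bf'\<bar>)"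
        using t x uC AE_space[of "slab T"]
      proof (eventually_elim, clarsimp)
        fix t y d assume t: "t \<noteq> \<epsilon>" "0 < t" "t < T" and uC: "u t y \<in> C" and d: "\<bar>d\<bar> \<le> L" "(\<psi> has_real_derivative d) (at y)"
        have "((\<lambda>s. \<phi> (s, y)) has_real_derivative - (indicator J t / \<epsilon>) * \<psi> y) (at t)"
          unfolding \<phi>_def using DERIV_cmult_right[OF ramp_derivative[OF \<epsilon>(1), of t \<epsilon>], of "\<psi> y"] t
          by (simp add: J_def)
        then have dt: "dt_test \<phi> (t, y) = - (indicator J t * \<psi> y / \<epsilon>)"
          unfolding dt_test_def prod.case by (subst DERIV_imp_deriv) auto
        have "((\<lambda>z. \<phi> (t, z)) has_real_derivative ramp \<epsilon> \<epsilon> t * d) (at y)"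
          unfolding \<phi>_def using DERIV_cmult[OF d(2), of "ramp \<epsilon> \<epsilon> t"] by simp
        then have dx: "dx_test \<phi> (t, y) = ramp \<epsilon> \<epsilon> t * d"
          unfolding dx_test_def prod.case by (rule DERIV_imp_deriv)
        have eq: "g (t, y) + g1 (t, y) = (ramp \<epsilon> \<epsilon> t * d) *\<^sub>R f (u t y)"
          by (simp add: g_def g1_def dt dx)
        show "norm (g (t, y) + g1 (t, y)) \<le> indicator {0..\<epsilon>} t * indicator {- r..r} y * (L * \<bar>Bf'\<bar>)"
        proof (cases "t \<le> \<epsilon> \<and> \<bar>y\<bar> \<le> r")
          case True
          have "\<bar>ramp \<epsilon> \<epsilon> t\<bar> * \<bar>d\<bar> \<le> 1 * L" using ramp_simps[OF \<epsilon>(1), of \<epsilon> t] d L0 by (intro mult_mono) auto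
          then have "norm ((ramp \<epsilon> \<epsilon> t * d) *\<^sub>R f (u t y)) \<le> L * \<bar>Bf'\<bar>"
            using Bf[OF uC] L0 by (auto simp: abs_mult intro!: mult_mono)
          then show ?thesis unfolding eq using True t by (auto simp: indicator_def)
        next
          case False
          \<comment> \<open>Outside the rectangle either \<open>\<psi>\<close> vanishes on a
            neighbourhood, so its derivative \<open>d\<close> is 0, or the ramp has already reached
            0.\<close>
          have "ramp \<epsilon> \<epsilon> t * d = 0"
          proof (cases "t \<le> \<epsilon>")
            case True
            then have y: "r < \<bar>y\<bar>" using False by simp
            have "((\<lambda>_. 0) has_real_derivative 0) (at y)" by simp
            then have "(\<psi> has_real_derivative 0) (at y)"
              by (rule has_field_derivative_transform_within_open[where S = "{y. r < \<bar>y\<bar>}"])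
                 (use y r(3) in \<open>auto intro!: open_Collect_less continuous_intros\<close>)
            then show ?thesis using DERIV_unique[OF d(2)] by simp
          qed (use ramp_simps(3)[OF \<epsilon>(1)] in simp)
          then have "norm (g (t, y) + g1 (t, y)) = 0" unfolding eq by (simp only: scaleR_zero_left norm_zero)
          then show ?thesis using L0 by simp
        qed
      qed
      then have "norm (integral\<^sup>L (slab T) (\<lambda>z. g z - - g1 z)) \<le> \<epsilon> * (2 * r * (L * \<bar>Bf'\<bar>))"
        unfolding bd(2)[symmetric]
        by (intro order_trans[OF integral_norm_bound] integral_mono_AE integrable_norm int_d bd(1))
      then show ?thesis using g(1) g1_int by simp
    qed
    \<comment> \<open>By Fubini this integral is the mean of \<open>m\<close> over (0, \<epsilon>),
      hence within \<open>\<delta>\<close> of \<open>m 0\<close>.\<close>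
    have g1_val: "norm (integral\<^sup>L (slab T) g1 - m 0) \<le> \<delta>"
    proof -
      define h where "h = (\<lambda>z. indicator ({0<..<T} \<times> UNIV) z *\<^sub>R g1 z)"
      have h: "integrable (lborel \<Otimes>\<^sub>M lborel) h"
        unfolding lborel_prod h_def using g1_int unfolding slab_def
        by (subst (asm) integrable_restrict_space) (auto simp: borel_Times)
      have inner: "(LINT x|lborel. h (t, x)) = (indicator J t / \<epsilon>) *\<^sub>R m t" for t
      proof (cases "t \<in> J")
        case True
        then have eq: "h (t, x) = (1 / \<epsilon>) *\<^sub>R (\<psi> x *\<^sub>R u t x)" for x
          using \<epsilon> by (simp add: h_def g1_def J_def indicator_def)
        have "(LINT x|lborel. h (t, x)) = (1 / \<epsilon>) *\<^sub>R m t"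
          unfolding eq m_def by (rule integral_scaleR_right)
        then show ?thesis using True by simp
      qed (simp add: h_def g1_def)
      have "integral\<^sup>L (slab T) g1 = integral\<^sup>L (lborel \<Otimes>\<^sub>M lborel) h"
        unfolding slab_def lborel_prod h_def by (subst integral_restrict_space) (auto simp: borel_Times)
      also have "\<dots> = (LINT t|lborel. LINT x|lborel. h (t, x))"
        using lborel_pair.integral_fst'[OF h] by simp
      finally have val: "integral\<^sup>L (slab T) g1 = (LINT t|lborel. (indicator J t / \<epsilon>) *\<^sub>R m t)"
        unfolding inner .
      have int_m: "integrable lborel (\<lambda>t. (indicator J t / \<epsilon>) *\<^sub>R m t)"
        using lborel_pair.integrable_fst'[OF h] unfolding inner .
      have J1: "integrable lborel (\<lambda>t. indicator J t / \<epsilon>)" "(LINT t|lborel. indicator J t / \<epsilon>) = 1"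
        using \<epsilon> by (auto simp: J_def)
      have "m 0 = (LINT t|lborel. (indicator J t / \<epsilon>) *\<^sub>R m 0)"
        using J1 by simp
      then have "integral\<^sup>L (slab T) g1 - m 0 = (LINT t|lborel. (indicator J t / \<epsilon>) *\<^sub>R m t - (indicator J t / \<epsilon>) *\<^sub>R m 0)"
        using val int_m J1 by (subst Bochner_Integration.integral_diff) auto
      also have "norm \<dots> \<le> (LINT t|lborel. indicator J t / \<epsilon> * \<delta>)"
      proof (rule Bochner_Integration.integral_norm_bound_integral)
        show "norm ((indicator J t / \<epsilon>) *\<^sub>R m t - (indicator J t / \<epsilon>) *\<^sub>R m 0) \<le> indicator J t / \<epsilon> * \<delta>" for t
          using \<delta>[of t] \<epsilon> by (auto simp: scaleR_diff_right[symmetric] J_def indicator_def divide_right_mono)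
        show "integrable lborel (\<lambda>t. (indicator J t / \<epsilon>) *\<^sub>R m t - (indicator J t / \<epsilon>) *\<^sub>R m 0)"
          using int_m J1(1) by (intro Bochner_Integration.integrable_diff integrable_scaleR_left)
        show "integrable lborel (\<lambda>t. indicator J t / \<epsilon> * \<delta>)"
          by (rule integrable_mult_left) (rule J1(1))
      qed
      also have "\<dots> = (LINT t|lborel. indicator J t / \<epsilon>) * \<delta>" by (rule integral_mult_left_zero)
      also have "\<dots> = \<delta>" using J1 by simp
      finally show ?thesis .
    qed
    have "m 0 - I0 = (integral\<^sup>L (slab T) g - integral\<^sup>L (slab T) (\<lambda>z. - g1 z)) - (integral\<^sup>L (slab T) g1 - m 0)"
      using g(3) by (simp add: add_eq_0_iff)
    then have "norm (m 0 - I0) \<le> \<epsilon> * (2 * r * (L * \<bar>Bf'\<bar>)) + \<delta>"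
      using norm_triangle_ineq4 g_close g1_val by (smt (verit))
    then show ?thesis using g(2) by simp
  qed
  have cont: "continuous_on {0..T} m" unfolding m_def by (rule weakly_continuous_bump(2)[OF wc \<psi>])
  have key: "integrable lborel (\<lambda>x. \<psi> x *\<^sub>R u0 x) \<and> norm (m 0 - I0) \<le> 0 + e" if e: "0 < e" for e
  proof -
    obtain d where d: "d > 0" "\<And>t. t \<in> {0..T} \<Longrightarrow> dist t 0 < d \<Longrightarrow> dist (m t) (m 0) < e / 2"
      using cont[unfolded continuous_on_iff, rule_format, of 0 "e / 2"] T e by auto
    define K where "K = 2 * r * (L * \<bar>Bf'\<bar>)"
    have K: "0 \<le> K" using r L0 by (simp add: K_def)
    \<comment> \<open>Small enough for \<open>T\<close>, for the continuity of \<open>m\<close> at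
      0, and for the flux term to stay below \<open>e / 2\<close>; \<open>K + 1\<close> avoids
      division by 0.\<close>
    define \<epsilon> where "\<epsilon> = min (min d T / 2) (e / (2 * (K + 1)))"
    have "0 < e / (2 * (K + 1))" "0 < min d T / 2" using d T e K by auto
    moreover have "\<epsilon> \<le> min d T / 2" unfolding \<epsilon>_def by (rule min.cobounded1)
    ultimately have \<epsilon>: "0 < \<epsilon>" "\<epsilon> < T" "\<epsilon> < d" unfolding \<epsilon>_def by linarith+
    have "\<epsilon> * K \<le> e / (2 * (K + 1)) * (K + 1)" using K \<epsilon> by (intro mult_mono) (auto simp: \<epsilon>_def)
    also have "\<dots> = e / 2" using K by (simp add: field_simps)
    finally have "\<epsilon> * K \<le> e / 2" .
    moreover have "integrable lborel (\<lambda>x. \<psi> x *\<^sub>R u0 x) \<and> norm (m 0 - I0) \<le> e / 2 + \<epsilon> * K"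
      unfolding K_def
    proof (rule main[OF \<epsilon>(1,2)])
      fix t assume "0 < t" "t < \<epsilon>"
      then show "norm (m t - m 0) \<le> e / 2" using d(2)[of t] \<epsilon> by (simp add: dist_norm less_imp_le)
    qed
    ultimately show ?thesis by auto
  qed
  show "integrable lborel (\<lambda>x. \<psi> x *\<^sub>R u0 x)" using key[of 1] by simp
  have "norm (m 0 - I0) \<le> 0" by (rule field_le_epsilon) (use key in blast)
  then show "(LINT x|lborel. \<psi> x *\<^sub>R u0 x) = (LINT x|lborel. \<psi> x *\<^sub>R u 0 x)" by (simp add: m_def I0_def)
qed

lemma ennreal_exp_le_enn_exp: "ennreal a \<le> b \<Longrightarrow> ennreal (exp a) \<le> enn_exp b"
proof -
  assume *: "ennreal a \<le> b"
  show ?thesis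
  proof (cases "b = \<top>")
    case False
    then have "a \<le> enn2real b" using * by (metis ennreal_enn2real ennreal_le_iff enn2real_nonneg less_top)
    then show ?thesis using False by (auto simp: enn_exp_def intro: ennreal_leI)
  qed (simp add: enn_exp_def)
qed

text \<open>The window estimate bounds the error in the mean, so every window before
  \<open>s\<close> contains a time with almost the desired bound, and such times can be chosen to
  converge to \<open>s\<close>. The envelope \<open>L\<close> takes values in [0, \<infinity>]
  because it is going to be an essential supremum over all parameters, whereas \<open>Lv\<close>
  belongs to the one parameter considered here.\<close>

lemma pathwise_stability:
  fixes v :: "real \<times> real \<Rightarrow> real^'m" and L :: "real \<Rightarrow> ennreal"
  assumes T: "0 < T" and sol: "entropy_solution T U f \<eta> q u0 u"
    and wc: "weakly_continuous_in_time T u"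
    and u_meas: "(\<lambda>(t, x). u t x) \<in> borel_measurable (restrict_space borel ({0..T} \<times> UNIV))"
    and u0_meas [measurable]: "u0 \<in> borel_measurable borel"
    and uC: "AE (t, x) in slab T. u t x \<in> C"
    and v: "Lv-lipschitz_on UNIV v" and vC: "\<And>z. v z \<in> C"
    and D_meas [measurable]: "vt \<in> borel_measurable borel" "vx \<in> borel_measurable borel"
    and D_le: "\<And>z. norm (vt z) \<le> Lv" "\<And>z. norm (vx z) \<le> Lv"
    and vt: "AE (t, x) in slab T. ((\<lambda>s. v (s, x)) has_vector_derivative vt (t, x)) (at t)"
    and vx: "AE (t, x) in slab T. ((\<lambda>z. v (t, z)) has_vector_derivative vx (t, x)) (at x)"
    and L_meas [measurable]: "L \<in> borel_measurable borel"
    and vx_le: "AE (t, x) in slab T. ennreal (norm (vx (t, x))) \<le> L t"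
    and s: "0 \<le> s" "s \<le> T"
  shows "(\<integral>\<^sup>+x. ennreal ((norm (u s x - v (s, x)))\<^sup>2) \<partial>lborel)
    \<le> enn_exp (ennreal (inverse Cl) * (\<integral>\<^sup>+t\<in>{0<..<s}. (ennreal (Cu * Cf) * L t + ennreal (Cu\<^sup>2)) \<partial>lborel))
      * (ennreal (inverse Cl) *
         ((\<integral>\<^sup>+z. ennreal ((norm (vt z + D1 f (v z) (vx z)))\<^sup>2) * indicator {0<..<s} (fst z) \<partial>slab T)
          + ennreal Cu * (\<integral>\<^sup>+x. ennreal ((norm (u0 x - v (0, x)))\<^sup>2) \<partial>lborel)))"
proof -
  define ER where "ER = (\<integral>\<^sup>+z. ennreal ((norm (vt z + D1 f (v z) (vx z)))\<^sup>2) * indicator {0<..<s} (fst z) \<partial>slab T)"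
  define E0 where "E0 = (\<integral>\<^sup>+x. ennreal ((norm (u0 x - v (0, x)))\<^sup>2) \<partial>lborel)"
  define Z where "Z = ER + ennreal Cu * E0"
  \<comment> \<open>Truncation at the Lipschitz constant makes the envelope bounded, and it still
    dominates the norm of \<open>vx\<close>, which never exceeds \<open>Lv\<close>.\<close>
  define l where "l = (\<lambda>t. enn2real (min (L t) (ennreal Lv)))"
  have Lv: "0 \<le> Lv" using v by (rule lipschitz_on_nonneg)
  have l_meas [measurable]: "l \<in> borel_measurable borel" unfolding l_def by measurable
  have l_ennreal: "ennreal (l t) = min (L t) (ennreal Lv)" for t
    unfolding l_def by (rule ennreal_enn2real) (simp add: min_less_iff_disj)
  have l: "0 \<le> l t" "l t \<le> Lv" for t
  proof -
    show "0 \<le> l t" by (simp add: l_def)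
    have "ennreal (l t) \<le> ennreal Lv" unfolding l_ennreal by simp
    then show "l t \<le> Lv" using Lv by simp
  qed
  have vx_l: "AE (t, x) in slab T. norm (vx (t, x)) \<le> l t"
    using vx_le
  proof eventually_elim
    case (elim z)
    then have "ennreal (norm (vx z)) \<le> ennreal (l (fst z))"
      unfolding l_ennreal using D_le(2)[of z] by (auto simp: ennreal_leI split_beta)
    then show ?case using l(1) by (simp add: split_beta)
  qed
  have u_slice: "(\<lambda>x. u t x) \<in> borel_measurable borel" if "t \<in> {0..T}" for t
  proof -
    have "(\<lambda>x::real. (t, x)) \<in> borel \<rightarrow>\<^sub>M restrict_space borel ({0..T} \<times> UNIV)"
      by (rule measurable_restrict_space2[OF _ borel_slices(2)]) (use that in auto)
    from measurable_compose[OF this u_meas] show ?thesis by simp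
  qed
  have u_slab: "(\<lambda>(t, x). u t x) \<in> borel_measurable (slab T)"
  proof -
    have "(\<lambda>z::real\<times>real. z) \<in> slab T \<rightarrow>\<^sub>M restrict_space borel ({0..T} \<times> UNIV)"
      by (intro measurable_restrict_space2 measurable_slab) auto
    from measurable_compose[OF this u_meas] show ?thesis .
  qed
  have v_slice [measurable]: "(\<lambda>x. v (t, x)) \<in> borel_measurable borel" for t
    by (intro borel_measurable_continuous_onI lipschitz_on_continuous_on[OF lipschitz_slice(2)[OF v]])
  have weak_sol: "weak_solution T U f u0 u" using sol by (simp add: entropy_solution_def)
  have init: "integrable lborel (\<lambda>x. \<psi> x *\<^sub>R u0 x)"
    "(LINT x|lborel. \<psi> x *\<^sub>R u0 x) = (LINT x|lborel. \<psi> x *\<^sub>R u 0 x)" if "bump \<psi>" for \<psi>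
    using initial_value[OF T weak_sol wc u_slab uC that] by auto
  have good: "AE t in lborel. t \<in> {0<..<T} \<longrightarrow> (AE x in lborel. u t x \<in> C)"
    using AE_slab_sections[OF uC] by simp
  \<comment> \<open>Almost every time slice takes values in \<open>C\<close>, so such times can be
    chosen to tend to 0, and the datum is the weak limit of the corresponding slices.\<close>
  have u0C: "AE x in lborel. u0 x \<in> C"
  proof -
    have "\<forall>k. \<exists>t. t \<in> {0<..<T / Suc k} \<and> (AE x in lborel. u t x \<in> C)"
    proof
      fix k
      have "T / Suc k > 0" using T by simp
      from AE_Ex_in_interval[OF good this] obtain t where t: "t \<in> {0<..<T / Suc k}"
        "t \<in> {0<..<T} \<longrightarrow> (AE x in lborel. u t x \<in> C)" by blast
      have "T / real (Suc k) \<le> T / 1" using T by (intro divide_left_mono) auto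
      then show "\<exists>t. t \<in> {0<..<T / Suc k} \<and> (AE x in lborel. u t x \<in> C)" using t by auto
    qed
    then obtain \<tau> where \<tau>: "\<And>k. \<tau> k \<in> {0<..<T / Suc k}" "\<And>k. AE x in lborel. u (\<tau> k) x \<in> C" by metis
    have "(\<lambda>k. T / real (Suc k)) \<longlonglongrightarrow> 0"
      using tendsto_mult[OF tendsto_const[of T] LIMSEQ_inverse_real_of_nat] by (simp add: inverse_eq_divide)
    then have lim: "\<tau> \<longlonglongrightarrow> 0"
      by (rule real_tendsto_sandwich[OF _ _ tendsto_const, rotated 2])
         (use \<tau>(1) in \<open>auto intro!: always_eventually less_imp_le\<close>)
    have "\<tau> k \<in> {0..T}" for k
    proof -
      have "T / real (Suc k) \<le> T / 1" using T by (intro divide_left_mono) auto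
      then show ?thesis using \<tau>(1)[of k] by auto
    qed
    then have "weak_limit (\<lambda>k. u (\<tau> k)) (u 0)"
      by (intro weak_limit_in_time[OF wc _ _ lim]) (use T in auto)
    then have "weak_limit (\<lambda>k. u (\<tau> k)) u0" unfolding weak_limit_def using init by auto
    from weak_limit_in_closed_convex[OF compact_imp_closed[OF compact_C] convex_C \<tau>(2) this u0_meas]
    show ?thesis .
  qed
  show ?thesis
  proof (cases "s = 0")
    case True
    \<comment> \<open>No window precedes time 0. Instead the constant sequence \<open>u0\<close> has
      the weak limit \<open>u 0\<close> by \<open>initial_value\<close>; the factors Cu/Cl > 1 and
      an exponential of at least 1 leave the room needed.\<close>
    have "weak_limit (\<lambda>k::nat. u0) (u 0)"
      unfolding weak_limit_def using init weakly_continuous_bump(1)[OF wc, of _ 0] T by auto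
    then have "weak_limit (\<lambda>k x. u0 x - v (0, x)) (\<lambda>x. u 0 x - v (0, x))"
      by (intro weak_limit_diff weak_limit_lipschitz[OF v tendsto_const])
    then have "(\<integral>\<^sup>+x. ennreal ((norm (u 0 x - v (0, x)))\<^sup>2) \<partial>lborel) \<le> E0"
      by (rule weak_limit_L2_bound) (use u_slice[of 0] T in \<open>auto simp: E0_def\<close>)
    also have "E0 = ennreal 1 * E0" by simp
    also have "\<dots> \<le> ennreal (inverse Cl * Cu) * E0"
      using Cl_pos Cl_less_Cu by (intro mult_right_mono ennreal_leI) (auto simp: field_simps)
    also have "\<dots> = ennreal (inverse Cl) * (ennreal Cu * E0)"
      using Cl_pos Cu_pos by (simp add: ennreal_mult mult.assoc)
    also have "\<dots> \<le> 1 * (ennreal (inverse Cl) * Z)"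
      unfolding Z_def by (simp add: mult_left_mono)
    also have "\<dots> \<le> enn_exp b * (ennreal (inverse Cl) * Z)" for b
      using ennreal_exp_le_enn_exp[of 0 b] by (intro mult_right_mono) auto
    finally show ?thesis unfolding True Z_def E0_def ER_def by simp
  next
    case False
    then have s0: "0 < s" using s by simp
    define a where "a = (\<lambda>t. (Cu * Cf * l t + Cu\<^sup>2) / Cl)"
    define A where "A = (\<lambda>t. integral {0..t} a)"
    have a0: "0 \<le> a t" for t unfolding a_def using l Cl_pos Cu_pos Cf_pos
      by (intro divide_nonneg_nonneg add_nonneg_nonneg mult_nonneg_nonneg) auto
    have aB: "a t \<le> (Cu * Cf * Lv + Cu\<^sup>2) / Cl" for t
      unfolding a_def using l(2) Cl_pos Cu_pos Cf_pos by (intro divide_right_mono add_mono mult_left_mono) auto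
    have a_meas: "a \<in> borel_measurable borel" unfolding a_def by measurable
    have "ennreal (A s) = (\<integral>\<^sup>+t. ennreal (a t) * indicator {0<..<s} t \<partial>lborel)"
      unfolding A_def by (rule integral_bounded_lipschitz(5)[OF a_meas a0 aB s(1)])
    also have "\<dots> \<le> (\<integral>\<^sup>+t. ennreal (inverse Cl) * ((ennreal (Cu * Cf) * L t + ennreal (Cu\<^sup>2)) * indicator {0<..<s} t) \<partial>lborel)"
    proof (rule nn_integral_mono)
      fix t
      have "ennreal (a t) = ennreal (inverse Cl) * (ennreal (Cu * Cf) * ennreal (l t) + ennreal (Cu\<^sup>2))"
        unfolding a_def divide_inverse using l Cl_pos Cu_pos Cf_pos
        by (subst mult.commute, subst ennreal_mult, simp, simp, subst ennreal_plus, simp, simp, subst ennreal_mult) auto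
      also have "\<dots> \<le> ennreal (inverse Cl) * (ennreal (Cu * Cf) * L t + ennreal (Cu\<^sup>2))"
        unfolding l_ennreal by (intro mult_left_mono add_mono) auto
      finally show "ennreal (a t) * indicator {0<..<s} t
          \<le> ennreal (inverse Cl) * ((ennreal (Cu * Cf) * L t + ennreal (Cu\<^sup>2)) * indicator {0<..<s} t)"
        by (auto simp: indicator_def)
    qed
    also have "\<dots> = ennreal (inverse Cl) * (\<integral>\<^sup>+t\<in>{0<..<s}. (ennreal (Cu * Cf) * L t + ennreal (Cu\<^sup>2)) \<partial>lborel)"
      by (rule nn_integral_cmult) measurable
    finally have exp_le: "ennreal (exp (A s)) \<le> enn_exp (ennreal (inverse Cl) *
        (\<integral>\<^sup>+t\<in>{0<..<s}. (ennreal (Cu * Cf) * L t + ennreal (Cu\<^sup>2)) \<partial>lborel))"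
      by (rule ennreal_exp_le_enn_exp)
    \<comment> \<open>The coefficient \<open>Cl / 2\<close> on the left and the halves on the right
      of the window estimate combine to \<open>1 / Cl\<close>.\<close>
    define B where "B = ennreal (exp (A s) / Cl) * Z"
    obtain \<sigma> where \<sigma>: "0 \<le> \<sigma>" "\<And>u v. u \<in> C \<Longrightarrow> v \<in> C \<Longrightarrow> \<bar>rel_q u v\<bar> \<le> \<sigma> * rel_eta u v"
      by (rule rel_q_le) (rule that)
    define w where "w = (\<lambda>z. ennreal ((norm (u (fst z) (snd z) - v z))\<^sup>2))"
    have w_meas [measurable]: "w \<in> borel_measurable (slab T)"
    proof -
      have "(\<lambda>z. u (fst z) (snd z)) \<in> borel_measurable (slab T)" using u_slab by (simp add: split_beta')
      moreover have "v \<in> borel_measurable (slab T)"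
        by (intro measurable_slab borel_measurable_continuous_onI lipschitz_on_continuous_on[OF v])
      ultimately show ?thesis unfolding w_def by measurable
    qed
    \<comment> \<open>The bound does not depend on the size of the cone, so Fatou's lemma lets the
      cone fill the slab.\<close>
    have avg: "(\<integral>\<^sup>+z. indicator {s - 2 * \<epsilon><..<s - \<epsilon>} (fst z) * w z \<partial>slab T) \<le> ennreal \<epsilon> * B"
      if \<epsilon>: "0 < \<epsilon>" "2 * \<epsilon> < s" for \<epsilon>
    proof (rule nn_integral_le_tendsto[where B = "\<lambda>_. ennreal \<epsilon> * B"
          and f = "\<lambda>n z. indicator {s - 2 * \<epsilon><..<s - \<epsilon>} (fst z) * (ennreal ((cone_weight (real (Suc n)) \<sigma> z)\<^sup>2) * w z)"])
      have J_meas [measurable]: "(\<lambda>z::real\<times>real. indicator {s - 2 * \<epsilon><..<s - \<epsilon>} (fst z) :: ennreal) \<in> borel_measurable (slab T)"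
        by (rule measurable_slab, rule measurable_compose[OF borel_measurable_fst]) measurable
      fix n
      have "cone_weight (real (Suc n)) \<sigma> \<in> borel_measurable (slab T)"
        using \<sigma>(1) by (intro measurable_slab borel_measurable_continuous_onI
            lipschitz_on_continuous_on[OF cone_weight_lipschitz]) auto
      then show "(\<lambda>z. indicator {s - 2 * \<epsilon><..<s - \<epsilon>} (fst z) * (ennreal ((cone_weight (real (Suc n)) \<sigma> z)\<^sup>2) * w z)) \<in> borel_measurable (slab T)"
        by (intro borel_measurable_times_ennreal J_meas w_meas) measurable
      define I where "I = (\<integral>\<^sup>+z. indicator {s - 2 * \<epsilon><..<s - \<epsilon>} (fst z) * (ennreal ((cone_weight (real (Suc n)) \<sigma> z)\<^sup>2) * w z) \<partial>slab T)"
      have half: "ennreal (1 / 2) * ER + ennreal (Cu / 2) * E0 = ennreal (1 / 2) * Z"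
      proof -
        have "ennreal (Cu / 2) = ennreal (1 / 2) * ennreal Cu"
          using Cu_pos by (subst ennreal_mult[symmetric]) auto
        then show ?thesis unfolding Z_def by (simp only: distrib_left mult.assoc)
      qed
      have k: "ennreal (exp (- A s) * Cl / (2 * \<epsilon>)) * I \<le> ennreal (1 / 2) * Z"
        using weighted_time_average_bound[OF T sol u_slab u0_meas uC u0C v vC D_meas D_le vt vx l_meas l vx_l s(2) \<epsilon> _ \<sigma>, of "real (Suc n)"]
        unfolding half[symmetric] I_def A_def a_def w_def ER_def E0_def by simp
      have "I = ennreal (2 * \<epsilon> * exp (A s) / Cl) * (ennreal (exp (- A s) * Cl / (2 * \<epsilon>)) * I)"
      proof -
        have "ennreal (2 * \<epsilon> * exp (A s) / Cl) * ennreal (exp (- A s) * Cl / (2 * \<epsilon>)) = ennreal 1"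
          using \<epsilon> Cl_pos by (subst ennreal_mult[symmetric]) (auto simp: exp_minus field_simps)
        then show ?thesis by (simp only: mult.assoc[symmetric] ennreal_1 mult_1_left)
      qed
      also have "\<dots> \<le> ennreal (2 * \<epsilon> * exp (A s) / Cl) * (ennreal (1 / 2) * Z)"
        using k by (rule mult_left_mono) simp
      also have "\<dots> = ennreal \<epsilon> * B"
      proof -
        have "ennreal (2 * \<epsilon> * exp (A s) / Cl) * ennreal (1 / 2) = ennreal \<epsilon> * ennreal (exp (A s) / Cl)"
          using \<epsilon> Cl_pos by (subst (1 2) ennreal_mult[symmetric]) auto
        then show ?thesis unfolding B_def by (simp only: mult.assoc[symmetric])
      qed
      finally show "(\<integral>\<^sup>+z. indicator {s - 2 * \<epsilon><..<s - \<epsilon>} (fst z) * (ennreal ((cone_weight (real (Suc n)) \<sigma> z)\<^sup>2) * w z) \<partial>slab T)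
          \<le> ennreal \<epsilon> * B" by (simp only: I_def)
    next
      have "(\<lambda>n. cone_weight (real (Suc n)) \<sigma> z) \<longlonglongrightarrow> 1" for z
      proof -
        define c where "c = sqrt (1 + (snd z)\<^sup>2) + \<sigma> * max 0 (fst z)"
        have "(\<lambda>n. max 0 (1 - c * inverse (real (Suc n)))) \<longlonglongrightarrow> max 0 (1 - c * 0)"
          by (intro tendsto_intros LIMSEQ_inverse_real_of_nat)
        then show ?thesis by (simp add: cone_weight_def split_beta c_def divide_inverse)
      qed
      then have "(\<lambda>n. ennreal ((cone_weight (real (Suc n)) \<sigma> z)\<^sup>2)) \<longlonglongrightarrow> ennreal (1\<^sup>2)" for z
        by (intro tendsto_ennrealI tendsto_power)
      then have "(\<lambda>n. ennreal ((cone_weight (real (Suc n)) \<sigma> z)\<^sup>2) * w z) \<longlonglongrightarrow> ennreal (1\<^sup>2) * w z" for z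
        by (intro tendsto_mult_ennreal tendsto_const) auto
      then have lim: "(\<lambda>n. ennreal ((cone_weight (real (Suc n)) \<sigma> z)\<^sup>2) * w z) \<longlonglongrightarrow> w z" for z
        by simp
      show "AE z in slab T. (\<lambda>n. indicator {s - 2 * \<epsilon><..<s - \<epsilon>} (fst z) * (ennreal ((cone_weight (real (Suc n)) \<sigma> z)\<^sup>2) * w z))
          \<longlonglongrightarrow> indicator {s - 2 * \<epsilon><..<s - \<epsilon>} (fst z) * w z"
        using lim by (intro AE_I2) (auto simp: indicator_def)
    qed simp
    define X where "X = (\<lambda>t. \<integral>\<^sup>+x. ennreal ((norm (u t x - v (t, x)))\<^sup>2) \<partial>lborel)"
    \<comment> \<open>Otherwise the integral over the window, whose length is \<epsilon>, would
      exceed \<epsilon> times \<open>B\<close>; finiteness of \<open>B\<close> is what makes the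
      excess \<open>\<delta>\<close> count.\<close>
    have ex: "\<exists>t\<in>{s - 2 * \<epsilon><..<s - \<epsilon>}. X t \<le> B + ennreal \<delta>"
      if \<epsilon>: "0 < \<epsilon>" "2 * \<epsilon> < s" and \<delta>: "0 < \<delta>" and fin: "B < \<top>" for \<epsilon> \<delta>
    proof (rule ccontr)
      assume "\<not> ?thesis"
      then have *: "B + ennreal \<delta> \<le> X t" if "t \<in> {s - 2 * \<epsilon><..<s - \<epsilon>}" for t
        using that by (auto simp: not_le less_imp_le)
      define J where "J = {s - 2 * \<epsilon><..<s - \<epsilon>}"
      have J_slab: "t \<in> J \<Longrightarrow> t \<in> {0<..<T}" for t using \<epsilon> s by (auto simp: J_def)
      have J_meas [measurable]: "(\<lambda>z::real\<times>real. indicator J (fst z) :: ennreal) \<in> borel_measurable (slab T)"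
        by (rule measurable_slab, rule measurable_compose[OF borel_measurable_fst]) (simp add: J_def)
      define k where "k = (\<lambda>z. indicator J (fst z) * w z * indicator ({0<..<T} \<times> UNIV) z)"
      have k_meas: "k \<in> borel_measurable (lborel \<Otimes>\<^sub>M lborel)"
      proof -
        have "(\<lambda>z. indicator J (fst z) * w z) \<in> borel_measurable (slab T)"
          by (intro borel_measurable_times_ennreal J_meas w_meas)
        then show ?thesis unfolding slab_def k_def lborel_prod
          by (subst (asm) borel_measurable_restrict_space_iff_ennreal) (auto simp: borel_Times)
      qed
      have "(\<integral>\<^sup>+t. (B + ennreal \<delta>) * indicator J t \<partial>lborel) \<le> (\<integral>\<^sup>+t. (\<integral>\<^sup>+x. k (t, x) \<partial>lborel) \<partial>lborel)"
      proof (rule nn_integral_mono)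
        fix t
        show "(B + ennreal \<delta>) * indicator J t \<le> (\<integral>\<^sup>+x. k (t, x) \<partial>lborel)"
        proof (cases "t \<in> J")
          case True
          then have "(\<integral>\<^sup>+x. k (t, x) \<partial>lborel) = X t"
            using J_slab[OF True] by (simp add: k_def X_def w_def)
          then show ?thesis using *[of t] True by (simp add: J_def)
        qed simp
      qed
      also have "\<dots> = (\<integral>\<^sup>+z. k z \<partial>(lborel \<Otimes>\<^sub>M lborel))"
        by (rule lborel.nn_integral_fst[OF k_meas])
      also have "\<dots> = (\<integral>\<^sup>+z. indicator J (fst z) * w z \<partial>slab T)"
        unfolding lborel_prod k_def by (rule nn_integral_slab[symmetric]) measurable
      also have "\<dots> \<le> ennreal \<epsilon> * B" unfolding J_def by (rule avg[OF \<epsilon>])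
      finally have "(B + ennreal \<delta>) * ennreal \<epsilon> \<le> ennreal \<epsilon> * B"
        using \<epsilon> by (simp add: J_def nn_integral_cmult_indicator)
      moreover obtain b where b: "B = ennreal b" "0 \<le> b" using fin by (cases B) auto
      ultimately have "ennreal ((b + \<delta>) * \<epsilon>) \<le> ennreal (\<epsilon> * b)"
        using \<epsilon> \<delta> by (simp add: ennreal_mult ennreal_plus)
      then have "(b + \<delta>) * \<epsilon> \<le> \<epsilon> * b" using \<epsilon> b by simp
      then have "\<delta> * \<epsilon> \<le> 0" by (simp add: algebra_simps)
      with mult_pos_pos[OF \<delta> \<epsilon>(1)] show False by simp
    qed
    have XsB: "X s \<le> B"
    proof (cases "B = \<top>")
      case False
      then have fin: "B < \<top>" by (simp add: less_top)
      show ?thesis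
      proof (rule ennreal_le_epsilon)
        fix \<delta> :: real assume \<delta>: "0 < \<delta>"
        \<comment> \<open>The windows belong to \<epsilon> = s/(3(k+1)): this meets 2\<epsilon> < s,
          and the windows contract to \<open>s\<close>.\<close>
        have "\<forall>k. \<exists>t. t \<in> {s - 2 * (s / (3 * real (Suc k)))<..<s - s / (3 * real (Suc k))} \<and> X t \<le> B + ennreal \<delta>"
        proof
          fix k
          have "s / (3 * real (Suc k)) \<le> s / 3" using s0 by (intro divide_left_mono) auto
          then show "\<exists>t. t \<in> {s - 2 * (s / (3 * real (Suc k)))<..<s - s / (3 * real (Suc k))} \<and> X t \<le> B + ennreal \<delta>"
            using ex[of "s / (3 * real (Suc k))" \<delta>] s0 \<delta> fin by auto
        qed
        then obtain \<tau> where \<tau>: "\<And>k. \<tau> k \<in> {s - 2 * (s / (3 * real (Suc k)))<..<s - s / (3 * real (Suc k))}"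
          "\<And>k. X (\<tau> k) \<le> B + ennreal \<delta>" by metis
        have lim0: "(\<lambda>k. s / (3 * real (Suc k))) \<longlonglongrightarrow> 0"
          using tendsto_mult[OF tendsto_const[of "s / 3"] LIMSEQ_inverse_real_of_nat] by (simp add: inverse_eq_divide)
        have lim: "\<tau> \<longlonglongrightarrow> s"
        proof (rule real_tendsto_sandwich)
          show "(\<lambda>k. s - 2 * (s / (3 * real (Suc k)))) \<longlonglongrightarrow> s"
            using tendsto_diff[OF tendsto_const[of s] tendsto_mult[OF tendsto_const[of 2] lim0]] by simp
          show "(\<lambda>k. s - s / (3 * real (Suc k))) \<longlonglongrightarrow> s"
            using tendsto_diff[OF tendsto_const[of s] lim0] by simp
        qed (use \<tau>(1) in \<open>auto intro!: always_eventually less_imp_le\<close>)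
        have \<tau>T: "\<tau> k \<in> {0..T}" for k
        proof -
          have "s / (3 * real (Suc k)) \<le> s / 3" using s0 by (intro divide_left_mono) auto
          moreover have "0 < s / (3 * real (Suc k))" using s0 by simp
          moreover have "s - 2 * (s / (3 * real (Suc k))) < \<tau> k" "\<tau> k < s - s / (3 * real (Suc k))"
            using \<tau>(1)[of k] by auto
          ultimately show ?thesis using s0 s(2) by (simp only: atLeastAtMost_iff) linarith
        qed
        have "weak_limit (\<lambda>k x. u (\<tau> k) x - v (\<tau> k, x)) (\<lambda>x. u s x - v (s, x))"
          by (intro weak_limit_diff weak_limit_in_time[OF wc \<tau>T _ lim] weak_limit_lipschitz[OF v lim])
             (use s in auto)
        then show "X s \<le> B + ennreal \<delta>"
          unfolding X_def
          by (rule weak_limit_L2_bound) (use u_slice \<tau>T s \<tau>(2) in \<open>auto simp: X_def\<close>)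
      qed
    qed simp
    also have "B = ennreal (exp (A s)) * (ennreal (inverse Cl) * Z)"
      unfolding B_def divide_inverse using Cl_pos by (simp add: ennreal_mult mult.assoc)
    also have "\<dots> \<le> enn_exp (ennreal (inverse Cl) *
        (\<integral>\<^sup>+t\<in>{0<..<s}. (ennreal (Cu * Cf) * L t + ennreal (Cu\<^sup>2)) \<partial>lborel)) * (ennreal (inverse Cl) * Z)"
      by (rule mult_right_mono[OF exp_le]) simp
    finally show ?thesis unfolding X_def Z_def ER_def E0_def .
  qed
qed

end

section \<open>Dependence on the random parameter\<close>

lemma enn_powr_2: "enn_powr (ennreal (norm v)) 2 = ennreal ((norm v)\<^sup>2)"
  by (simp add: enn_powr_def powr_numeral)

lemma enn_powr_half_power2: "(enn_powr a (1 / 2))\<^sup>2 = a"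
proof (cases "a = \<top>")
  case False
  have "(enn2real a powr (1 / 2))\<^sup>2 = enn2real a"
    by (subst powr_half_sqrt) auto
  note eq = this
  have "(enn_powr a (1 / 2))\<^sup>2 = ennreal ((enn2real a powr (1 / 2))\<^sup>2)"
    using False by (simp add: enn_powr_def ennreal_power)
  also have "\<dots> = a" unfolding eq using False by (simp add: ennreal_enn2real less_top)
  finally show ?thesis .
qed (simp add: enn_powr_def power2_eq_square ennreal_top_mult)

lemma enn_powr_half_2: "enn_powr (enn_powr a (1 / 2)) 2 = a"
proof (cases "a = \<top>")
  case False
  have "(enn2real a powr (1 / 2)) powr 2 = enn2real a" by (subst powr_powr) simp
  note eq = this
  have "enn_powr (enn_powr a (1 / 2)) 2 = ennreal ((enn2real a powr (1 / 2)) powr 2)"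
    using False by (simp add: enn_powr_def)
  also have "\<dots> = a" unfolding eq using False by (simp add: ennreal_enn2real less_top)
  finally show ?thesis .
qed (simp add: enn_powr_def)

text \<open>Squaring cancels the roots of the outer and the inner norm, also at the value
  \<infinity>, so squared norms become iterated integrals.\<close>

lemma norm_space_stoch_2:
  "(norm_space_stoch 2 2 P g)\<^sup>2 = (\<integral>\<^sup>+y. \<integral>\<^sup>+x. ennreal ((norm (g x y))\<^sup>2) \<partial>lborel \<partial>P)"
  unfolding norm_space_stoch_def Lp_norm_def by (simp add: enn_powr_2 enn_powr_half_power2 enn_powr_half_2)

lemma norm_space_time_stoch_2:
  "(norm_space_time_stoch 2 2 T P g)\<^sup>2 = (\<integral>\<^sup>+y. \<integral>\<^sup>+(t, x). ennreal ((norm (g t x y))\<^sup>2) \<partial>slab T \<partial>P)"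
  unfolding norm_space_time_stoch_def Lp_norm_def
  by (simp add: split_beta' enn_powr_2 enn_powr_half_power2 enn_powr_half_2)

lemma enn_exp_mono: "a \<le> b \<Longrightarrow> enn_exp a \<le> enn_exp b"
  by (cases "b = \<top>") (auto simp: enn_exp_def top_unique less_top intro!: ennreal_leI enn2real_mono)

section \<open>Essential suprema and measurability in the parameter\<close>

lemma esssup_le_iff:
  fixes f :: "'a \<Rightarrow> ennreal"
  assumes "f \<in> borel_measurable M"
  shows "esssup M f \<le> c \<longleftrightarrow> (AE x in M. f x \<le> c)"
  using esssup_I[OF assms] esssup_AE[of f M] by (auto elim: order_trans elim!: eventually_mono)

text \<open>A sublevel set of the essential supremum consists of the points at which a superlevel
  set of \<open>f\<close> has a null section, and the measure of sections is measurable for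
  sigma-finite \<open>N\<close>.\<close>

lemma borel_measurable_esssup:
  fixes f :: "'a \<times> 'b \<Rightarrow> ennreal"
  assumes N: "sigma_finite_measure N" and f [measurable]: "f \<in> borel_measurable (M \<Otimes>\<^sub>M N)"
  shows "(\<lambda>x. esssup N (\<lambda>y. f (x, y))) \<in> borel_measurable M"
proof (rule borel_measurableI_le)
  fix c
  have sec: "(\<lambda>y. f (x, y)) \<in> borel_measurable N" if "x \<in> space M" for x
    using that by measurable
  define Q where "Q = {z \<in> space (M \<Otimes>\<^sub>M N). c < f z}"
  have Q [measurable]: "Q \<in> sets (M \<Otimes>\<^sub>M N)" unfolding Q_def by measurable
  have "{x \<in> space M. esssup N (\<lambda>y. f (x, y)) \<le> c} = {x \<in> space M. emeasure N (Pair x -` Q) = 0}"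
  proof (intro Collect_cong conj_cong refl)
    fix x assume x: "x \<in> space M"
    have "Pair x -` Q = {y \<in> space N. \<not> f (x, y) \<le> c}"
      using x by (auto simp: Q_def space_pair_measure)
    then have "(AE y in N. f (x, y) \<le> c) \<longleftrightarrow> emeasure N (Pair x -` Q) = 0"
      using sec[OF x] by (subst AE_iff_measurable[OF _ refl]) auto
    then show "esssup N (\<lambda>y. f (x, y)) \<le> c \<longleftrightarrow> emeasure N (Pair x -` Q) = 0"
      by (simp add: esssup_le_iff[OF sec[OF x]])
  qed
  also have "\<dots> \<in> sets M"
    using sigma_finite_measure.measurable_emeasure_Pair[OF N Q] by measurable
  finally show "{x \<in> space M. esssup N (\<lambda>y. f (x, y)) \<le> c} \<in> sets M" .
qed

text \<open>The values at the nodes are unrestricted, but there are only countably many nodes; on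
  each cell the function is polynomial.\<close>

lemma dg_space_borel_measurable:
  fixes v :: "real \<Rightarrow> real^'m"
  assumes h: "0 < h" and v: "v \<in> dg_space a h p"
  shows "v \<in> borel_measurable borel"
proof (rule measurable_piecewise_restrict)
  define \<C> where "\<C> = range (cell a h) \<union> range (\<lambda>j. {node a h j})"
  show "countable \<C>" unfolding \<C>_def by auto
  show "\<Omega> \<inter> space borel \<in> sets borel" if "\<Omega> \<in> \<C>" for \<Omega>
    using that by (auto simp: \<C>_def cell_def)
  show "space borel \<subseteq> \<Union>\<C>"
  proof
    fix x :: real
    define j where "j = \<lfloor>(x - a) / h\<rfloor>"
    have "of_int j \<le> (x - a) / h" "(x - a) / h < of_int j + 1" unfolding j_def by linarith+
    then have "node a h j \<le> x" "x < node a h (j + 1)"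
      using h by (auto simp: node_def pos_le_divide_eq pos_divide_less_eq algebra_simps)
    then have "x \<in> cell a h j \<or> x = node a h j" by (auto simp: cell_def)
    then show "x \<in> \<Union>\<C>" unfolding \<C>_def by blast
  qed
  show "v \<in> borel_measurable (restrict_space borel \<Omega>)" if "\<Omega> \<in> \<C>" for \<Omega>
  proof (rule borel_measurable_continuous_on_restrict)
    from that consider j where "\<Omega> = cell a h j" | j where "\<Omega> = {node a h j}" by (auto simp: \<C>_def)
    then show "continuous_on \<Omega> v"
    proof cases
      case 1
      from v have "\<forall>k. \<exists>c::real poly. \<forall>x\<in>cell a h j. v x $ k = poly c x" unfolding dg_space_def by blast
      then obtain c :: "'m \<Rightarrow> real poly" where c: "\<And>k x. x \<in> cell a h j \<Longrightarrow> v x $ k = poly (c k) x" by metis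
      have "continuous_on (cell a h j) (\<lambda>x. \<chi> k. poly (c k) x)"
        by (intro continuous_on_vec_lambda continuous_intros)
      then show ?thesis unfolding 1
        by (rule continuous_on_eq) (simp add: c vec_eq_iff)
    qed simp
  qed
qed

text \<open>The points of the open slab with values outside \<open>C\<close> form an open set, which
  cannot be null unless empty; continuity then reaches the two end times. Membership of the
  reconstruction is thereby upgraded from almost everywhere to every point, including time 0, where
  the initial error is measured.\<close>

lemma closed_AE_slab:
  fixes g :: "real \<times> real \<Rightarrow> 'b::topological_space"
  assumes T: "0 < T" and g: "continuous_on UNIV g" and C: "closed C"
    and ae: "AE z in slab T. g z \<in> C" and z: "fst z \<in> {0..T}"
  shows "g z \<in> C"
proof (rule ccontr)
  assume "g z \<notin> C"
  define W where "W = g -` (- C)"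
  have W: "open W" unfolding W_def using g C by (intro open_vimage) auto
  have "z \<in> closure ({0<..<T} \<times> UNIV)" using z T by (cases z) (simp add: closure_Times)
  then have "W \<inter> ({0<..<T} \<times> UNIV) \<noteq> {}"
    using W \<open>g z \<notin> C\<close> unfolding closure_iff_nhds_not_empty W_def by blast
  moreover have "open (W \<inter> ({0<..<T} \<times> UNIV))" using W by (intro open_Int open_Times) auto
  moreover have "negligible (W \<inter> ({0<..<T} \<times> UNIV))"
  proof (rule negligible_subset)
    show "negligible {z. \<not> (fst z \<in> {0<..<T} \<longrightarrow> g z \<in> C)}"
      using ae unfolding AE_slab_iff AE_lborel_iff_negligible .
  qed (auto simp: W_def)
  ultimately show False using open_not_negligible by blast
qed

text \<open>By construction the bound holds for each \<open>t\<close> and almost every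
  \<open>y\<close>, while the pathwise estimate asks for almost every \<open>y\<close> and then
  almost every \<open>t\<close>. Fubini exchanges the two, which requires the inner essential
  supremum to be jointly measurable in \<open>t\<close> and \<open>y\<close>.\<close>

lemma AE_sup_bound:
  fixes g :: "real \<Rightarrow> real \<times> real \<Rightarrow> ennreal" and P :: "real measure"
  assumes P: "sigma_finite_measure P"
    and g [measurable]: "(\<lambda>(y, z). g y z) \<in> borel_measurable (P \<Otimes>\<^sub>M borel)"
  defines "L \<equiv> \<lambda>t. esssup P (\<lambda>y. esssup lborel (\<lambda>x. g y (t, x)))"
  shows "L \<in> borel_measurable borel"
    and "AE y in P. AE (t, x) in slab T. g y (t, x) \<le> L t"
proof -
  interpret P: sigma_finite_measure P by fact
  interpret LP: pair_sigma_finite "lborel :: real measure" P ..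
  have g3: "(\<lambda>((t, y), x). g y (t, x)) \<in> borel_measurable ((lborel \<Otimes>\<^sub>M P) \<Otimes>\<^sub>M lborel)"
  proof -
    have "(\<lambda>w. (snd (fst w), (fst (fst w), snd w))) \<in> (lborel \<Otimes>\<^sub>M P) \<Otimes>\<^sub>M lborel \<rightarrow>\<^sub>M P \<Otimes>\<^sub>M (borel \<Otimes>\<^sub>M borel)"
      by measurable
    then have "(\<lambda>w. (snd (fst w), (fst (fst w), snd w))) \<in> (lborel \<Otimes>\<^sub>M P) \<Otimes>\<^sub>M lborel \<rightarrow>\<^sub>M P \<Otimes>\<^sub>M borel"
      unfolding borel_prod .
    from measurable_compose[OF this g] show ?thesis by (simp add: split_beta')
  qed
  define h where "h = (\<lambda>ty. esssup lborel (\<lambda>x. g (snd ty) (fst ty, x)))"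
  have h [measurable]: "h \<in> borel_measurable (lborel \<Otimes>\<^sub>M P)"
    unfolding h_def using borel_measurable_esssup[OF sigma_finite_lborel g3] by (simp add: split_beta')
  have L_eq: "L t = esssup P (\<lambda>y. h (t, y))" for t by (simp add: L_def h_def)
  show Lm [measurable]: "L \<in> borel_measurable borel"
    using borel_measurable_esssup[OF P h] unfolding L_eq by simp
  have "AE t in lborel. AE y in P. h (t, y) \<le> L t"
    unfolding L_eq by (intro AE_I2 esssup_AE)
  moreover have "{z \<in> space (lborel \<Otimes>\<^sub>M P). h (fst z, snd z) \<le> L (fst z)} \<in> sets (lborel \<Otimes>\<^sub>M P)"
    by measurable
  ultimately have ae: "AE y in P. AE t in lborel. h (t, y) \<le> L t"
    by (subst (asm) LP.AE_commute) (auto simp: split_beta')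
  show "AE y in P. AE (t, x) in slab T. g y (t, x) \<le> L t"
    using ae AE_space
  proof eventually_elim
    case (elim y)
    have gy [measurable]: "g y \<in> borel_measurable borel"
    proof -
      have "Pair y \<in> borel \<rightarrow>\<^sub>M P \<Otimes>\<^sub>M borel" using elim(2) by measurable
      from measurable_compose[OF this g] show ?thesis by simp
    qed
    have "AE z in lborel. g y z \<le> L (fst z)"
    proof (rule AE_lborel_pairI)
      have "(\<lambda>z::real\<times>real. L (fst z)) \<in> borel_measurable borel"
        by (rule measurable_compose[OF borel_measurable_fst Lm])
      then show "Measurable.pred borel (\<lambda>z. g y z \<le> L (fst z))" by measurable
      have "AE t in lborel. AE x in lborel. g y (t, x) \<le> L t"
        using elim(1)
      proof eventually_elim
        case (elim t)
        have "AE x in lborel. g y (t, x) \<le> h (t, y)" unfolding h_def by (simp add: esssup_AE)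
        then show ?case by eventually_elim (use elim in auto)
      qed
      then show "(AE x in lborel. AE xa in lborel. g y (x, xa) \<le> L (fst (x, xa))) \<or>
        (AE xa in lborel. AE x in lborel. g y (x, xa) \<le> L (fst (x, xa)))" by simp
    qed
    then show ?case unfolding AE_slab_iff by eventually_elim auto
  qed
qed

text \<open>Only \<open>f\<close> has to be measurable, since the essential supremum of a
  non-measurable \<open>g\<close> is \<open>top\<close>. Thus \<open>g\<close> may come from a
  derivative whose values are arbitrary on a null set.\<close>

lemma esssup_le_esssup_AE:
  fixes f g :: "'a \<Rightarrow> ennreal"
  assumes "AE x in M. f x = g x" "f \<in> borel_measurable M"
  shows "esssup M f \<le> esssup M g"
  using assms by (intro esssup_AE_mono) auto

text \<open>Exchanging the sums exhibits the projection, for fixed \<open>y\<close>, as a finite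
  combination of the functions at the quadrature points with coefficients that depend on
  \<open>y\<close> alone. Regularity in space and time thus concerns finitely many deterministic
  functions.\<close>

lemma nisp_eq:
  "nisp M R \<Psi> ys \<omega> g x y = (\<Sum>l\<le>R. (\<Sum>i\<le>M. \<Psi> i y * (\<Psi> i (ys l) * \<omega> l)) *\<^sub>R g l x)"
  unfolding nisp_def scaleR_sum_right scaleR_sum_left by (subst sum.swap) (simp add: mult.assoc)

lemma lipschitz_sum_scaleR:
  fixes U :: "nat \<Rightarrow> 'a::metric_space \<Rightarrow> 'b::real_normed_vector"
  assumes "\<And>l. (K l)-lipschitz_on X (U l)"
  shows "(\<Sum>l\<le>R. \<bar>b l\<bar> * K l)-lipschitz_on X (\<lambda>z. \<Sum>l\<le>R. b l *\<^sub>R U l z)"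
proof (rule lipschitz_onI)
  fix z w assume zw: "z \<in> X" "w \<in> X"
  have "norm ((\<Sum>l\<le>R. b l *\<^sub>R U l z) - (\<Sum>l\<le>R. b l *\<^sub>R U l w)) = norm (\<Sum>l\<le>R. b l *\<^sub>R (U l z - U l w))"
    by (simp add: sum_subtractf[symmetric] scaleR_diff_right)
  also have "\<dots> \<le> (\<Sum>l\<le>R. norm (b l *\<^sub>R (U l z - U l w)))" by (rule norm_sum)
  also have "\<dots> \<le> (\<Sum>l\<le>R. \<bar>b l\<bar> * K l * dist z w)"
  proof (rule sum_mono)
    fix l
    have "norm (U l z - U l w) \<le> K l * dist z w"
      using lipschitz_onD[OF assms zw] by (simp add: dist_norm)
    then show "norm (b l *\<^sub>R (U l z - U l w)) \<le> \<bar>b l\<bar> * K l * dist z w"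
      by (simp add: mult.assoc mult_left_mono)
  qed
  finally show "dist (\<Sum>l\<le>R. b l *\<^sub>R U l z) (\<Sum>l\<le>R. b l *\<^sub>R U l w) \<le> (\<Sum>l\<le>R. \<bar>b l\<bar> * K l) * dist z w"
    by (simp add: dist_norm sum_distrib_right)
qed (intro sum_nonneg mult_nonneg_nonneg lipschitz_on_nonneg[OF assms] abs_ge_zero)

text \<open>Projection onto an interval is nonexpansive, so freezing the function outside the time
  interval extends it to the plane with the same constant. The lemmas on Lipschitz functions can
  then be applied to a reconstruction given on [0, T] only.\<close>

lemma clamp_lipschitz:
  fixes g :: "real \<times> real \<Rightarrow> 'b::metric_space"
  assumes g: "L-lipschitz_on ({0..T} \<times> UNIV) g" and T: "0 \<le> T"
  shows "L-lipschitz_on UNIV (\<lambda>z. g (max 0 (min T (fst z)), snd z))"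
proof (rule lipschitz_onI)
  fix z w :: "real \<times> real"
  have L: "0 \<le> L" using g by (rule lipschitz_on_nonneg)
  have "dist (max 0 (min T (fst z))) (max 0 (min T (fst w))) \<le> dist (fst z) (fst w)"
    unfolding dist_real_def by linarith
  then have "dist (max 0 (min T (fst z)), snd z) (max 0 (min T (fst w)), snd w) \<le> dist z w"
    unfolding dist_prod_def fst_conv snd_conv
    by (intro real_sqrt_le_mono add_right_mono power_mono zero_le_dist)
  then have "L * dist (max 0 (min T (fst z)), snd z) (max 0 (min T (fst w)), snd w) \<le> L * dist z w"
    using L by (rule mult_left_mono)
  moreover have "dist (g (max 0 (min T (fst z)), snd z)) (g (max 0 (min T (fst w)), snd w))
      \<le> L * dist (max 0 (min T (fst z)), snd z) (max 0 (min T (fst w)), snd w)"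
    by (rule lipschitz_onD[OF g]) (use T in \<open>auto simp: min_def max_def\<close>)
  ultimately show "dist (g (max 0 (min T (fst z)), snd z)) (g (max 0 (min T (fst w)), snd w)) \<le> L * dist z w"
    by (rule order_trans[rotated])
qed (rule lipschitz_on_nonneg[OF g])

text \<open>The origin of the two factors 2 in the final estimate.\<close>

lemma norm_diff_square_le: "(norm (a - c))\<^sup>2 \<le> 2 * (norm (a - b))\<^sup>2 + 2 * (norm (b - c))\<^sup>2"
proof -
  have "norm (a - c) \<le> norm (a - b) + norm (b - c)" using norm_triangle_ineq[of "a - b" "b - c"] by simp
  then have "(norm (a - c))\<^sup>2 \<le> (norm (a - b) + norm (b - c))\<^sup>2" by (rule power_mono) simp
  also have "\<dots> \<le> 2 * (norm (a - b))\<^sup>2 + 2 * (norm (b - c))\<^sup>2"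
    using zero_le_power2[of "norm (a - b) - norm (b - c)"] by (simp add: power2_eq_square algebra_simps)
  finally show ?thesis .
qed

lemma AE_slab_mono:
  assumes "AE z in slab T. Q z" "s \<le> T"
  shows "AE z in slab s. Q z"
  using assms unfolding AE_slab_iff by (auto elim!: eventually_mono)

section \<open>The error estimate for random data\<close>

theorem theorem4p1:
  fixes \<Omega> :: "'w measure" and \<xi> :: "'w \<Rightarrow> real" and \<Xi> :: "real set" and w\<^sub>\<xi> :: "real \<Rightarrow> real"
    and T :: real and \<U> \<C> :: "(real^'m) set" and f :: "real^'m \<Rightarrow> real^'m"
    and \<eta> q :: "real^'m \<Rightarrow> real" and C\<^sub>f C\<^sub>l C\<^sub>u :: real
    and u0 :: "real \<Rightarrow> real \<Rightarrow> real^'m" and u :: "real \<Rightarrow> real \<Rightarrow> real \<Rightarrow> real^'m"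
    and \<Psi> :: "nat \<Rightarrow> real \<Rightarrow> real" and M R :: nat and ys \<omega> :: "nat \<Rightarrow> real"
    and a h :: real and p Nt :: nat and ts :: "nat \<Rightarrow> real"
    and F :: "real^'m \<Rightarrow> real^'m \<Rightarrow> real^'m"
    and \<Lambda> :: "(real \<Rightarrow> real^'m) \<Rightarrow> (real \<Rightarrow> real^'m)"
    and S :: nat and \<alpha> \<beta> :: "nat \<Rightarrow> nat \<Rightarrow> real"
    and uh :: "nat \<Rightarrow> nat \<Rightarrow> real \<Rightarrow> real^'m"
    and ust :: "nat \<Rightarrow> real \<Rightarrow> real \<Rightarrow> real^'m"
    and n :: nat
  defines "P \<equiv> law \<Xi> w\<^sub>\<xi>"
    and "uhn \<equiv> nisp M R \<Psi> ys \<omega> (\<lambda>l. uh l n)"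
    and "usts \<equiv> (\<lambda>t. nisp M R \<Psi> ys \<omega> (\<lambda>l. ust l t))"
  assumes "prob_space \<Omega>" and "\<Xi> \<in> sets borel" and "\<And>y. y \<in> \<Xi> \<Longrightarrow> 0 \<le> w\<^sub>\<xi> y"
    and "distributed \<Omega> (restrict_space lborel \<Xi>) \<xi> (\<lambda>y. ennreal (w\<^sub>\<xi> y))"
    and "0 < T" and "open \<U>" and "C2_on \<U> f" and "strictly_hyperbolic \<U> f"
    and "entropy_pair \<U> f \<eta> q"
    and "random_entropy_solution T \<Xi> P \<U> f \<eta> q u0 u"
    and "AE (t, x) in slab T. (\<integral>\<^sup>+ y. ennreal ((norm (u t x y))\<^sup>2) \<partial>P) < \<infinity>"
    and "convex \<C>" and "compact \<C>" and "\<C> \<subseteq> \<U>"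
    and "0 < C\<^sub>f" and "0 < C\<^sub>l" and "C\<^sub>l < C\<^sub>u"
    and "\<And>v w. w \<in> \<C> \<Longrightarrow> norm (D2 f w v v) \<le> C\<^sub>f * (norm v)\<^sup>2"
    and "\<And>v w. w \<in> \<C> \<Longrightarrow> C\<^sub>l * (norm v)\<^sup>2 \<le> D2 \<eta> w v v \<and> D2 \<eta> w v v \<le> C\<^sub>u * (norm v)\<^sup>2"
    and "AE y in P. AE (t, x) in slab T. u t x y \<in> \<C> \<and> usts t x y \<in> \<C>"
    and "orthonormal_basis P \<Psi>"
    and "\<And>l. l \<le> R \<Longrightarrow> ys l \<in> \<Xi>"
    and "0 < h"
    and "ts 0 = 0" and "ts Nt = T" and "\<And>k. k < Nt \<Longrightarrow> ts k < ts (Suc k)"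
    and "\<And>l. l \<le> R \<Longrightarrow>
           rkdg_approximation \<U> f F \<Lambda> S \<alpha> \<beta> a h p Nt ts (\<lambda>x. u0 x (ys l)) (uh l)"
    and "\<And>l. l \<le> R \<Longrightarrow> space_time_reconstruction T a h p (ust l)"
    and "norm_space_time_stoch 2 2 T P (residual f usts) < \<infinity>"
    and "n \<le> Nt"
  shows "(norm_space_stoch 2 2 P (\<lambda>x y. u (ts n) x y - uhn x y))\<^sup>2
    \<le> 2 * (norm_space_stoch 2 2 P (\<lambda>x y. usts (ts n) x y - uhn x y))\<^sup>2
      + 2 * ennreal (inverse C\<^sub>l)
        * ((norm_space_time_stoch 2 2 (ts n) P (residual f usts))\<^sup>2
           + ennreal C\<^sub>u * (norm_space_stoch 2 2 P (\<lambda>x y. u0 x y - usts 0 x y))\<^sup>2)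
        * enn_exp (ennreal (inverse C\<^sub>l)
            * (\<integral>\<^sup>+ t\<in>{0<..<ts n}.
                 (ennreal (C\<^sub>u * C\<^sub>f)
                    * sup_norm_space_stoch P (\<lambda>x y. vector_derivative (\<lambda>z. usts t z y) (at x))
                  + ennreal (C\<^sub>u\<^sup>2)) \<partial>lborel))"
proof -
  interpret relative_entropy \<U> \<C> f \<eta> q C\<^sub>f C\<^sub>l C\<^sub>u
    by unfold_locales (use assms in auto)
  have T: "0 < T" by fact
  define s where "s = ts n"
  have ts_mono: "ts i \<le> ts j" if "i \<le> j" "j \<le> Nt" for i j
    using that
  proof (induction j)
    case (Suc j)
    then show ?case using \<open>\<And>k. k < Nt \<Longrightarrow> ts k < ts (Suc k)\<close>[of j] by (cases "i = Suc j") (auto simp: less_imp_le intro: order_trans)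
  qed simp
  have s: "0 \<le> s" "s \<le> T"
    using ts_mono[of 0 n] ts_mono[of n Nt] \<open>n \<le> Nt\<close> \<open>ts 0 = 0\<close> \<open>ts Nt = T\<close> by (auto simp: s_def)
  have dist: "distributed \<Omega> (restrict_space lborel \<Xi>) \<xi> (\<lambda>y. ennreal (w\<^sub>\<xi> y))" by fact
  have P_distr: "P = distr \<Omega> (restrict_space lborel \<Xi>) \<xi>"
    unfolding P_def law_def using dist by (simp add: distributed_def)
  have "prob_space P"
    unfolding P_distr using \<open>prob_space \<Omega>\<close> dist by (intro prob_space.prob_space_distr) (auto simp: distributed_def)
  then interpret P: prob_space P .
  have sets_P: "sets P = sets (restrict_space borel \<Xi>)"
    by (simp add: P_def law_def sets_restrict_space)
  have space_P: "space P = \<Xi>" by (simp add: P_def law_def space_restrict_space)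
  have \<Psi>_meas [measurable]: "\<Psi> i \<in> borel_measurable P" for i
    using \<open>orthonormal_basis P \<Psi>\<close> by (auto simp: orthonormal_basis_def)

  \<comment> \<open>The coefficients provided by \<open>nisp_eq\<close>; they carry the whole
    dependence on \<open>y\<close>.\<close>
  define b where "b = (\<lambda>l y. \<Sum>i\<le>M. \<Psi> i y * (\<Psi> i (ys l) * \<omega> l))"
  have b_meas [measurable]: "b l \<in> borel_measurable P" for l unfolding b_def by measurable
  define cl where "cl = (\<lambda>t. max 0 (min T t))"
  have cl: "cl t \<in> {0..T}" "t \<in> {0..T} \<Longrightarrow> cl t = t" for t using T by (auto simp: cl_def)
  \<comment> \<open>Times are clamped to [0, T] and indices beyond \<open>R\<close> receive 0, so
    that all facts about \<open>Us l\<close> hold for every \<open>l\<close> and on the whole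
    plane.\<close>
  define Us where "Us = (\<lambda>l z. if l \<le> R then ust l (cl (fst z)) (snd z) else 0)"
  have "\<exists>K. K-lipschitz_on UNIV (Us l)" for l
  proof (cases "l \<le> R")
    case True
    obtain K where "K-lipschitz_on ({0..T} \<times> UNIV) (\<lambda>(t, x). ust l t x)"
      using \<open>\<And>l. l \<le> R \<Longrightarrow> space_time_reconstruction T a h p (ust l)\<close>[OF True]
      unfolding space_time_reconstruction_def by blast
    from clamp_lipschitz[OF this] T True show ?thesis by (auto simp: Us_def cl_def)
  next
    case False
    then have "0-lipschitz_on UNIV (Us l)" by (auto simp: Us_def lipschitz_on_def)
    then show ?thesis by blast
  qed
  then obtain K where K: "\<And>l. (K l)-lipschitz_on UNIV (Us l)" by metis
  define Q where "Q = (\<lambda>l Dt Dx. Dt \<in> borel_measurable borel \<and> Dx \<in> borel_measurable borel \<and>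
    (\<forall>z. norm (Dt z) \<le> K l) \<and> (\<forall>z. norm (Dx z) \<le> K l) \<and>
    (\<forall>t. AE x in lborel. ((\<lambda>z. Us l (t, z)) has_vector_derivative Dx (t, x)) (at x)) \<and>
    (AE (t, x) in lborel. ((\<lambda>s. Us l (s, x)) has_vector_derivative Dt (t, x)) (at t)) \<and>
    (AE (t, x) in lborel. ((\<lambda>z. Us l (t, z)) has_vector_derivative Dx (t, x)) (at x)))"
  have "\<exists>Dt Dx. Q l Dt Dx" for l
    by (rule lipschitz_partial_derivatives[OF K[of l]]) (unfold Q_def, blast)
  then obtain Dt Dx where Q: "\<And>l. Q l (Dt l) (Dx l)" by metis
  have D_meas [measurable]: "Dt l \<in> borel_measurable borel" "Dx l \<in> borel_measurable borel" for l
    using Q[of l] by (auto simp: Q_def)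
  have D_le: "norm (Dt l z) \<le> K l" "norm (Dx l z) \<le> K l" for l z
    using Q[of l] unfolding Q_def by blast+
  define V where "V = (\<lambda>y z. \<Sum>l\<le>R. b l y *\<^sub>R Us l z)"
  define Vt where "Vt = (\<lambda>y z. \<Sum>l\<le>R. b l y *\<^sub>R Dt l z)"
  define Vx where "Vx = (\<lambda>y z. \<Sum>l\<le>R. b l y *\<^sub>R Dx l z)"
  define Lv where "Lv = (\<lambda>y. \<Sum>l\<le>R. \<bar>b l y\<bar> * K l)"
  have usts_eq: "usts t x y = V y (t, x)" if "t \<in> {0..T}" for t x y
    unfolding usts_def nisp_eq V_def b_def using cl(2)[OF that] by (simp add: Us_def)
  have uhn_eq: "uhn x y = (\<Sum>l\<le>R. b l y *\<^sub>R uh l n x)" for x y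
    unfolding uhn_def nisp_eq b_def by simp
  have V_clamp: "V y z = V y (cl (fst z), snd z)" for y z
    unfolding V_def Us_def using cl by simp
  have V_lip: "(Lv y)-lipschitz_on UNIV (V y)" for y
    unfolding V_def Lv_def by (rule lipschitz_sum_scaleR[OF K])
  have sum_le: "norm (\<Sum>l\<le>R. b l y *\<^sub>R D l) \<le> Lv y" if "\<And>l. norm (D l :: real^'m) \<le> K l" for D y
    unfolding Lv_def by (intro order_trans[OF norm_sum] sum_mono) (auto intro!: mult_left_mono that)
  have VD_le: "norm (Vt y z) \<le> Lv y" "norm (Vx y z) \<le> Lv y" for y z
    unfolding Vt_def Vx_def by (intro sum_le D_le)+
  have Us_meas [measurable]: "Us l \<in> borel_measurable borel" for l
    by (intro borel_measurable_continuous_onI lipschitz_on_continuous_on[OF K])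
  have VD_meas [measurable]: "Vt y \<in> borel_measurable borel" "Vx y \<in> borel_measurable borel" for y
    unfolding Vt_def Vx_def by measurable
  have V_meas2 [measurable]: "(\<lambda>(y, z). V y z) \<in> borel_measurable (P \<Otimes>\<^sub>M borel)"
    "(\<lambda>(y, z). Vt y z) \<in> borel_measurable (P \<Otimes>\<^sub>M borel)"
    "(\<lambda>(y, z). Vx y z) \<in> borel_measurable (P \<Otimes>\<^sub>M borel)"
    unfolding V_def Vt_def Vx_def by measurable

  have sum_deriv: "((\<lambda>s. \<Sum>l\<le>R. b l y *\<^sub>R g l s) has_vector_derivative (\<Sum>l\<le>R. b l y *\<^sub>R d l)) (at r)"
    if "\<And>l. (g l has_vector_derivative (d l :: real^'m)) (at r)" for g d r y
    by (intro has_vector_derivative_sum bounded_linear.has_vector_derivative[OF bounded_linear_scaleR_right] that)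
  \<comment> \<open>A single null set serves all \<open>y\<close>: the derivatives are needed only
    for the countably many \<open>Us l\<close>, and the coefficients are constant in space and
    time.\<close>
  have "AE z in lborel. \<forall>l. ((\<lambda>s. Us l (s, snd z)) has_vector_derivative Dt l z) (at (fst z))
      \<and> ((\<lambda>x. Us l (fst z, x)) has_vector_derivative Dx l z) (at (snd z))"
    unfolding AE_all_countable using Q by (auto simp: Q_def split_beta')
  then have good: "AE z in lborel. \<forall>y. ((\<lambda>s. V y (s, snd z)) has_vector_derivative Vt y z) (at (fst z))
      \<and> ((\<lambda>x. V y (fst z, x)) has_vector_derivative Vx y z) (at (snd z))"
  proof eventually_elim
    case (elim z)
    then show ?case unfolding V_def Vt_def Vx_def by (intro allI conjI sum_deriv) auto
  qed
  then have good_slab: "AE z in slab T. \<forall>y. ((\<lambda>s. V y (s, snd z)) has_vector_derivative Vt y z) (at (fst z))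
      \<and> ((\<lambda>x. V y (fst z, x)) has_vector_derivative Vx y z) (at (snd z))"
    unfolding AE_slab_iff by eventually_elim auto
  have good_slice: "AE x in lborel. \<forall>y. ((\<lambda>z. V y (t, z)) has_vector_derivative Vx y (t, x)) (at x)" for t
  proof -
    have "AE x in lborel. \<forall>l. ((\<lambda>z. Us l (t, z)) has_vector_derivative Dx l (t, x)) (at x)"
      unfolding AE_all_countable using Q by (auto simp: Q_def)
    then show ?thesis
    proof eventually_elim
      case (elim x)
      then show ?case unfolding V_def Vx_def by (intro allI sum_deriv) auto
    qed
  qed

  \<comment> \<open>Built from the jointly measurable \<open>Vx\<close> instead of
    \<open>vector_derivative\<close>, which makes it a measurable function of time;
    \<open>Lt_le\<close> then compares it with the norm in the statement.\<close>
  define Lt where "Lt = (\<lambda>t. esssup P (\<lambda>y. esssup lborel (\<lambda>x. ennreal (norm (Vx y (t, x))))))"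
  have nVx: "(\<lambda>(y, z). ennreal (norm (Vx y z))) \<in> borel_measurable (P \<Otimes>\<^sub>M borel)"
    using V_meas2(3) by measurable
  have Lt_meas [measurable]: "Lt \<in> borel_measurable borel"
    and Lt_AE: "AE y in P. AE (t, x) in slab T. ennreal (norm (Vx y (t, x))) \<le> Lt t"
    unfolding Lt_def
    using AE_sup_bound[where g = "\<lambda>y z. ennreal (norm (Vx y z))", OF P.sigma_finite_measure_axioms nVx] by auto
  have Lt_le: "Lt t \<le> sup_norm_space_stoch P (\<lambda>x y. vector_derivative (\<lambda>z. usts t z y) (at x))"
    if t: "t \<in> {0..T}" for t
    unfolding Lt_def sup_norm_space_stoch_def
  proof (rule esssup_mono)
    have "(\<lambda>(y, x). ennreal (norm (Vx y (t, x)))) \<in> borel_measurable (P \<Otimes>\<^sub>M lborel)"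
    proof -
      have "(\<lambda>w::real\<times>real. (fst w, (t, snd w))) \<in> P \<Otimes>\<^sub>M lborel \<rightarrow>\<^sub>M P \<Otimes>\<^sub>M (borel \<Otimes>\<^sub>M borel)" by measurable
      then have "(\<lambda>w::real\<times>real. (fst w, (t, snd w))) \<in> P \<Otimes>\<^sub>M lborel \<rightarrow>\<^sub>M P \<Otimes>\<^sub>M borel" unfolding borel_prod .
      from measurable_compose[OF this nVx] show ?thesis by (simp add: split_beta')
    qed
    from borel_measurable_esssup[OF sigma_finite_lborel this]
    show "(\<lambda>y. esssup lborel (\<lambda>x. ennreal (norm (Vx y (t, x))))) \<in> borel_measurable P" by simp
    fix y
    show "esssup lborel (\<lambda>x. ennreal (norm (Vx y (t, x))))
        \<le> esssup lborel (\<lambda>x. ennreal (norm (vector_derivative (\<lambda>z. usts t z y) (at x))))"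
    proof (rule esssup_le_esssup_AE)
      show "AE x in lborel. ennreal (norm (Vx y (t, x))) = ennreal (norm (vector_derivative (\<lambda>z. usts t z y) (at x)))"
        using good_slice[of t]
      proof eventually_elim
        case (elim x)
        then have "vector_derivative (\<lambda>z. usts t z y) (at x) = Vx y (t, x)"
          unfolding usts_eq[OF t] by (blast intro: vector_derivative_at)
        then show ?case by simp
      qed
    qed measurable
  qed

  define Kexp where "Kexp = enn_exp (ennreal (inverse C\<^sub>l) *
    (\<integral>\<^sup>+t\<in>{0<..<s}. (ennreal (C\<^sub>u * C\<^sub>f) * Lt t + ennreal (C\<^sub>u\<^sup>2)) \<partial>lborel))"
  have Kexp_le: "Kexp \<le> enn_exp (ennreal (inverse C\<^sub>l)
            * (\<integral>\<^sup>+ t\<in>{0<..<s}.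
                 (ennreal (C\<^sub>u * C\<^sub>f)
                    * sup_norm_space_stoch P (\<lambda>x y. vector_derivative (\<lambda>z. usts t z y) (at x))
                  + ennreal (C\<^sub>u\<^sup>2)) \<partial>lborel))"
    unfolding Kexp_def
  proof (intro enn_exp_mono mult_left_mono nn_integral_mono)
    fix t
    show "(ennreal (C\<^sub>u * C\<^sub>f) * Lt t + ennreal (C\<^sub>u\<^sup>2)) * indicator {0<..<s} t
      \<le> (ennreal (C\<^sub>u * C\<^sub>f) * sup_norm_space_stoch P (\<lambda>x y. vector_derivative (\<lambda>z. usts t z y) (at x))
          + ennreal (C\<^sub>u\<^sup>2)) * indicator {0<..<s} t"
      using Lt_le[of t] s by (cases "t \<in> {0<..<s}") (auto intro!: add_mono mult_left_mono)
  qed simp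

  \<comment> \<open>Regularity of \<open>f\<close> is known on \<U> only, and \<open>V y z\<close>
    lies in \<C> only for almost every \<open>y\<close>. Cutting off outside \<C> gives a Borel
    function on the whole space, hence a version \<open>Rs\<close> of the residual that is jointly
    measurable for all \<open>y\<close>.\<close>
  define DF where "DF = (\<lambda>k w. indicator \<C> w *\<^sub>R D1 f w (axis k 1))"
  have DF_meas [measurable]: "DF k \<in> borel_measurable borel" for k
    unfolding DF_def
  proof (rule borel_measurable_continuous_on_indicator)
    show "\<C> \<in> sets borel" by (rule borel_closed[OF compact_imp_closed[OF compact_C]])
    show "continuous_on \<C> (\<lambda>w. D1 f w (axis k 1))"
      using continuous_on_subset[OF C2_on_continuous(2)[OF C2_f] C_sub_U] by (intro continuous_intros)
  qed
  define Rs where "Rs = (\<lambda>y z. Vt y z + (\<Sum>k\<in>UNIV. (Vx y z \<bullet> axis k 1) *\<^sub>R DF k (V y z)))"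
  have Rs_eq: "Rs y z = Vt y z + D1 f (V y z) (Vx y z)" if "V y z \<in> \<C>" for y z
    using that blinfun_axis_expansion[of "D1 f (V y z)" "Vx y z"] by (simp add: Rs_def DF_def)
  have Rs_meas: "(\<lambda>(y, z). Rs y z) \<in> borel_measurable (P \<Otimes>\<^sub>M borel)"
    unfolding Rs_def split_beta' using V_meas2[unfolded split_beta'] by measurable
  have slab_sets [measurable]: "{0<..<s} \<times> (UNIV :: real set) \<in> sets borel" by (simp add: borel_Times)
  define ER where "ER = (\<lambda>y. \<integral>\<^sup>+z. ennreal ((norm (Rs y z))\<^sup>2) * indicator ({0<..<s} \<times> UNIV) z \<partial>lborel)"
  define E0 where "E0 = (\<lambda>y. \<integral>\<^sup>+x. ennreal ((norm (u0 x y - V y (0, x)))\<^sup>2) \<partial>lborel)"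
  define Y where "Y = (\<lambda>y. \<integral>\<^sup>+x. ennreal ((norm (V y (s, x) - uhn x y))\<^sup>2) \<partial>lborel)"
  define X where "X = (\<lambda>y. \<integral>\<^sup>+x. ennreal ((norm (u s x y - V y (s, x)))\<^sup>2) \<partial>lborel)"
  have ER_meas [measurable]: "ER \<in> borel_measurable P"
  proof -
    have "(\<lambda>w. ennreal ((norm (Rs (fst w) (snd w)))\<^sup>2) * indicator ({0<..<s} \<times> UNIV) (snd w)) \<in> borel_measurable (P \<Otimes>\<^sub>M lborel)"
      using Rs_meas[unfolded split_beta'] by measurable
    from lborel.borel_measurable_nn_integral_fst[OF this] show ?thesis unfolding ER_def by simp
  qed
  have V_slice2: "(\<lambda>(y, x). V y (t, x)) \<in> borel_measurable (P \<Otimes>\<^sub>M borel)" for t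
  proof -
    have "(\<lambda>w::real\<times>real. (fst w, (t, snd w))) \<in> P \<Otimes>\<^sub>M borel \<rightarrow>\<^sub>M P \<Otimes>\<^sub>M (borel \<Otimes>\<^sub>M borel)" by measurable
    then have "(\<lambda>w::real\<times>real. (fst w, (t, snd w))) \<in> P \<Otimes>\<^sub>M borel \<rightarrow>\<^sub>M P \<Otimes>\<^sub>M borel" unfolding borel_prod .
    from measurable_compose[OF this V_meas2(1)] show ?thesis by (simp add: split_beta')
  qed
  have res: "random_entropy_solution T \<Xi> P \<U> f \<eta> q u0 u" by fact
  have id_P: "(\<lambda>y. y) \<in> P \<rightarrow>\<^sub>M borel"
    unfolding measurable_cong_sets[OF sets_P refl] by (intro measurable_restrict_space1) simp
  have u0_meas2: "(\<lambda>(y, x). u0 x y) \<in> borel_measurable (P \<Otimes>\<^sub>M borel)"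
  proof -
    have "(\<lambda>w::real\<times>real. (snd w, fst w)) \<in> P \<Otimes>\<^sub>M borel \<rightarrow>\<^sub>M borel \<Otimes>\<^sub>M borel"
      using id_P by (intro measurable_Pair measurable_snd measurable_compose[OF measurable_fst])
    then have "(\<lambda>w::real\<times>real. (snd w, fst w)) \<in> P \<Otimes>\<^sub>M borel \<rightarrow>\<^sub>M restrict_space borel (UNIV \<times> \<Xi>)"
      unfolding borel_prod by (rule measurable_restrict_space2[rotated]) (auto simp: space_pair_measure space_P)
    moreover have "(\<lambda>(x, y). u0 x y) \<in> borel_measurable (restrict_space borel (UNIV \<times> \<Xi>))"
      using res by (simp add: random_entropy_solution_def)
    ultimately have "(\<lambda>w. case (snd w, fst w) of (x, y) \<Rightarrow> u0 x y) \<in> borel_measurable (P \<Otimes>\<^sub>M borel)"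
      by (rule measurable_compose)
    then show ?thesis by (simp add: split_beta')
  qed
  have E0_meas [measurable]: "E0 \<in> borel_measurable P"
  proof -
    have "(\<lambda>w. ennreal ((norm (u0 (snd w) (fst w) - V (fst w) (0, snd w)))\<^sup>2)) \<in> borel_measurable (P \<Otimes>\<^sub>M lborel)"
      using u0_meas2[unfolded split_beta'] V_slice2[of 0, unfolded split_beta'] by measurable
    from lborel.borel_measurable_nn_integral_fst[OF this] show ?thesis unfolding E0_def by simp
  qed
  have uh_meas [measurable]: "uh l n \<in> borel_measurable borel" if "l \<le> R" for l
    by (rule dg_space_borel_measurable[OF \<open>0 < h\<close>])
       (use \<open>\<And>l. l \<le> R \<Longrightarrow> rkdg_approximation \<U> f F \<Lambda> S \<alpha> \<beta> a h p Nt ts (\<lambda>x. u0 x (ys l)) (uh l)\<close>[OF that] \<open>n \<le> Nt\<close>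
         in \<open>auto simp: rkdg_approximation_def\<close>)
  have uhn_meas2: "(\<lambda>w. uhn (snd w) (fst w)) \<in> borel_measurable (P \<Otimes>\<^sub>M lborel)"
    unfolding uhn_eq
  proof (rule borel_measurable_sum)
    fix l assume "l \<in> {..R}"
    then have [measurable]: "uh l n \<in> borel_measurable borel" using uh_meas by simp
    show "(\<lambda>w. b l (fst w) *\<^sub>R uh l n (snd w)) \<in> borel_measurable (P \<Otimes>\<^sub>M lborel)" by measurable
  qed
  have Y_meas [measurable]: "Y \<in> borel_measurable P"
  proof -
    have "(\<lambda>w. ennreal ((norm (V (fst w) (s, snd w) - uhn (snd w) (fst w)))\<^sup>2)) \<in> borel_measurable (P \<Otimes>\<^sub>M lborel)"
      using V_slice2[of s, unfolded split_beta'] uhn_meas2 by measurable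
    from lborel.borel_measurable_nn_integral_fst[OF this] show ?thesis unfolding Y_def by simp
  qed

  have VC: "AE y in P. \<forall>z. V y z \<in> \<C>"
    using \<open>AE y in P. AE (t, x) in slab T. u t x y \<in> \<C> \<and> usts t x y \<in> \<C>\<close>
  proof eventually_elim
    case (elim y)
    have "AE z in slab T. V y z \<in> \<C>"
      using elim AE_space
    proof eventually_elim
      case (elim z)
      then show ?case using usts_eq[of "fst z" "snd z" y] by (auto simp: split_beta)
    qed
    \<comment> \<open>Continuity extends membership from almost every point of the open slab to all
      times in [0, T], and clamping then covers the whole plane.\<close>
    then have "V y (cl (fst z), snd z) \<in> \<C>" for z
      using cl(1) by (intro closed_AE_slab[OF T lipschitz_on_continuous_on[OF V_lip] compact_imp_closed[OF compact_C]]) auto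
    then show ?case using V_clamp by metis
  qed
  have u_measT: "(\<lambda>(t, x, y). u t x y) \<in> borel_measurable (restrict_space borel ({0..T} \<times> UNIV \<times> \<Xi>))"
    using res by (simp add: random_entropy_solution_def)
  have sol: "AE y in P. entropy_solution T \<U> f \<eta> q (\<lambda>x. u0 x y) (\<lambda>t x. u t x y) \<and>
                 weakly_continuous_in_time T (\<lambda>t x. u t x y)"
    using res by (simp add: random_entropy_solution_def)
  have u_meas_y: "(\<lambda>(t, x). u t x y) \<in> borel_measurable (restrict_space borel ({0..T} \<times> UNIV))" if y: "y \<in> \<Xi>" for y
  proof -
    have "(\<lambda>z::real\<times>real. (fst z, snd z, y)) \<in> borel \<rightarrow>\<^sub>M borel"
      by (intro borel_measurable_continuous_onI continuous_intros)
    then have "(\<lambda>z::real\<times>real. (fst z, snd z, y)) \<in> restrict_space borel ({0..T} \<times> UNIV) \<rightarrow>\<^sub>M restrict_space borel ({0..T} \<times> UNIV \<times> \<Xi>)"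
      using y by (intro measurable_restrict_space2 measurable_restrict_space1) (auto simp: space_restrict_space)
    from measurable_compose[OF this u_measT] show ?thesis by (simp add: split_beta')
  qed
  have u0_meas_y: "(\<lambda>x. u0 x y) \<in> borel_measurable borel" if y: "y \<in> \<Xi>" for y
  proof -
    have "Pair y \<in> borel \<rightarrow>\<^sub>M P \<Otimes>\<^sub>M borel" using y by (simp add: space_P)
    from measurable_compose[OF this u0_meas2] show ?thesis by simp
  qed
  \<comment> \<open>The factor \<open>Kexp\<close> is the same for all \<open>y\<close>, so it can
    leave the integral over \<open>y\<close> below.\<close>
  have path: "AE y in P. X y \<le> Kexp * (ennreal (inverse C\<^sub>l) * (ER y + ennreal C\<^sub>u * E0 y))"
    using sol VC Lt_AE \<open>AE y in P. AE (t, x) in slab T. u t x y \<in> \<C> \<and> usts t x y \<in> \<C>\<close> AE_space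
  proof eventually_elim
    case (elim y)
    have y: "y \<in> \<Xi>" using elim(5) by (simp add: space_P)
    have uC: "AE (t, x) in slab T. u t x y \<in> \<C>" using elim(4) by eventually_elim auto
    have Vt: "AE (t, x) in slab T. ((\<lambda>s. V y (s, x)) has_vector_derivative Vt y (t, x)) (at t)"
      and Vx: "AE (t, x) in slab T. ((\<lambda>z. V y (t, z)) has_vector_derivative Vx y (t, x)) (at x)"
      using good_slab by (auto elim!: eventually_mono)
    have ER_y: "(\<integral>\<^sup>+z. ennreal ((norm (Vt y z + D1 f (V y z) (Vx y z)))\<^sup>2) * indicator {0<..<s} (fst z) \<partial>slab T) = ER y"
    proof -
      have Rs_y: "(\<lambda>z. Rs y z) \<in> borel_measurable borel"
      proof -
        have "Pair y \<in> borel \<rightarrow>\<^sub>M P \<Otimes>\<^sub>M borel" using y by (simp add: space_P)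
        from measurable_compose[OF this Rs_meas] show ?thesis by simp
      qed
      have ind: "(\<lambda>z::real\<times>real. indicator {0<..<s} (fst z) :: ennreal) \<in> borel_measurable borel"
        by (rule measurable_compose[OF borel_measurable_fst]) measurable
      have "(\<lambda>z. ennreal ((norm (Rs y z))\<^sup>2) * indicator {0<..<s} (fst z)) \<in> borel_measurable (slab T)"
        using Rs_y by (intro measurable_slab borel_measurable_times_ennreal ind) measurable
      from nn_integral_slab[OF this] show ?thesis
        unfolding ER_def Rs_eq[OF elim(2)[rule_format], symmetric]
        using s by (auto intro!: nn_integral_cong simp: indicator_def)
    qed
    show ?case
      using pathwise_stability[OF T elim(1)[THEN conjunct1] elim(1)[THEN conjunct2] u_meas_y[OF y] u0_meas_y[OF y] uC
          V_lip elim(2)[rule_format] VD_meas VD_le Vt Vx Lt_meas elim(3) s]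
      unfolding ER_y X_def Kexp_def E0_def .
  qed
  \<comment> \<open>\<open>residual\<close> is formed with \<open>vector_derivative\<close>, whose
    value is arbitrary where no derivative exists; off a null set it agrees with the measurable
    \<open>Rs\<close>.\<close>
  have ER_res: "AE y in P. (\<integral>\<^sup>+(t, x). ennreal ((norm (residual f usts t x y))\<^sup>2) \<partial>slab s) = ER y"
    using VC AE_space
  proof eventually_elim
    case (elim y)
    have y: "y \<in> \<Xi>" using elim(2) by (simp add: space_P)
    have "AE z in slab T. residual f usts (fst z) (snd z) y = Rs y z"
      using good_slab AE_space
    proof eventually_elim
      case (elim z)
      obtain t x where z: "z = (t, x)" by force
      have t: "t \<in> {0<..<T}" using elim(2) z by auto
      have Vt: "((\<lambda>s. V y (s, x)) has_vector_derivative Vt y z) (at t)"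
        and Vx: "((\<lambda>x. V y (t, x)) has_vector_derivative Vx y z) (at x)"
        using elim(1) by (auto simp: z)
      have VU: "V y z \<in> \<U>" using \<open>\<forall>z. V y z \<in> \<C>\<close> C_sub_U by blast
      have 1: "((\<lambda>s. usts s x y) has_vector_derivative Vt y z) (at t)"
        by (rule has_vector_derivative_transform_within_open[OF Vt, of "{0<..<T}"]) (use t usts_eq in auto)
      have "((\<lambda>r. f (V y (t, r))) has_vector_derivative D1 f (V y z) (Vx y z)) (at x)"
        using has_vector_derivative_chain[OF Vx, of f] derivs(1)[OF VU] by (simp add: z)
      then have 2: "((\<lambda>r. f (usts t r y)) has_vector_derivative D1 f (V y z) (Vx y z)) (at x)"
        using usts_eq[of t] t by simp
      show ?case
        unfolding residual_def Rs_eq[OF \<open>\<forall>z. V y z \<in> \<C>\<close>[rule_format]]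
        using vector_derivative_at[OF 1] vector_derivative_at[OF 2] by (simp add: z)
    qed
    then have "AE z in slab s. residual f usts (fst z) (snd z) y = Rs y z" using s(2) by (rule AE_slab_mono)
    then have "(\<integral>\<^sup>+(t, x). ennreal ((norm (residual f usts t x y))\<^sup>2) \<partial>slab s) = (\<integral>\<^sup>+z. ennreal ((norm (Rs y z))\<^sup>2) \<partial>slab s)"
      by (intro nn_integral_cong_AE) (auto elim!: eventually_mono)
    also have "\<dots> = ER y"
    proof -
      have "Pair y \<in> borel \<rightarrow>\<^sub>M P \<Otimes>\<^sub>M borel" using y by (simp add: space_P)
      from measurable_compose[OF this Rs_meas] have "(\<lambda>z. Rs y z) \<in> borel_measurable borel" by simp
      then have "(\<lambda>z. ennreal ((norm (Rs y z))\<^sup>2)) \<in> borel_measurable (slab s)"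
        by (intro measurable_slab) measurable
      from nn_integral_slab[OF this] show ?thesis by (simp add: ER_def)
    qed
    finally show ?case .
  qed
  have tri: "(\<integral>\<^sup>+x. ennreal ((norm (u s x y - uhn x y))\<^sup>2) \<partial>lborel) \<le> 2 * X y + 2 * Y y" if y: "y \<in> \<Xi>" for y
  proof -
    have [measurable]: "(\<lambda>x. u s x y) \<in> borel_measurable borel"
    proof -
      have "(\<lambda>x::real. (s, x)) \<in> borel \<rightarrow>\<^sub>M restrict_space borel ({0..T} \<times> UNIV)"
        by (rule measurable_restrict_space2[OF _ borel_slices(2)]) (use s in auto)
      from measurable_compose[OF this u_meas_y[OF y]] show ?thesis by simp
    qed
    have [measurable]: "(\<lambda>x. V y (s, x)) \<in> borel_measurable borel"
      by (intro borel_measurable_continuous_onI lipschitz_on_continuous_on[OF lipschitz_slice(2)[OF V_lip]])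
    have [measurable]: "(\<lambda>x. uhn x y) \<in> borel_measurable borel"
      unfolding uhn_eq using uh_meas by (intro borel_measurable_sum borel_measurable_scaleR borel_measurable_const) auto
    have "(\<integral>\<^sup>+x. ennreal ((norm (u s x y - uhn x y))\<^sup>2) \<partial>lborel) \<le>
        (\<integral>\<^sup>+x. 2 * ennreal ((norm (u s x y - V y (s, x)))\<^sup>2) + 2 * ennreal ((norm (V y (s, x) - uhn x y))\<^sup>2) \<partial>lborel)"
    proof (rule nn_integral_mono)
      fix x
      have "ennreal ((norm (u s x y - uhn x y))\<^sup>2)
          \<le> ennreal (2 * (norm (u s x y - V y (s, x)))\<^sup>2 + 2 * (norm (V y (s, x) - uhn x y))\<^sup>2)"
        by (intro ennreal_leI norm_diff_square_le)
      then show "ennreal ((norm (u s x y - uhn x y))\<^sup>2)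
          \<le> 2 * ennreal ((norm (u s x y - V y (s, x)))\<^sup>2) + 2 * ennreal ((norm (V y (s, x) - uhn x y))\<^sup>2)"
        by (simp add: ennreal_plus ennreal_mult)
    qed
    also have "\<dots> = 2 * X y + 2 * Y y"
      unfolding X_def Y_def by (subst nn_integral_add) (auto simp: nn_integral_cmult)
    finally show ?thesis .
  qed
  have "(norm_space_stoch 2 2 P (\<lambda>x y. u (ts n) x y - uhn x y))\<^sup>2
      = (\<integral>\<^sup>+y. \<integral>\<^sup>+x. ennreal ((norm (u s x y - uhn x y))\<^sup>2) \<partial>lborel \<partial>P)"
    unfolding norm_space_stoch_2 s_def ..
  also have "\<dots> \<le> (\<integral>\<^sup>+y. 2 * (Kexp * (ennreal (inverse C\<^sub>l) * (ER y + ennreal C\<^sub>u * E0 y))) + 2 * Y y \<partial>P)"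
  proof (rule nn_integral_mono_AE, use path AE_space in eventually_elim)
    case (elim y)
    then have "2 * X y + 2 * Y y \<le> 2 * (Kexp * (ennreal (inverse C\<^sub>l) * (ER y + ennreal C\<^sub>u * E0 y))) + 2 * Y y"
      by (intro add_right_mono mult_left_mono) auto
    then show ?case using tri[of y] elim(2) space_P by (auto intro: order_trans)
  qed
  also have "\<dots> = 2 * (Kexp * (ennreal (inverse C\<^sub>l) * ((\<integral>\<^sup>+y. ER y \<partial>P) + ennreal C\<^sub>u * (\<integral>\<^sup>+y. E0 y \<partial>P)))) + 2 * (\<integral>\<^sup>+y. Y y \<partial>P)"
    by (simp add: nn_integral_add nn_integral_cmult)
  also have "(\<integral>\<^sup>+y. ER y \<partial>P) = (norm_space_time_stoch 2 2 s P (residual f usts))\<^sup>2"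
    unfolding norm_space_time_stoch_2 using ER_res by (intro nn_integral_cong_AE) (auto elim!: eventually_mono)
  also have "(\<integral>\<^sup>+y. E0 y \<partial>P) = (norm_space_stoch 2 2 P (\<lambda>x y. u0 x y - usts 0 x y))\<^sup>2"
    unfolding norm_space_stoch_2 E0_def using usts_eq[of 0] T by simp
  also have "(\<integral>\<^sup>+y. Y y \<partial>P) = (norm_space_stoch 2 2 P (\<lambda>x y. usts s x y - uhn x y))\<^sup>2"
    unfolding norm_space_stoch_2 Y_def using usts_eq[of s] s by simp
  finally have "(norm_space_stoch 2 2 P (\<lambda>x y. u (ts n) x y - uhn x y))\<^sup>2
      \<le> 2 * (norm_space_stoch 2 2 P (\<lambda>x y. usts s x y - uhn x y))\<^sup>2
        + 2 * ennreal (inverse C\<^sub>l) * ((norm_space_time_stoch 2 2 s P (residual f usts))\<^sup>2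
           + ennreal C\<^sub>u * (norm_space_stoch 2 2 P (\<lambda>x y. u0 x y - usts 0 x y))\<^sup>2) * Kexp"
    by (simp add: ac_simps)
  also have "\<dots> \<le> 2 * (norm_space_stoch 2 2 P (\<lambda>x y. usts s x y - uhn x y))\<^sup>2
        + 2 * ennreal (inverse C\<^sub>l) * ((norm_space_time_stoch 2 2 s P (residual f usts))\<^sup>2
           + ennreal C\<^sub>u * (norm_space_stoch 2 2 P (\<lambda>x y. u0 x y - usts 0 x y))\<^sup>2)
        * enn_exp (ennreal (inverse C\<^sub>l)
            * (\<integral>\<^sup>+ t\<in>{0<..<s}.
                 (ennreal (C\<^sub>u * C\<^sub>f)
                    * sup_norm_space_stoch P (\<lambda>x y. vector_derivative (\<lambda>z. usts t z y) (at x))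
                  + ennreal (C\<^sub>u\<^sup>2)) \<partial>lborel))"
    by (intro add_left_mono mult_left_mono Kexp_le) simp
  finally show ?thesis unfolding s_def .
qed

end
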